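(* Let $G=(X,E)$ be a symmetric 2-structure and $\mathcal{I}$ an involution of its colours without fixed point. The family $\mathcal{F}\subseteq 2^X$ of involution modules of $G$ (with respect to $\mathcal{I}$) is a partitive crossing family, and hence it has a unique tree representation of size $O(|X|)$.
   Context: A (symmetric) 2-structure is a pair $G=(X,E)$ with $X$ finite and $E:X^2\to\mathbb{N}$ symmetric; its colour set is $C=\{E(u,v):u\neq v\}$. For $s\in X$, $i\in C$, $X'\subseteq X$, $N^i_s(X')=\{x\in X':E(s,x)=i\}$. Given an involution $\mathcal{I}$ of $C$ without fixed point, $U\subseteq X$ is an involution module if for all $u,v\in U$, either $N^i_u(X\setminus U)=N^{\mathcal{I}(i)}_v(X\setminus U)$ for all $i\in C$, or $N^i_u(X\setminus U)=N^{i}_v(X\setminus U)$ for all $i\in C$. Two sets $A,B\subseteq X$ are crossing if $A\cap B$, $A\setminus B$, $B\setminus A$ are nonempty and $A\cup B\neq X$. A family $\mathcal{F}\subseteq 2^X$ is a partitive crossing family if $X,\emptyset\in\mathcal{F}$ and for any crossing $A,B\in\mathcal{F}$, the sets $A\cap B$, $A\cup B$, $A\setminus B$ and $A\triangle B$ belong to $\mathcal{F}$. A tree representation of such a family is an unrooted tree, some of whose edges are oriented, whose leaves are the elements of $X$ and whose internal nodes are labelled complete or prime, such that the members of $\mathcal{F}$ are exactly the following sets: for a node $N$ with in-neighbours $N_1,\dots,N_k$, writing $X_i$ for the set of leaves whose path to $N$ passes through $N_i$, if $N$ is complete, every union $\bigcup_{i\in I}X_i$ with $I\subset\{1,\dots,k\}$,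 $1<|I|<k$; if $N$ is prime, every $X_i$; and for every arc $(N_1,N_2)$, the set of leaves on the $N_1$ side belongs to $\mathcal{F}$.
   Formalization: Uniqueness is up to isomorphism fixing leaves, among reduced tree representations only (fewest nodes, no oriented edge can be made unoriented, no complete node can be made prime), since literal uniqueness fails; an unoriented edge counts as both arcs, and ∅ and X are added to the represented sets. *)

theory Defs
  imports Main
begin

definition symmetric_2_structure :: "'a set \<Rightarrow> ('a \<Rightarrow> 'a \<Rightarrow> nat) \<Rightarrow> bool" where
  "symmetric_2_structure X E \<longleftrightarrow> finite X \<and> (\<forall>u\<in>X. \<forall>v\<in>X. E u v = E v u)"

definition colours :: "'a set \<Rightarrow> ('a \<Rightarrow> 'a \<Rightarrow> nat) \<Rightarrow> nat set" where
  "colours X E = {E u v | u v. u \<in> X \<and> v \<in> X \<and> u \<noteq> v}"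

definition involution_without_fixed_point :: "nat set \<Rightarrow> (nat \<Rightarrow> nat) \<Rightarrow> bool" where
  "involution_without_fixed_point C I \<longleftrightarrow> (\<forall>i\<in>C. I i \<in> C \<and> I (I i) = i \<and> I i \<noteq> i)"

definition colour_nbhd :: "('a \<Rightarrow> 'a \<Rightarrow> nat) \<Rightarrow> nat \<Rightarrow> 'a \<Rightarrow> 'a set \<Rightarrow> 'a set" where
  "colour_nbhd E i s X' = {x \<in> X'. E s x = i}"

definition involution_module ::
  "'a set \<Rightarrow> ('a \<Rightarrow> 'a \<Rightarrow> nat) \<Rightarrow> (nat \<Rightarrow> nat) \<Rightarrow> 'a set \<Rightarrow> bool" where
  "involution_module X E I U \<longleftrightarrow> U \<subseteq> X \<and>
    (\<forall>u\<in>U. \<forall>v\<in>U.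
      (\<forall>i\<in>colours X E. colour_nbhd E i u (X - U) = colour_nbhd E (I i) v (X - U)) \<or>
      (\<forall>i\<in>colours X E. colour_nbhd E i u (X - U) = colour_nbhd E i v (X - U)))"

definition involution_modules ::
  "'a set \<Rightarrow> ('a \<Rightarrow> 'a \<Rightarrow> nat) \<Rightarrow> (nat \<Rightarrow> nat) \<Rightarrow> 'a set set" where
  "involution_modules X E I = {U. involution_module X E I U}"

definition crossing :: "'a set \<Rightarrow> 'a set \<Rightarrow> 'a set \<Rightarrow> bool" where
  "crossing X A B \<longleftrightarrow> A \<inter> B \<noteq> {} \<and> A - B \<noteq> {} \<and> B - A \<noteq> {} \<and> A \<union> B \<noteq> X"

definition partitive_crossing_family :: "'a set \<Rightarrow> 'a set set \<Rightarrow> bool" where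
  "partitive_crossing_family X F \<longleftrightarrow> F \<subseteq> Pow X \<and> X \<in> F \<and> {} \<in> F \<and>
    (\<forall>A\<in>F. \<forall>B\<in>F. crossing X A B \<longrightarrow>
      A \<inter> B \<in> F \<and> A \<union> B \<in> F \<and> A - B \<in> F \<and> (A - B) \<union> (B - A) \<in> F)"


text \<open>
  Partially oriented trees. Every edge of the tree carries at least one arc: an oriented edge
  carries exactly one, and an unoriented edge is encoded by the pair of opposite arcs. Internal
  nodes outside \<open>complete_nodes\<close> are the prime ones.
\<close>

datatype 'a node = Leaf 'a | Inner nat

record 'a otree =
  nodes :: "'a node set"
  arcs :: "('a node \<times> 'a node) set"
  complete_nodes :: "'a node set"

definition adjacent :: "'a otree \<Rightarrow> 'a node \<Rightarrow> 'a node \<Rightarrow> bool" where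
  "adjacent T u v \<longleftrightarrow> (u, v) \<in> arcs T \<or> (v, u) \<in> arcs T"

definition simple_path :: "'a otree \<Rightarrow> 'a node \<Rightarrow> 'a node list \<Rightarrow> 'a node \<Rightarrow> bool" where
  "simple_path T u p v \<longleftrightarrow> p \<noteq> [] \<and> hd p = u \<and> last p = v \<and> set p \<subseteq> nodes T \<and> distinct p \<and>
    successively (adjacent T) p"

text \<open>The empty tree is admitted; it is the one that represents the case of an empty ground set.\<close>

definition oriented_tree :: "'a otree \<Rightarrow> bool" where
  "oriented_tree T \<longleftrightarrow> finite (nodes T) \<and> arcs T \<subseteq> nodes T \<times> nodes T \<and>
    (\<forall>v. (v, v) \<notin> arcs T) \<and>
    (\<forall>u\<in>nodes T. \<forall>v\<in>nodes T. \<exists>!p. simple_path T u p v)"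

definition leaves :: "'a otree \<Rightarrow> 'a node set" where
  "leaves T = {v \<in> nodes T. card {w. adjacent T v w} \<le> 1}"

definition internal_nodes :: "'a otree \<Rightarrow> 'a node set" where
  "internal_nodes T = nodes T - leaves T"

definition prime_nodes :: "'a otree \<Rightarrow> 'a node set" where
  "prime_nodes T = internal_nodes T - complete_nodes T"

definition in_neighbours :: "'a otree \<Rightarrow> 'a node \<Rightarrow> 'a node set" where
  "in_neighbours T v = {u. (u, v) \<in> arcs T}"

text \<open>
  The leaves whose path to \<open>v\<close> passes through \<open>u\<close>; for adjacent \<open>u\<close>, \<open>v\<close> these are the leaves
  on the \<open>u\<close> side of the edge.
\<close>

definition side :: "'a otree \<Rightarrow> 'a node \<Rightarrow> 'a node \<Rightarrow> 'a set" where
  "side T u v = {x. Leaf x \<in> leaves T \<and> (\<exists>p. simple_path T (Leaf x) p v \<and> u \<in> set p)}"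

definition represented_sets :: "'a otree \<Rightarrow> 'a set set" where
  "represented_sets T =
     {(\<Union>u\<in>J. side T u v) | v J. v \<in> complete_nodes T \<and> J \<subseteq> in_neighbours T v \<and>
        1 < card J \<and> card J < card (in_neighbours T v)}
   \<union> {side T u v | u v. v \<in> prime_nodes T \<and> u \<in> in_neighbours T v}
   \<union> {side T u v | u v. (u, v) \<in> arcs T}"

text \<open>The trivial members, the empty set and the ground set, are not encoded by the tree.\<close>

definition tree_representation :: "'a set \<Rightarrow> 'a set set \<Rightarrow> 'a otree \<Rightarrow> bool" where
  "tree_representation X F T \<longleftrightarrow> oriented_tree T \<and>
    leaves T = Leaf ` X \<and> internal_nodes T \<subseteq> range Inner \<and>
    complete_nodes T \<subseteq> internal_nodes T \<and>
    F = represented_sets T \<union> {{}, X}"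

text \<open>
  A family never determines a representation outright: an edge may be subdivided, a node whose
  label contributes no set may carry either label, and an arc whose set is also produced by a
  complete node may be dropped. Uniqueness refers to representations without anything superfluous:
  the number of nodes is minimum, no oriented edge can be made unoriented, and no complete node
  can be relabelled prime. A degree bound of three on internal nodes is not an alternative. Let
  the edges within \<open>{1, 2, 3}\<close> have colour \<open>a\<close>, those between \<open>{1, 2, 3}\<close> and \<open>{4, 5}\<close> colour
  \<open>b\<close>, and the edge \<open>{4, 5}\<close> colour \<open>a\<close>, where \<open>b\<close> is neither \<open>a\<close> nor its image (both images
  can be made to occur by applying the involution to all colours at one vertex, which does not
  affect the modules). Every subset of \<open>{1, 2, 3}\<close> is a module and so is \<open>{4, 5}\<close>, but
  \<open>{1, 4, 5}\<close> is not. Hence the complete node with in-neighbours 1, 2, 3 must not have the node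
  above 4 and 5 as an in-neighbour, and a node of degree two is needed to encode both
  \<open>{1, 2, 3}\<close> and \<open>{4, 5}\<close>.
\<close>

definition reduced_tree_representation :: "'a set \<Rightarrow> 'a set set \<Rightarrow> 'a otree \<Rightarrow> bool" where
  "reduced_tree_representation X F T \<longleftrightarrow> tree_representation X F T \<and>
    (\<forall>T'. tree_representation X F T' \<longrightarrow> card (nodes T) \<le> card (nodes T')) \<and>
    (\<forall>u v. (u, v) \<in> arcs T \<and> (v, u) \<notin> arcs T \<longrightarrow>
      \<not> tree_representation X F (T\<lparr>arcs := insert (v, u) (arcs T)\<rparr>)) \<and>
    (\<forall>v\<in>complete_nodes T.
      \<not> tree_representation X F (T\<lparr>complete_nodes := complete_nodes T - {v}\<rparr>))"

definition otree_iso :: "'a otree \<Rightarrow> 'a otree \<Rightarrow> bool" where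
  "otree_iso T T' \<longleftrightarrow> (\<exists>f. bij_betw f (nodes T) (nodes T') \<and>
    (\<forall>x. Leaf x \<in> nodes T \<longrightarrow> f (Leaf x) = Leaf x) \<and>
    (\<forall>u\<in>nodes T. \<forall>v\<in>nodes T. (u, v) \<in> arcs T \<longleftrightarrow> (f u, f v) \<in> arcs T') \<and>
    (\<forall>v\<in>nodes T. v \<in> complete_nodes T \<longleftrightarrow> f v \<in> complete_nodes T'))"

definition otree_size :: "'a otree \<Rightarrow> nat" where
  "otree_size T = card (nodes T) + card (arcs T)"

end

theory Submission
  imports Defs
begin

text \<open>
  Crossing modules are compared at a common outside vertex: as the involution has no fixed point,
  such a vertex determines whether two vertices look alike or twisted, so all local comparisons
  fit together.

  For a partitive crossing family, the splits that no member crosses are the edges of a tree. Around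
  a node of degree at least three the members form a family in which every non-trivial member is
  crossed; such a family contains no non-trivial union of sides, or all of them, or exactly those
  avoiding one distinguished side (a rooted node). Conversely, in any representation every edge is
  an uncrossed split and every uncrossed split is an edge, so the tree is determined up to nodes of
  degree two. Those are forced exactly on edges which leave a rooted node towards its distinguished
  side \<open>R\<close>, where \<open>R\<close> is a member that the node at the other end does not produce as a union. A node
  is therefore identified by the family of sides around it, and in a reduced representation the
  arcs and the complete labels can be read off from these families.
\<close>

section \<open>Involution modules form a partitive crossing family\<close>

text \<open>The uniqueness argument rests on a count. Every element of \<open>codes\<close> is the
  family of sides at some node of every representation, and the canonical tree has exactly one node
  per code. Hence in a representation with the minimum number of nodes \<open>node_code\<close> is a
  bijection onto \<open>codes\<close>, and two such bijections compose to the isomorphism.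

  The main obstacle is that a crossing family need not be closed under complement: an edge only
  guarantees that one of its two sides is a member. So splits are treated symmetrically in
  \<open>S\<close> and \<open>X - S\<close>, and only afterwards is it asked which of the two lies
  in \<open>F\<close>.

  The trees are unrooted, but every argument about paths is made after rooting at some leaf
  \<open>r\<close>; the sides of an edge are then the leaves below a node and the complement of this
  set, told apart by membership of \<open>r\<close>.

  The constant 12 is 4 + 2 * 4: at most \<open>4 * card X\<close> nodes, and at most two arcs for
  the parent edge of each node. Ground sets with at most one element are treated separately, since
  there a singleton is not a proper side of any edge.\<close>

locale coloured_structure =
  fixes X :: "'a set" and E :: "'a \<Rightarrow> 'a \<Rightarrow> nat" and I :: "nat \<Rightarrow> nat"
  assumes structure_ok: "symmetric_2_structure X E"
    and involution_ok: "involution_without_fixed_point (colours X E) I"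
begin

text \<open>This is the action of the group of order two on colours, with \<open>True\<close> acting
  as \<open>I\<close>; composition of twists is exclusive or, written
  \<open>s \<noteq> t\<close>.\<close>

definition twist :: "bool \<Rightarrow> nat \<Rightarrow> nat" where
  "twist s i = (if s then I i else i)"

lemma finite_ground: "finite X"
  using structure_ok by (simp add: symmetric_2_structure_def)

lemma E_sym: "u \<in> X \<Longrightarrow> v \<in> X \<Longrightarrow> E u v = E v u"
  using structure_ok by (simp add: symmetric_2_structure_def)

lemma E_colour: "u \<in> X \<Longrightarrow> v \<in> X \<Longrightarrow> u \<noteq> v \<Longrightarrow> E u v \<in> colours X E"
  by (auto simp: colours_def)

lemma twist_twist: "i \<in> colours X E \<Longrightarrow> twist s (twist t i) = twist (s \<noteq> t) i"
  using involution_ok by (auto simp: twist_def involution_without_fixed_point_def)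

text \<open>The action is free, because \<open>I\<close> moves every colour.\<close>

lemma twist_inj: "i \<in> colours X E \<Longrightarrow> twist s i = twist t i \<Longrightarrow> s = t"
  using involution_ok
  by (cases s; cases t; force simp: twist_def involution_without_fixed_point_def)

definition twisted :: "bool \<Rightarrow> 'a \<Rightarrow> 'a \<Rightarrow> 'a set \<Rightarrow> bool" where
  "twisted s u v Y \<longleftrightarrow> (\<forall>x\<in>Y. E u x = twist s (E v x))"

text \<open>The colour neighbourhoods of a vertex of \<open>U\<close> partition
  \<open>X - U\<close>, so a family of equations between neighbourhoods amounts to one equation for
  each outside vertex. All colours involved belong to distinct vertices, hence to
  \<open>colours X E\<close>, where \<open>I\<close> is an involution.\<close>

lemma involution_module_iff:
  "involution_module X E I U \<longleftrightarrow>
     U \<subseteq> X \<and> (\<forall>u\<in>U. \<forall>v\<in>U. \<exists>s. twisted s u v (X - U))"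
proof -
  have "((\<forall>i\<in>colours X E. colour_nbhd E i u (X - U) = colour_nbhd E (I i) v (X - U)) \<or>
      (\<forall>i\<in>colours X E. colour_nbhd E i u (X - U) = colour_nbhd E i v (X - U)))
      \<longleftrightarrow> (\<exists>s. twisted s u v (X - U))" if U: "U \<subseteq> X" "u \<in> U" "v \<in> U" for u v
  proof -
    have cu: "E u x \<in> colours X E" "E v x \<in> colours X E" if "x \<in> X - U" for x
      using that U by (auto intro!: E_colour)
    have inv: "I (I i) = i" "I i \<in> colours X E" if "i \<in> colours X E" for i
      using that involution_ok by (auto simp: involution_without_fixed_point_def)
    have "(\<forall>i\<in>colours X E. colour_nbhd E i u (X - U) = colour_nbhd E (I i) v (X - U))
      \<longleftrightarrow> twisted True u v (X - U)"
    proof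
      assume L: "\<forall>i\<in>colours X E. colour_nbhd E i u (X - U) = colour_nbhd E (I i) v (X - U)"
      have "E u x = I (E v x)" if x: "x \<in> X - U" for x
      proof -
        have "x \<in> colour_nbhd E (E u x) u (X - U)"
          using x by (auto simp: colour_nbhd_def)
        then have "E v x = I (E u x)" using L cu[OF x] by (auto simp: colour_nbhd_def)
        then show ?thesis using inv cu[OF x] by auto
      qed
      then show "twisted True u v (X - U)" by (simp add: twisted_def twist_def)
    next
      assume "twisted True u v (X - U)"
      then have R: "\<And>x. x \<in> X - U \<Longrightarrow> E u x = I (E v x)" by (simp add: twisted_def twist_def)
      show "\<forall>i\<in>colours X E. colour_nbhd E i u (X - U) = colour_nbhd E (I i) v (X - U)"
        using R inv cu by (fastforce simp: colour_nbhd_def)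
    qed
    moreover have "(\<forall>i\<in>colours X E. colour_nbhd E i u (X - U) = colour_nbhd E i v (X - U))
      \<longleftrightarrow> twisted False u v (X - U)"
      using cu by (fastforce simp: colour_nbhd_def twisted_def twist_def)
    ultimately show ?thesis by (metis (full_types))
  qed
  then show ?thesis unfolding involution_module_def by (safe; blast)
qed

lemma twistedD: "twisted s u v Y \<Longrightarrow> x \<in> Y \<Longrightarrow> E u x = twist s (E v x)"
  by (simp add: twisted_def)

lemma module_twist:
  "involution_module X E I U \<Longrightarrow> u \<in> U \<Longrightarrow> v \<in> U \<Longrightarrow> \<exists>s. twisted s u v (X - U)"
  by (simp add: involution_module_iff)

text \<open>The crossing supplies one vertex in each of the four corners. The outside vertex
  \<open>z\<close> serves the intersection, the common vertex \<open>w\<close> the union,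
  \<open>a\<close> and \<open>b\<close> the differences, and the mixed case of the symmetric
  difference needs both \<open>w\<close> and \<open>z\<close>.\<close>

lemma partitive_crossing_family_modules:
  "partitive_crossing_family X (involution_modules X E I)"
  unfolding partitive_crossing_family_def
proof (intro conjI ballI impI)
  show "involution_modules X E I \<subseteq> Pow X" "X \<in> involution_modules X E I"
    "{} \<in> involution_modules X E I"
    by (auto simp: involution_modules_def involution_module_iff twisted_def)
next
  fix A B assume "A \<in> involution_modules X E I" "B \<in> involution_modules X E I"
    and cr: "crossing X A B"
  then have A: "involution_module X E I A" and B: "involution_module X E I B"
    by (auto simp: involution_modules_def)
  then have AX: "A \<subseteq> X" and BX: "B \<subseteq> X" by (auto simp: involution_module_iff)
  from cr AX BX obtain w a b z where w: "w \<in> A" "w \<in> B" and a: "a \<in> A" "a \<notin> B"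
    and b: "b \<in> B" "b \<notin> A" and z: "z \<in> X" "z \<notin> A" "z \<notin> B"
    unfolding crossing_def by blast
  have col: "E u v \<in> colours X E" if "u \<in> X" "v \<in> X" "u \<noteq> v" for u v
    using that by (rule E_colour)
  note sub = AX BX
  have int: "\<exists>s. twisted s u v (X - A \<inter> B)" if uv: "u \<in> A \<inter> B" "v \<in> A \<inter> B" for u v
  proof -
    obtain s t where s: "twisted s u v (X - A)" and t: "twisted t u v (X - B)"
      using module_twist[OF A, of u v] module_twist[OF B, of u v] uv by blast
    \<comment> \<open>The vertex \<open>z\<close> lies outside both sets and is seen with either
      twist, so the twists agree and the two comparisons can be glued.\<close>
    have "E u z = twist s (E v z)" "E u z = twist t (E v z)"
      using s t z by (auto dest: twistedD)
    moreover have "E v z \<in> colours X E" using uv z sub by (auto intro!: col)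
    ultimately have "s = t" using twist_inj by metis
    with s t have "twisted s u v (X - A \<inter> B)" by (auto simp: twisted_def)
    then show ?thesis ..
  qed
  show "A \<inter> B \<in> involution_modules X E I"
    using int sub by (auto simp: involution_modules_def involution_module_iff)
  \<comment> \<open>The vertex \<open>v\<close> is kept out of \<open>Y\<close> because
    \<open>I\<close> is only known to be an involution on colours of distinct vertices.\<close>
  have tr: "twisted (s \<noteq> t) u v Y" if "twisted s u w' Y" "twisted t w' v Y" "v \<in> X" "Y \<subseteq> X - {v}"
    for s t u v w' Y
    unfolding twisted_def
  proof
    fix x assume x: "x \<in> Y"
    then have "E v x \<in> colours X E" using that by (intro col) auto
    then show "E u x = twist (s \<noteq> t) (E v x)"
      using that x twist_twist by (simp add: twisted_def)
  qed
  have tww: "\<exists>s. twisted s u w (X - (A \<union> B))" if u: "u \<in> A \<union> B" for u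
  proof -
    obtain s where "twisted s u w (X - A) \<or> twisted s u w (X - B)"
      using module_twist[OF A, of u w] module_twist[OF B, of u w] u w by blast
    then show ?thesis by (auto simp: twisted_def)
  qed
  have twv: "\<exists>s. twisted s w u (X - (A \<union> B))" if u: "u \<in> A \<union> B" for u
  proof -
    obtain s where "twisted s w u (X - A) \<or> twisted s w u (X - B)"
      using module_twist[OF A, of w u] module_twist[OF B, of w u] u w by blast
    then show ?thesis by (auto simp: twisted_def)
  qed
  have un: "\<exists>s. twisted s u v (X - (A \<union> B))" if uv: "u \<in> A \<union> B" "v \<in> A \<union> B" for u v
  proof -
    obtain s where s: "twisted s u w (X - (A \<union> B))" using tww[OF uv(1)] ..
    obtain t where t: "twisted t w v (X - (A \<union> B))" using twv[OF uv(2)] ..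
    have "twisted (s \<noteq> t) u v (X - (A \<union> B))" using uv sub by (intro tr[OF s t]) auto
    then show ?thesis ..
  qed
  show "A \<union> B \<in> involution_modules X E I"
    using un sub by (auto simp: involution_modules_def involution_module_iff)
  text \<open>For \<open>x, y \<in> C\<close> the colours seen from any vertex outside \<open>C\<close> differ by a twist that does
    not depend on that vertex; so a twist observed at one \<open>y \<in> C\<close> is observed on all of \<open>C\<close>.\<close>
  have spread: "E u x = twist s (E v x)"
    if Bm: "involution_module X E I C" and uv: "u \<in> X - C" "v \<in> X - C"
      and xy: "x \<in> C" "y \<in> C" and e: "E u y = twist s (E v y)" for u v x y s C
  proof -
    have CX: "C \<subseteq> X" using Bm by (simp add: involution_module_iff)
    obtain t where t: "twisted t x y (X - C)" using module_twist[OF Bm xy] ..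
    have "E u x = twist t (E u y)" "E v x = twist t (E v y)"
      using t uv xy CX E_sym by (metis Diff_iff subsetD twistedD)+
    moreover have "E v y \<in> colours X E" using uv xy CX by (intro col) auto
    moreover have "(t \<noteq> s) = (s \<noteq> t)" by auto
    ultimately show ?thesis using e by (simp add: twist_twist)
  qed
  \<comment> \<open>Compared with \<open>X - A'\<close> only vertices of \<open>B'\<close> are new.
    The vertex \<open>b'\<close> is in both regions: it carries the twist of \<open>A'\<close>, and
    \<open>spread\<close> extends this twist to all of \<open>B'\<close>.\<close>
  have dif: "\<exists>s. twisted s u v (X - (A' - B'))"
    if uv: "u \<in> A' - B'" "v \<in> A' - B'" and A': "involution_module X E I A'"
      and B': "involution_module X E I B'" and sb:
      "A' \<subseteq> X" "B' \<subseteq> X" and b': "b' \<in> B' - A'" for u v A' B' b'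
  proof -
    obtain s where s: "twisted s u v (X - A')" using module_twist[OF A'] uv by blast
    then have "E u b' = twist s (E v b')" using b' sb by (auto dest: twistedD)
    then have "E u x = twist s (E v x)" if "x \<in> B'" for x
      using spread[OF B', of u v x b' s] that uv sb b' by blast
    with s have "twisted s u v (X - (A' - B'))" by (auto simp: twisted_def)
    then show ?thesis ..
  qed
  show "A - B \<in> involution_modules X E I"
    using dif[OF _ _ A B AX BX] b sub by (auto simp: involution_modules_def involution_module_iff)
  \<comment> \<open>For \<open>x\<close> in the intersection, \<open>u\<close> is compared with
    \<open>x\<close> by a twist of \<open>A'\<close> and \<open>x\<close> with \<open>v\<close> by a
    twist of \<open>B'\<close>. Their composite applies to every vertex outside the union; reading
    the edges \<open>u x\<close>, \<open>u v\<close> and \<open>x v\<close> in turn shows that it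
    also applies at \<open>x\<close> itself. The vertex \<open>z'\<close> then shows that the
    composite does not depend on \<open>x\<close>.\<close>
  have mixed: "\<exists>s. twisted s u v (X - ((A' - B') \<union> (B' - A')))"
    if u: "u \<in> A' - B'" and v: "v \<in> B' - A'" and A': "involution_module X E I A'"
      and B': "involution_module X E I B'" and w': "w' \<in> A' \<inter> B'"
      and z': "z' \<in> X - (A' \<union> B')" for u v A' B' w' z'
  proof -
    have sb: "A' \<subseteq> X" "B' \<subseteq> X" using A' B' by (auto simp: involution_module_iff)
    have at: "\<exists>s. E u x = twist s (E v x) \<and> twisted s u v (X - (A' \<union> B'))" if x: "x \<in> A' \<inter> B'" for x
    proof -
      obtain s' where s': "twisted s' u x (X - A')" using module_twist[OF A'] u x by blast
      obtain t where t: "twisted t x v (X - B')" using module_twist[OF B'] v x by blast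
      have cv: "E v y \<in> colours X E" if "y \<in> X" "y \<noteq> v" for y
        using that v sb by (intro col) auto
      have e1: "E u v = twist s' (E x v)" using s' v sb by (auto dest: twistedD)
      have e2: "E x u = twist t (E v u)" using t u sb by (auto dest: twistedD)
      have "E u x = twist t (E u v)"
        using e2 E_sym u v x sb by (metis Diff_iff Int_iff subsetD)
      also have "\<dots> = twist t (twist s' (E v x))"
        using e1 E_sym v x sb by (metis Diff_iff Int_iff subsetD)
      also have "\<dots> = twist (t \<noteq> s') (E v x)" using cv[of x] x v sb twist_twist by blast
      finally have 1: "E u x = twist (t \<noteq> s') (E v x)" .
      have "twisted (t \<noteq> s') u v (X - (A' \<union> B'))"
        unfolding twisted_def
      proof
        fix y assume y: "y \<in> X - (A' \<union> B')"
        have "E u y = twist s' (E x y)" "E x y = twist t (E v y)"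
          using s' t y by (auto dest: twistedD)
        moreover have "E v y \<in> colours X E" using y v by (intro cv) auto
        moreover have "(s' \<noteq> t) = (t \<noteq> s')" by auto
        ultimately show "E u y = twist (t \<noteq> s') (E v y)" by (simp add: twist_twist)
      qed
      with 1 show ?thesis by blast
    qed
    obtain s where s: "twisted s u v (X - (A' \<union> B'))" using at[OF w'] by blast
    have "E u x = twist s (E v x)" if x: "x \<in> A' \<inter> B'" for x
    proof -
      obtain t where t: "E u x = twist t (E v x)" "twisted t u v (X - (A' \<union> B'))"
        using at[OF x] by blast
      have "E v z' \<in> colours X E" using z' v sb by (intro col) auto
      moreover have "twist s (E v z') = twist t (E v z')" using s t z' by (metis twistedD)
      ultimately have "s = t" by (rule twist_inj)
      with t show ?thesis by simp
    qed
    with s have "twisted s u v (X - ((A' - B') \<union> (B' - A')))" unfolding twisted_def by blast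
    then show ?thesis ..
  qed
  have one_sided: "\<exists>s. twisted s u v (X - ((A' - B') \<union> (B' - A')))"
    if "\<exists>s. twisted s u v (X - (A' - B'))" for u v A' B'
    using that by (auto simp: twisted_def)
  have "\<exists>s. twisted s u v (X - ((A - B) \<union> (B - A)))"
    if u: "u \<in> (A - B) \<union> (B - A)" and v: "v \<in> (A - B) \<union> (B - A)" for u v
  proof -
    have z': "z \<in> X - (A \<union> B)" "z \<in> X - (B \<union> A)" "w \<in> A \<inter> B" "w \<in> B \<inter> A" using z w by auto
    have sw: "(A - B) \<union> (B - A) = (B - A) \<union> (A - B)" by blast
    consider "u \<in> A - B" "v \<in> A - B" | "u \<in> A - B" "v \<in> B - A" | "u \<in> B - A" "v \<in> A - B"
      | "u \<in> B - A" "v \<in> B - A" using u v by blast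
    then show ?thesis
    proof cases
      case 1
      then show ?thesis using one_sided dif[OF 1 A B AX BX, of b] b by blast
    next
      case 2
      then show ?thesis using mixed[OF 2 A B] z' by blast
    next
      case 3
      then show ?thesis using mixed[OF 3 B A] z' unfolding sw by blast
    next
      case 4
      then show ?thesis using one_sided dif[OF 4 B A BX AX, of a] a unfolding sw by blast
    qed
  qed
  then show "(A - B) \<union> (B - A) \<in> involution_modules X E I"
    using sub by (auto simp: involution_modules_def involution_module_iff)
qed

lemma singleton_module: "x \<in> X \<Longrightarrow> {x} \<in> involution_modules X E I"
  by (auto simp: involution_modules_def involution_module_iff twisted_def twist_def
      intro!: exI[of _ False])

end

section \<open>Partitive crossing families in which every non-trivial member is crossed\<close>

text \<open>This is crossing without the condition on the union. For sets that avoid a fixed point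
  \<open>q\<close> of the ground set that condition is automatic, so overlap is then the same as
  crossing.\<close>

definition overlap :: "'a set \<Rightarrow> 'a set \<Rightarrow> bool" where
  "overlap A B \<longleftrightarrow> A \<inter> B \<noteq> {} \<and> A - B \<noteq> {} \<and> B - A \<noteq> {}"

lemma overlapI: "x \<in> A \<Longrightarrow> x \<in> B \<Longrightarrow> y \<in> A \<Longrightarrow> y \<notin> B \<Longrightarrow> z \<in> B \<Longrightarrow> z \<notin> A \<Longrightarrow> overlap A B"
  unfolding overlap_def by blast

lemma two_elements: "2 \<le> card A \<Longrightarrow> \<exists>x\<in>A. \<exists>y\<in>A. x \<noteq> y"
  by (metis card_2_iff' obtain_subset_with_card_n subset_eq)

lemma three_elements: "3 \<le> card A \<Longrightarrow> \<exists>x\<in>A. \<exists>y\<in>A. \<exists>z\<in>A. x \<noteq> y \<and> x \<noteq> z \<and> y \<noteq> z"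
  by (metis obtain_subset_with_card_n card_3_iff insert_subset)

lemma card_ge_2: "finite A \<Longrightarrow> x \<in> A \<Longrightarrow> y \<in> A \<Longrightarrow> x \<noteq> y \<Longrightarrow> 2 \<le> card A"
  using card_mono[of A "{x, y}"] by auto

text \<open>A smallest non-trivial member is a pair, and pairs in \<open>Q\<close> form a transitive
  relation. The class \<open>K\<close> of such a pair contains only members as non-empty subsets,
  and a smallest member that overlaps \<open>K\<close> leads to a contradiction unless
  \<open>K\<close> is everything.\<close>

lemma partitive_without_strong_members:
  assumes fin: "finite W" and sub: "Q \<subseteq> Pow W"
    and cl: "\<And>A B. A \<in> Q \<Longrightarrow> B \<in> Q \<Longrightarrow> overlap A B \<Longrightarrow>
      A \<inter> B \<in> Q \<and> A \<union> B \<in> Q \<and> A - B \<in> Q \<and> (A - B) \<union> (B - A) \<in> Q"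
    and sing: "\<And>x. x \<in> W \<Longrightarrow> {x} \<in> Q"
    and weak: "\<And>A. A \<in> Q \<Longrightarrow> 2 \<le> card A \<Longrightarrow> A \<noteq> W \<Longrightarrow> \<exists>B\<in>Q. overlap A B"
    and ex: "A0 \<in> Q" "2 \<le> card A0" "A0 \<noteq> W"
    and J: "J \<subseteq> W" "J \<noteq> {}"
  shows "J \<in> Q"
proof -
  have finQ: "finite A" if "A \<in> Q" for A using that sub finite_subset[OF _ fin, of A] by auto
  have small: "card B < card A" if "A \<in> Q" "B \<subseteq> A" "B \<noteq> A" for A B
    using that finQ by (intro psubset_card_mono) auto
  \<comment> \<open>Closure under symmetric difference enters here. Without it the intervals of a
    linear order would be a counterexample.\<close>
  have sd: "{x, z} \<in> Q" if "{x, y} \<in> Q" "{y, z} \<in> Q" "x \<noteq> y" "y \<noteq> z" "x \<noteq> z" for x y z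
  proof -
    have "overlap {x, y} {y, z}" using that by (intro overlapI[of y _ _ x z]) auto
    then have "({x, y} - {y, z}) \<union> ({y, z} - {x, y}) \<in> Q" using cl that by blast
    moreover have "({x, y} - {y, z}) \<union> ({y, z} - {x, y}) = {x, z}" using that by auto
    ultimately show ?thesis by simp
  qed
  \<comment> \<open>By minimality the intersection and the difference of \<open>A\<close> with a
    member that overlaps it are singletons, so \<open>A\<close> is a pair.\<close>
  obtain A where A: "A \<in> Q" "2 \<le> card A" "A \<noteq> W"
    and Amin: "\<And>C. C \<in> Q \<Longrightarrow> 2 \<le> card C \<Longrightarrow> C \<noteq> W \<Longrightarrow> card A \<le> card C"
    using ex_has_least_nat[of "\<lambda>A. A \<in> Q \<and> 2 \<le> card A \<and> A \<noteq> W" A0 card] ex by blast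
  have AW: "A \<subseteq> W" using A sub by auto
  obtain B where B: "B \<in> Q" "overlap A B" using weak A by blast
  have one: "\<exists>a. C = {a}" if "C \<in> Q" "C \<subseteq> A" "C \<noteq> A" "C \<noteq> {}" for C
  proof -
    have "card C < 2" using Amin[of C] small[OF A(1) that(2,3)] that AW by force
    moreover have "card C \<noteq> 0" using finQ that by auto
    ultimately have "card C = 1" by linarith
    then show ?thesis by (meson card_1_singletonE)
  qed
  obtain a where a: "A \<inter> B = {a}" using one[of "A \<inter> B"] cl[OF A(1) B] B(2) unfolding overlap_def by blast
  obtain b where b: "A - B = {b}" using one[of "A - B"] cl[OF A(1) B] B(2) unfolding overlap_def by blast
  have ab: "{a, b} \<in> Q" "a \<noteq> b" using A a b by (metis Int_Diff_Un insert_is_Un, blast)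
  have abW: "a \<in> W" "b \<in> W" using ab sub by auto
  define K where "K = {x \<in> W. x = a \<or> {a, x} \<in> Q}"
  have KW: "K \<subseteq> W" and abK: "a \<in> K" "b \<in> K" using ab abW by (auto simp: K_def)
  have pair: "{x, y} \<in> Q" if "x \<in> K" "y \<in> K" for x y
  proof (cases "x = y \<or> x = a \<or> y = a")
    case True
    then show ?thesis using that sing by (auto simp: K_def insert_commute)
  next
    case False
    then have "{x, a} \<in> Q" "{a, y} \<in> Q" using that by (auto simp: K_def insert_commute)
    then show ?thesis using sd False by blast
  qed
  have clique: "J \<in> Q" if "J \<subseteq> K" "J \<noteq> {}" for J
  proof -
    have "finite J" using that KW fin by (meson finite_subset)
    from this that(2,1) show ?thesis
    proof (induction rule: finite_ne_induct)
      case (singleton x)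
      then show ?case using sing KW by auto
    next
      case (insert x J)
      then obtain y where y: "y \<in> J" by auto
      have xy: "{x, y} \<in> Q" using pair insert y by auto
      show ?case
      proof (cases "J = {y}")
        case True
        then show ?thesis using xy by simp
      next
        case False
        then obtain z where "z \<in> J" "z \<noteq> y" using y by blast
        then have "overlap J {x, y}" using y insert by (intro overlapI[of y _ _ z x]) auto
        then have "J \<union> {x, y} \<in> Q" using cl insert xy by blast
        moreover have "J \<union> {x, y} = insert x J" using y by auto
        ultimately show ?thesis by simp
      qed
    qed
  qed
  \<comment> \<open>Otherwise \<open>K\<close> is a non-trivial member and is overlapped. Let
    \<open>B\<close> be a smallest member overlapping it. Then \<open>B\<close> meets
    \<open>K\<close> in one point \<open>a'\<close>, and \<open>D = B - K\<close> is a member as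
    well. If \<open>D\<close> is a single point, that point belongs to \<open>K\<close>; if not, a
    member overlapping \<open>D\<close> cuts \<open>B\<close> down to something smaller.\<close>
  have "K = W"
  proof (rule ccontr)
    assume KnW: "K \<noteq> W"
    have finK: "finite K" using KW fin by (meson finite_subset)
    have "K \<in> Q" using clique abK by blast
    moreover have "2 \<le> card K" using card_ge_2[OF finK abK] ab by blast
    ultimately obtain B0 where B0: "B0 \<in> Q" "overlap K B0" using weak KnW by blast
    define PP where "PP B \<longleftrightarrow> B \<in> Q \<and> B \<inter> K \<noteq> {} \<and> B - K \<noteq> {} \<and> K - B \<noteq> {}" for B
    have "PP B0" using B0 by (auto simp: PP_def overlap_def)
    then obtain B where B: "PP B" and Bmin: "\<And>C. PP C \<Longrightarrow> card B \<le> card C"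
      using ex_has_least_nat[of PP B0 card] by blast
    have BQ: "B \<in> Q" using B by (simp add: PP_def)
    have no: False if "PP C" "C \<subseteq> B" "C \<noteq> B" for C
      using Bmin[OF that(1)] small[OF BQ that(2,3)] by simp
    obtain a' b' where a': "a' \<in> B" "a' \<in> K" and b': "b' \<in> K" "b' \<notin> B"
      using B by (auto simp: PP_def)
    have BK: "B \<inter> K = {a'}"
    proof (rule ccontr)
      assume n: "B \<inter> K \<noteq> {a'}"
      \<comment> \<open>As a subset of \<open>K\<close>, \<open>J\<close> is a member. It takes all
        of \<open>B \<inter> K\<close> except \<open>a'\<close>, and \<open>b'\<close> makes it
        leave \<open>B\<close>, so \<open>B - J\<close> is a smaller set of the same kind as
        \<open>B\<close>.\<close>
      define J where "J = insert b' (B \<inter> K - {a'})"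
      obtain c where c: "c \<in> B \<inter> K - {a'}" using n a' by blast
      have "J \<in> Q" using b' by (intro clique) (auto simp: J_def)
      moreover have "overlap B J"
        using a' b' c by (intro overlapI[of c _ _ a' b']) (auto simp: J_def)
      ultimately have "B - J \<in> Q" using cl BQ by blast
      moreover have "B - J \<subseteq> B" "B - J \<noteq> B" using c by (auto simp: J_def)
      moreover have "a' \<in> B - J" "B - K \<subseteq> B - J" "b' \<notin> B - J" using a' b' by (auto simp: J_def)
      ultimately show False using no[of "B - J"] B a' b' unfolding PP_def by blast
    qed
    define D where "D = B - K"
    have BD: "B = insert a' D" "a' \<notin> D" using BK a' by (auto simp: D_def)
    have Dne: "D \<noteq> {}" using B by (auto simp: D_def PP_def)
    have DK: "D \<inter> K = {}" by (auto simp: D_def)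
    obtain e where e: "e \<in> D" using Dne by blast
    \<comment> \<open>Subtracting a pair inside \<open>K\<close> removes from \<open>B\<close>
      exactly its only point in \<open>K\<close>.\<close>
    have "overlap B {a', b'}" using a' b' e BD DK by (intro overlapI[of a' _ _ e b']) auto
    then have "B - {a', b'} \<in> Q" using cl BQ pair a' b' by blast
    moreover have "B - {a', b'} = D" using BD b' by auto
    ultimately have DQ: "D \<in> Q" by simp
    have DW: "D \<noteq> W" using abK DK KW by auto
    show False
    proof (cases "card D = 1")
      case True
      then obtain c where c: "D = {c}" by (meson card_1_singletonE)
      then have "{a', c} \<in> Q" using BQ BD by auto
      moreover have cW: "c \<in> W" "c \<notin> K" using c DQ sub DK by auto
      moreover have "{a, a'} \<in> Q" using pair abK a' by blast
      ultimately have "{a, c} \<in> Q" using sd[of a a' c] abK a' by (cases "a = a'") auto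
      then show False using cW by (auto simp: K_def)
    next
      case False
      moreover have "card D \<noteq> 0" using Dne finQ[OF DQ] by auto
      ultimately have "2 \<le> card D" by linarith
      then obtain B2 where B2: "B2 \<in> Q" "overlap D B2" using weak DQ DW by blast
      obtain x y z where xyz: "x \<in> D" "x \<in> B2" "y \<in> D" "y \<notin> B2" "z \<in> B2" "z \<notin> D"
        using B2(2) unfolding overlap_def by blast
      \<comment> \<open>Whichever of \<open>B \<inter> B2\<close> and \<open>B - B2\<close> keeps
        \<open>a'\<close> still overlaps \<open>K\<close> and is smaller than
        \<open>B\<close>.\<close>
      show False
      proof (cases "a' \<in> B2")
        case True
        have int: "B \<inter> B2 \<in> Q"
        proof (cases "B2 \<subseteq> B")
          case True
          then show ?thesis using B2 by (simp add: Int_absorb1)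
        next
          case False
          then have "overlap B B2" using \<open>a' \<in> B2\<close> a' xyz BD by (auto simp: overlap_def)
          then show ?thesis using cl BQ B2 by blast
        qed
        have "PP (B \<inter> B2)" unfolding PP_def
          using int a' True xyz b' DK BD by auto
        then show False using no[of "B \<inter> B2"] xyz BD by blast
      next
        case False
        have "z \<notin> B" using xyz False BD by auto
        then have "overlap B B2" using xyz BD by (intro overlapI[of x _ _ y z]) auto
        then have "B - B2 \<in> Q" using cl BQ B2 by blast
        then have "PP (B - B2)" unfolding PP_def
          using a' False xyz b' DK BD by auto
        then show False using no[of "B - B2"] xyz BD by blast
      qed
    qed
  qed
  then show ?thesis using clique J by blast
qed

section \<open>Crossing families up to complement\<close>

lemma crossing_complement:
  "A \<subseteq> X \<Longrightarrow> B \<subseteq> X \<Longrightarrow> crossing X (X - A) B \<longleftrightarrow> crossing X A B"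
  unfolding crossing_def by blast

lemma crossing_commute: "crossing X A B \<longleftrightarrow> crossing X B A"
  unfolding crossing_def by blast

lemma crossingI:
  "x \<in> A \<Longrightarrow> x \<in> B \<Longrightarrow> y \<in> A \<Longrightarrow> y \<notin> B \<Longrightarrow> z \<in> B \<Longrightarrow> z \<notin> A \<Longrightarrow> w \<in> X \<Longrightarrow> w \<notin> A \<Longrightarrow> w \<notin> B
   \<Longrightarrow> crossing X A B"
  unfolding crossing_def by blast

lemma pcf_closed:
  assumes "partitive_crossing_family X F" "A \<in> F" "B \<in> F" "crossing X A B"
  shows "A \<inter> B \<in> F" "A \<union> B \<in> F" "A - B \<in> F" "B - A \<in> F" "(A - B) \<union> (B - A) \<in> F"
  using assms crossing_commute[of X A B] unfolding partitive_crossing_family_def by blast+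

text \<open>Two crossing sets cut \<open>V\<close> into four corners. Complementing one of the sets
  permutes the corners and preserves crossing, so the four results are the same up to
  complement.\<close>

lemma pcf_complement_closed:
  assumes pcf: "partitive_crossing_family V P"
    and A: "A \<subseteq> V" "A \<in> P \<or> V - A \<in> P" and B: "B \<subseteq> V" "B \<in> P \<or> V - B \<in> P"
    and cr: "crossing V A B"
  shows "\<forall>C \<in> {A \<inter> B, A \<union> B, A - B, (A - B) \<union> (B - A)}. C \<in> P \<or> V - C \<in> P"
proof -
  define A' where "A' = (if A \<in> P then A else V - A)"
  define B' where "B' = (if B \<in> P then B else V - B)"
  have AB: "A' \<in> P" "B' \<in> P" using A B by (auto simp: A'_def B'_def)
  have "crossing V A B'" using cr crossing_complement[OF B(1) A(1)] crossing_commute[of V A]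
    by (auto simp: B'_def)
  moreover have "B' \<subseteq> V" using B by (auto simp: B'_def)
  ultimately have "crossing V A' B'" using crossing_complement[OF A(1)] by (auto simp: A'_def)
  note c = pcf_closed[OF pcf AB this]
  show ?thesis
  proof (cases "A \<in> P"; cases "B \<in> P")
    assume "A \<in> P" "B \<in> P"
    then show ?thesis using c by (simp add: A'_def B'_def)
  next
    assume "A \<in> P" "B \<notin> P"
    then have e: "A' = A" "B' = V - B" by (auto simp: A'_def B'_def)
    have "A - B = A' \<inter> B'" "V - (A - B) = V - A' \<inter> B'" "A \<inter> B = A' - B'"
      "V - (A \<union> B) = B' - A'" "V - ((A - B) \<union> (B - A)) = (A' - B') \<union> (B' - A')"
      using A B e by auto
    then show ?thesis using c by auto
  next
    assume "A \<notin> P" "B \<in> P"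
    then have e: "A' = V - A" "B' = B" by (auto simp: A'_def B'_def)
    have "V - (A - B) = A' \<union> B'" "A \<inter> B = B' - A'"
      "V - (A \<union> B) = A' - B'" "V - ((A - B) \<union> (B - A)) = (A' - B') \<union> (B' - A')"
      using A B e by auto
    then show ?thesis using c by auto
  next
    assume "A \<notin> P" "B \<notin> P"
    then have e: "A' = V - A" "B' = V - B" by (auto simp: A'_def B'_def)
    have "A - B = B' - A'" "V - (A \<inter> B) = A' \<union> B'"
      "V - (A \<union> B) = A' \<inter> B'" "(A - B) \<union> (B - A) = (A' - B') \<union> (B' - A')"
      using A B e by auto
    then show ?thesis using c by auto
  qed
qed

text \<open>Fix \<open>q\<close> outside \<open>A0\<close> and represent each split by its side
  avoiding \<open>q\<close>. On \<open>V - {q}\<close> crossing becomes overlap, and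
  \<open>partitive_without_strong_members\<close> applies to these sides.\<close>

lemma crossed_family_all_splits:
  assumes fin: "finite V" and pcf: "partitive_crossing_family V P"
    and weak: "\<And>A. A \<in> P \<Longrightarrow> 2 \<le> card A \<Longrightarrow> 2 \<le> card (V - A) \<Longrightarrow> \<exists>B\<in>P. crossing V A B"
    and ex: "A0 \<in> P" "2 \<le> card A0" "2 \<le> card (V - A0)"
    and J: "J \<subseteq> V" "2 \<le> card J" "2 \<le> card (V - J)"
  shows "J \<in> P \<or> V - J \<in> P"
proof -
  have PV: "P \<subseteq> Pow V" using pcf by (simp add: partitive_crossing_family_def)
  obtain q where q: "q \<in> V" "q \<notin> A0"
    using ex by (metis DiffE card.empty ex_in_conv not_numeral_le_zero)
  define W where "W = V - {q}"
  \<comment> \<open>Singletons and \<open>W\<close> are adjoined to meet the hypotheses on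
    \<open>Q\<close>. They overlap nothing inside \<open>W\<close>, so a member involved in an
    overlap is always a genuine split.\<close>
  define Q where "Q = {J. J \<subseteq> W \<and> J \<noteq> {} \<and> (J \<in> P \<or> V - J \<in> P \<or> card J = 1 \<or> J = W)}"
  have finW: "finite W" using fin by (simp add: W_def)
  have all: "J \<in> Q" if "J \<subseteq> W" "J \<noteq> {}" for J
  proof (rule partitive_without_strong_members[OF finW _ _ _ _ _ _ _ that])
    show "Q \<subseteq> Pow W" by (auto simp: Q_def)
    show "{x} \<in> Q" if "x \<in> W" for x using that by (auto simp: Q_def)
    have A0V: "A0 \<subseteq> V" using ex PV by auto
    then show "A0 \<in> Q" using ex q by (auto simp: Q_def W_def)
    show "2 \<le> card A0" by fact
    show "A0 \<noteq> W"
    proof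
      assume "A0 = W"
      then have "V - A0 = {q}" using q by (auto simp: W_def)
      then show False using ex by simp
    qed
  next
    fix A B assume A: "A \<in> Q" and B: "B \<in> Q" and ov: "overlap A B"
    have s: "C \<in> P \<or> V - C \<in> P" if "C \<in> Q" "overlap C D" "D \<subseteq> W" for C D
    proof -
      have "card C \<noteq> 1"
      proof
        assume "card C = 1"
        then obtain c where "C = {c}" by (meson card_1_singletonE)
        then show False using that(2) by (auto simp: overlap_def)
      qed
      moreover have "C \<noteq> W" using that by (auto simp: overlap_def)
      ultimately show ?thesis using that by (auto simp: Q_def)
    qed
    have AB: "A \<subseteq> W" "B \<subseteq> W" using A B by (auto simp: Q_def)
    have "overlap B A" using ov by (auto simp: overlap_def)
    then have sp: "A \<in> P \<or> V - A \<in> P" "B \<in> P \<or> V - B \<in> P" using s A B ov AB by blast+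
    have ABV: "A \<subseteq> V" "B \<subseteq> V" using AB by (auto simp: W_def)
    have "crossing V A B" using ov AB q by (auto simp: overlap_def crossing_def W_def)
    from pcf_complement_closed[OF pcf ABV(1) sp(1) ABV(2) sp(2) this]
    show "A \<inter> B \<in> Q \<and> A \<union> B \<in> Q \<and> A - B \<in> Q \<and> (A - B) \<union> (B - A) \<in> Q"
      using AB ov by (auto simp: Q_def overlap_def)
  next
    fix A assume A: "A \<in> Q" "2 \<le> card A" "A \<noteq> W"
    then have AW: "A \<subseteq> W" and sp: "A \<in> P \<or> V - A \<in> P" by (auto simp: Q_def)
    obtain x where "x \<in> W" "x \<notin> A" using A AW by blast
    then have co: "2 \<le> card (V - A)" using q AW fin
      by (intro card_ge_2[of _ x q]) (auto simp: W_def)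
    have AV: "A \<subseteq> V" using AW by (auto simp: W_def)
    have dd: "V - (V - A) = A" using AV by auto
    have "\<exists>B\<in>P. crossing V A B"
    proof (cases "A \<in> P")
      case True
      then show ?thesis using weak[OF _ A(2) co] by simp
    next
      case False
      then obtain B where B: "B \<in> P" "crossing V (V - A) B" using sp weak[of "V - A"] co A dd by auto
      then have "crossing V A B" using crossing_complement[OF AV, of B] PV by blast
      then show ?thesis using B by blast
    qed
    then obtain B where B: "B \<in> P" "crossing V A B" by blast
    define B' where "B' = (if q \<in> B then V - B else B)"
    have BV: "B \<subseteq> V" using B PV by auto
    have "crossing V A B'" using B BV AV crossing_complement[of B V A] crossing_commute[of V A]
      by (auto simp: B'_def)
    then have "overlap A B'" by (auto simp: crossing_def overlap_def)
    moreover have "B' \<in> Q" using B BV \<open>overlap A B'\<close>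
      by (auto simp: Q_def B'_def W_def overlap_def double_diff)
    ultimately show "\<exists>B\<in>Q. overlap A B" by blast
  qed
  have dd: "V - (V - J) = J" using J(1) by auto
  have split: "C \<in> P \<or> V - C \<in> P" if C: "C \<subseteq> V" "q \<notin> C" "2 \<le> card C" "2 \<le> card (V - C)" for C
  proof -
    have "C \<in> Q" using C by (intro all) (auto simp: W_def)
    moreover have "C \<noteq> W"
    proof
      assume "C = W"
      then have "V - C = {q}" using q by (auto simp: W_def)
      then show False using C(4) by simp
    qed
    ultimately show ?thesis using C(3) by (auto simp: Q_def)
  qed
  show ?thesis
  proof (cases "q \<in> J")
    case True
    then show ?thesis using split[of "V - J"] J dd by auto
  next
    case False
    then show ?thesis using split[of J] J by simp
  qed
qed

text \<open>For every non-trivial set, it or its complement is a member. Consider the relation that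
  \<open>{x, y}\<close> is a member: symmetric differences of pairs make it transitive, and those of
  complements of pairs leave at most two classes. One class gives the first alternative; of two
  classes one must be a singleton, and its element is the distinguished one.\<close>

lemma crossed_family_trichotomy:
  assumes fin: "finite V" and pcf: "partitive_crossing_family V P"
    and weak: "\<And>A. A \<in> P \<Longrightarrow> 2 \<le> card A \<Longrightarrow> 2 \<le> card (V - A) \<Longrightarrow> \<exists>B\<in>P. crossing V A B"
    and ex: "A0 \<in> P" "2 \<le> card A0" "2 \<le> card (V - A0)"
  shows "(\<forall>J\<subseteq>V. 2 \<le> card J \<longrightarrow> 2 \<le> card (V - J) \<longrightarrow> J \<in> P) \<or>
    (\<exists>i\<in>V. \<forall>J\<subseteq>V. 2 \<le> card J \<longrightarrow> 2 \<le> card (V - J) \<longrightarrow> (J \<in> P \<longleftrightarrow> i \<notin> J))"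
proof -
  have PV: "P \<subseteq> Pow V" using pcf by (simp add: partitive_crossing_family_def)
  have split: "J \<in> P \<or> V - J \<in> P" if "J \<subseteq> V" "2 \<le> card J" "2 \<le> card (V - J)" for J
  proof (rule crossed_family_all_splits[OF fin pcf _ ex that])
    show "\<exists>B\<in>P. crossing V A B" if "A \<in> P" "2 \<le> card A" "2 \<le> card (V - A)" for A
      by (rule weak[OF that])
  qed
  have A0V: "A0 \<subseteq> V" using ex PV by auto
  then have finA0: "finite A0" using fin by (rule finite_subset)
  have V4: "4 \<le> card V" using ex card_Diff_subset[OF finA0 A0V] by linarith
  have other: "\<exists>w\<in>V. w \<notin> {x, y, z}" for x y z
  proof (rule ccontr)
    assume "\<not> ?thesis"
    then have "V \<subseteq> {x, y, z}" by auto
    then have "card V \<le> card {x, y, z}" by (intro card_mono) auto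
    also have "\<dots> \<le> 3" by (simp add: card_insert_if)
    finally show False using V4 by simp
  qed
  have co2: "2 \<le> card (V - {x, y})" if "x \<in> V" "y \<in> V" for x y
  proof -
    obtain w where w: "w \<in> V" "w \<notin> {x, y, y}" using other by blast
    obtain w' where w': "w' \<in> V" "w' \<notin> {x, y, w}" using other by blast
    show ?thesis using w w' fin by (intro card_ge_2[of _ w w']) auto
  qed
  have sd: "{x, z} \<in> P" if xyz: "{x, y} \<in> P" "{y, z} \<in> P" "x \<noteq> y" "y \<noteq> z" "x \<noteq> z" for x y z
  proof -
    obtain w where "w \<in> V" "w \<notin> {x, y, z}" using other by blast
    then have "crossing V {x, y} {y, z}" using xyz by (intro crossingI[of y _ _ x z w]) auto
    then have "({x, y} - {y, z}) \<union> ({y, z} - {x, y}) \<in> P" by (rule pcf_closed(5)[OF pcf xyz(1,2)])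
    moreover have "({x, y} - {y, z}) \<union> ({y, z} - {x, y}) = {x, z}" using xyz by auto
    ultimately show ?thesis by simp
  qed
  have copair: "V - {x, y} \<in> P" if xy: "x \<in> V" "y \<in> V" "x \<noteq> y" and nP: "{x, y} \<notin> P" for x y
  proof -
    have "2 \<le> card {x, y}" using xy by simp
    then show ?thesis using split[of "{x, y}"] co2[OF xy(1,2)] nP xy by blast
  qed
  \<comment> \<open>The complements of the two missing pairs are members, and their symmetric
    difference is \<open>{y, z}\<close>.\<close>
  have dich: "{y, z} \<in> P" if nP: "{x, y} \<notin> P" "{x, z} \<notin> P"
    and xyz: "x \<in> V" "y \<in> V" "z \<in> V" "x \<noteq> y" "y \<noteq> z" "x \<noteq> z" for x y z
  proof -
    have P: "V - {x, y} \<in> P" "V - {x, z} \<in> P"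
      using copair[OF xyz(1,2) xyz(4) nP(1)] copair[OF xyz(1,3) xyz(6) nP(2)] .
    obtain w where "w \<in> V" "w \<notin> {x, y, z}" using other by blast
    then have "crossing V (V - {x, y}) (V - {x, z})"
      using xyz by (intro crossingI[of w _ _ z y x]) auto
    note pcf_closed(5)[OF pcf P this]
    moreover have "(V - {x, y} - (V - {x, z})) \<union> (V - {x, z} - (V - {x, y})) = {y, z}"
      using xyz by auto
    ultimately show ?thesis by simp
  qed
  have clique: "J \<in> P" if "2 \<le> card J" "J \<subseteq> V" "J \<noteq> V"
    and pairs: "\<And>x y. x \<in> J \<Longrightarrow> y \<in> J \<Longrightarrow> x \<noteq> y \<Longrightarrow> {x, y} \<in> P" for J
  proof -
    have "finite J" using that(2) fin by (rule finite_subset)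
    then have "card J = 1 \<or> J \<in> P" if "J \<noteq> {}" using that \<open>J \<subseteq> V\<close> \<open>J \<noteq> V\<close> pairs
    proof (induction rule: finite_ne_induct)
      case (singleton x)
      then show ?case by simp
    next
      case (insert x J)
      then obtain y where y: "y \<in> J" by auto
      have xy: "{x, y} \<in> P" using insert.prems(3) insert.hyps y by blast
      show ?case
      proof (cases "J = {y}")
        case True
        then show ?thesis using xy by simp
      next
        case False
        then obtain z where z: "z \<in> J" "z \<noteq> y" using y by blast
        have "card J \<noteq> 1" using card_ge_2[of J y z] insert z y by auto
        then have JP: "J \<in> P" using insert by blast
        obtain w where "w \<in> V" "w \<notin> insert x J" using insert by blast
        then have "crossing V J {x, y}" using y z insert by (intro crossingI[of y _ _ z x w]) auto
        then have "J \<union> {x, y} \<in> P" by (rule pcf_closed(2)[OF pcf JP xy])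
        moreover have "J \<union> {x, y} = insert x J" using y by auto
        ultimately show ?thesis by simp
      qed
    qed
    then show ?thesis using that(1) by force
  qed
  show ?thesis
  proof (cases "\<forall>x\<in>V. \<forall>y\<in>V. x \<noteq> y \<longrightarrow> {x, y} \<in> P")
    case True
    have "J \<in> P" if "J \<subseteq> V" "2 \<le> card J" "2 \<le> card (V - J)" for J
    proof (rule clique)
      show "J \<noteq> V" using that by auto
    qed (use that True in blast)+
    then show ?thesis by blast
  next
    case False
    then obtain a b where ab: "a \<in> V" "b \<in> V" "a \<noteq> b" "{a, b} \<notin> P" by blast
    define K where "K x = {y \<in> V. y = x \<or> {x, y} \<in> P}" for x
    have KV: "K x \<subseteq> V" for x by (auto simp: K_def)
    have Kab: "a \<in> K a" "b \<in> K b" "b \<notin> K a" "a \<notin> K b" using ab by (auto simp: K_def insert_commute)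
    have cov: "V = K a \<union> K b"
    proof
      show "V \<subseteq> K a \<union> K b"
      proof
        fix y assume y: "y \<in> V"
        show "y \<in> K a \<union> K b"
        proof (cases "y = a \<or> y = b \<or> {a, y} \<in> P")
          case False
          then have "{b, y} \<in> P" using dich[of a b y] ab y by blast
          then show ?thesis using y by (simp add: K_def)
        qed (use y Kab in \<open>auto simp: K_def\<close>)
      qed
    qed (use KV in blast)
    have dis: "K a \<inter> K b = {}"
    proof (rule ccontr)
      assume "K a \<inter> K b \<noteq> {}"
      then obtain y where y: "y \<in> K a" "y \<in> K b" by blast
      then have "y \<noteq> a" "y \<noteq> b" using Kab by auto
      then have "{a, y} \<in> P" "{y, b} \<in> P" using y by (auto simp: K_def insert_commute)
      then show False using sd[of a y b] ab \<open>y \<noteq> a\<close> \<open>y \<noteq> b\<close> by blast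
    qed
    have pr: "{x, y} \<in> P" if "x \<in> K c" "y \<in> K c" "x \<noteq> y" for x y c
    proof (cases "x = c \<or> y = c")
      case True
      then show ?thesis using that by (auto simp: K_def insert_commute)
    next
      case False
      then have "{x, c} \<in> P" "{c, y} \<in> P" using that by (auto simp: K_def insert_commute)
      then show ?thesis using sd[of x c y] False that by blast
    qed
    have np: "{x, y} \<notin> P" if "x \<in> K a" "y \<in> K b" for x y
    proof
      assume p: "{x, y} \<in> P"
      have xV: "x \<in> V" "y \<in> V" "x \<noteq> y" using that KV dis by auto
      have "{a, y} \<in> P"
      proof (cases "x = a")
        case False
        then have "{a, x} \<in> P" using that by (auto simp: K_def)
        moreover have "a \<noteq> y" using that dis Kab by auto
        ultimately show ?thesis using sd[of a x y] p xV False by blast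
      qed (use p in simp)
      then have "y \<in> K a" using xV by (auto simp: K_def)
      then show False using that dis by blast
    qed
    \<comment> \<open>Stated for \<open>c\<close> and \<open>e\<close> because either of the two
      classes may turn out to be the singleton.\<close>
    have root: ?thesis if Ka: "K c = {c}" and c: "c \<in> V" and cov: "V = K c \<union> K e"
      and dis: "K c \<inter> K e = {}" and np: "\<And>y. y \<in> K e \<Longrightarrow> {c, y} \<notin> P" for c e
    proof -
      have "J \<in> P \<longleftrightarrow> c \<notin> J" if J: "J \<subseteq> V" "2 \<le> card J" "2 \<le> card (V - J)" for J
      proof
        assume JP: "J \<in> P"
        show "c \<notin> J"
        proof
          assume cJ: "c \<in> J"
          obtain y where y: "y \<in> J" "y \<noteq> c" using two_elements[OF J(2)] by metis
          have yK: "y \<in> K e" using y J cov Ka by auto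
          obtain u w where uw: "u \<in> V - J" "w \<in> V - J" "u \<noteq> w" using two_elements[OF J(3)] by blast
          show False
          proof (cases "J = {c, y}")
            case True
            then show ?thesis using np yK JP by blast
          next
            case False
            then obtain z where z: "z \<in> J" "z \<noteq> c" "z \<noteq> y" using cJ y by blast
            \<comment> \<open>\<open>H\<close> lies in the class of \<open>e\<close> and is thus a
              member. It contains all of \<open>J\<close> except \<open>c\<close> and
              \<open>y\<close>, and \<open>u\<close> makes it leave \<open>J\<close>; so
              \<open>J - H\<close> is the pair \<open>{c, y}\<close>, which joins two
              classes.\<close>
            define H where "H = insert u (J - {c, y})"
            have HK: "H \<subseteq> K e" using J uw cov Ka cJ by (auto simp: H_def)
            have finH: "finite H" using HK KV fin by (meson finite_subset)
            have HP: "H \<in> P"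
            proof (rule clique)
              show "2 \<le> card H" using z uw finH by (intro card_ge_2[of _ z u]) (auto simp: H_def)
              show "H \<subseteq> V" using HK KV by blast
              show "H \<noteq> V" using HK dis Ka c by blast
              show "{x, y} \<in> P" if "x \<in> H" "y \<in> H" "x \<noteq> y" for x y
                using pr[of x e y] HK that by blast
            qed
            have "crossing V J H"
              using z y uw cJ by (intro crossingI[of z _ _ y u w]) (auto simp: H_def)
            then have "J - H \<in> P" by (rule pcf_closed(3)[OF pcf JP HP])
            moreover have "J - H = {c, y}" using cJ y uw by (auto simp: H_def)
            ultimately show False using np yK by simp
          qed
        qed
      next
        assume "c \<notin> J"
        then have JK: "J \<subseteq> K e" using J cov Ka by auto
        show "J \<in> P"
        proof (rule clique[OF J(2,1)])
          show "J \<noteq> V" using \<open>c \<notin> J\<close> c by blast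
          show "{x, y} \<in> P" if "x \<in> J" "y \<in> J" "x \<noteq> y" for x y
            using pr[of x e y] JK that by blast
        qed
      qed
      then show ?thesis using c by blast
    qed
    show ?thesis
    proof (cases "K a = {a} \<or> K b = {b}")
      case True
      then show ?thesis
      proof
        assume h: "K a = {a}"
        show ?thesis by (rule root[OF h ab(1) cov dis]) (rule np[OF Kab(1)])
      next
        assume h: "K b = {b}"
        have "V = K b \<union> K a" "K b \<inter> K a = {}" using cov dis by auto
        moreover have "{b, y} \<notin> P" if "y \<in> K a" for y
          using np[OF that Kab(2)] by (simp add: insert_commute)
        ultimately show ?thesis by (rule root[OF h ab(2)])
      qed
    next
      case False
      then obtain a' d where a': "a' \<in> K a" "a' \<noteq> a" and d: "d \<in> K b" "d \<noteq> b" using Kab by blast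
      have finK: "finite (K x)" for x using KV fin by (meson finite_subset)
      have K2: "2 \<le> card (K a)" "2 \<le> card (K b)"
        using card_ge_2[OF finK Kab(1) a'(1)] card_ge_2[OF finK Kab(2) d(1)] a' d by auto
      have KaP: "K a \<in> P" 
      proof (rule clique[OF K2(1) KV])
        show "K a \<noteq> V" using Kab ab by blast
        show "{x, y} \<in> P" if "x \<in> K a" "y \<in> K a" "x \<noteq> y" for x y
          using pr that by blast
      qed
      have co: "V - {a, b} \<in> P" using copair ab by blast
      \<comment> \<open>With two classes of at least two elements, the complement of the missing
        pair \<open>{a, b}\<close> crosses \<open>K a\<close>. The symmetric difference exchanges
        \<open>K a\<close> for its single element \<open>a\<close>, and what remains can be cut down
        to the pair \<open>{a, d}\<close> between the classes.\<close>
      have "crossing V (K a) (V - {a, b})"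
        using a' d ab Kab KV dis by (intro crossingI[of a' _ _ a d b]) auto
      note pcf_closed(5)[OF pcf KaP co this]
      moreover have "(K a - (V - {a, b})) \<union> (V - {a, b} - K a) = insert a (K b - {b})"
        using cov dis Kab by auto
      ultimately have Y: "insert a (K b - {b}) \<in> P" by simp
      show ?thesis
      proof (cases "K b = {b, d}")
        case True
        then have "insert a (K b - {b}) = {a, d}" using d by auto
        then show ?thesis using Y np Kab d by auto
      next
        case False
        then obtain f where f: "f \<in> K b" "f \<noteq> b" "f \<noteq> d" using Kab d by blast
        have KP: "K b - {d} \<in> P"
        proof (rule clique)
          show "2 \<le> card (K b - {d})" using finK f Kab d by (intro card_ge_2[of _ f b]) auto
          show "K b - {d} \<subseteq> V" "K b - {d} \<noteq> V" using KV[of b] d by blast+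
          show "{x, y} \<in> P" if "x \<in> K b - {d}" "y \<in> K b - {d}" "x \<noteq> y" for x y
            using pr[of x b y] that by blast
        qed
        have "a' \<in> V" "a' \<notin> K b" using a' KV dis by blast+
        then have "crossing V (insert a (K b - {b})) (K b - {d})"
          using f d Kab a'(2) ab(3) by (intro crossingI[of f _ _ d b a']) simp_all
        then have "insert a (K b - {b}) - (K b - {d}) \<in> P" by (rule pcf_closed(3)[OF pcf Y KP])
        moreover have "insert a (K b - {b}) - (K b - {d}) = {a, d}" using Kab d by auto
        ultimately show ?thesis using np Kab d by auto
      qed
    qed
  qed
qed

section \<open>Strong splits and stars\<close>

locale partitive_family =
  fixes X :: "'a set" and F :: "'a set set"
  assumes finite_X: "finite X" and two_le_card: "2 \<le> card X"
    and pcf: "partitive_crossing_family X F"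
    and singleton_mem: "\<And>x. x \<in> X \<Longrightarrow> {x} \<in> F"
begin

text \<open>Either side of a bipartition may be the member; both sides belong to
  \<open>splits\<close>, one for each direction of the prospective edge.\<close>

definition splits :: "'a set set" where
  "splits = {S. S \<subseteq> X \<and> S \<noteq> {} \<and> S \<noteq> X \<and> (S \<in> F \<or> X - S \<in> F) \<and>
     (\<forall>B\<in>F. \<not> crossing X S B)}"

text \<open>A star is the family of sides around an internal node of degree at least three.\<close>

definition star :: "'a set set \<Rightarrow> bool" where
  "star M \<longleftrightarrow> M \<subseteq> splits \<and> \<Union>M = X \<and> pairwise disjnt M \<and> 3 \<le> card M \<and>
     (\<forall>S\<in>splits. \<exists>R\<in>M. S \<subseteq> R \<or> X - S \<subseteq> R)"

lemma F_sub: "A \<in> F \<Longrightarrow> A \<subseteq> X"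
  using pcf by (auto simp: partitive_crossing_family_def)

lemma splitsD:
  assumes "S \<in> splits"
  shows "S \<subseteq> X" "S \<noteq> {}" "S \<noteq> X" "S \<in> F \<or> X - S \<in> F" "\<And>B. B \<in> F \<Longrightarrow> \<not> crossing X S B"
  using assms by (auto simp: splits_def)

lemma compl_compl: "S \<subseteq> X \<Longrightarrow> X - (X - S) = S"
  by auto

lemma splits_complement: "S \<in> splits \<Longrightarrow> X - S \<in> splits"
proof -
  assume S: "S \<in> splits"
  note d = splitsD[OF S]
  have "\<not> crossing X (X - S) B" if "B \<in> F" for B
    using d(5)[OF that] crossing_complement[OF d(1) F_sub[OF that]] by simp
  moreover have "X - S \<noteq> {}" "X - S \<noteq> X" using d(1-3) by blast+
  moreover have "X - S \<in> F \<or> X - (X - S) \<in> F" using d(4) compl_compl[OF d(1)] by auto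
  ultimately show ?thesis unfolding splits_def by blast
qed

lemma splits_complement_iff: "S \<subseteq> X \<Longrightarrow> X - S \<in> splits \<longleftrightarrow> S \<in> splits"
  using splits_complement compl_compl by metis

lemma singleton_split: "x \<in> X \<Longrightarrow> {x} \<in> splits"
  using singleton_mem two_le_card by (auto simp: splits_def crossing_def)

text \<open>One of the splits is uncrossed, the other is a member up to complement, and crossing is
  insensitive to complements.\<close>

lemma splits_not_crossing:
  assumes "S \<in> splits" "T \<in> splits"
  shows "S \<subseteq> T \<or> T \<subseteq> S \<or> S \<inter> T = {} \<or> S \<union> T = X"
proof -
  have "\<not> crossing X S T"
    using splitsD[OF assms(1)] splitsD[OF assms(2)] crossing_complement crossing_commute by metis
  then show ?thesis by (auto simp: crossing_def)
qed

lemma split_not_crossing_member: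
  assumes "S \<in> splits" "A \<in> F"
  shows "S \<subseteq> A \<or> A \<subseteq> S \<or> S \<inter> A = {} \<or> S \<union> A = X"
  using splitsD(5)[OF assms] by (auto simp: crossing_def)

lemma starD:
  assumes "star M"
  shows "M \<subseteq> splits" "\<Union>M = X" "3 \<le> card M" "finite M"
    "\<And>S. S \<in> splits \<Longrightarrow> \<exists>R\<in>M. S \<subseteq> R \<or> X - S \<subseteq> R"
    "\<And>R R'. R \<in> M \<Longrightarrow> R' \<in> M \<Longrightarrow> R \<noteq> R' \<Longrightarrow> R \<inter> R' = {}"
    "\<And>R. R \<in> M \<Longrightarrow> R \<noteq> {}"
proof -
  show "finite M" by (rule ccontr) (use assms in \<open>simp add: star_def\<close>)
qed (use assms in \<open>auto simp: star_def pairwise_def disjnt_def splits_def\<close>)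

lemma star_complement: "star M \<Longrightarrow> J \<subseteq> M \<Longrightarrow> X - \<Union>J = \<Union>(M - J)"
  using starD(2,6)[of M] by fast

lemma star_Union_subset:
  assumes "star M" "J \<subseteq> M" "K \<subseteq> M"
  shows "\<Union>J \<subseteq> \<Union>K \<longleftrightarrow> J \<subseteq> K"
proof
  assume u: "\<Union>J \<subseteq> \<Union>K"
  show "J \<subseteq> K"
  proof
    fix R assume R: "R \<in> J"
    then obtain x where "x \<in> R" using starD(7)[OF assms(1)] assms(2) by blast
    then obtain R' where "R' \<in> K" "x \<in> R'" using u R by blast
    then have "R = R'" using starD(6)[OF assms(1), of R R'] R assms \<open>x \<in> R\<close> by blast
    then show "R \<in> K" using \<open>R' \<in> K\<close> by simp
  qed
qed auto

lemma star_Union_inj: "star M \<Longrightarrow> J \<subseteq> M \<Longrightarrow> K \<subseteq> M \<Longrightarrow> \<Union>J = \<Union>K \<Longrightarrow> J = K"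
  using star_Union_subset by (metis subset_antisym order_refl)

lemma star_Union_ops:
  assumes "star M" "J \<subseteq> M" "K \<subseteq> M"
  shows "\<Union>(J \<inter> K) = \<Union>J \<inter> \<Union>K" "\<Union>(J - K) = \<Union>J - \<Union>K"
  using starD(6)[OF assms(1)] assms(2,3) by fast+

text \<open>The parts are non-empty and disjoint, so taking unions respects the Boolean operations.
  This allows \<open>F\<close> to be studied on the quotient, as a family of sets of parts.\<close>

lemma star_crossing:
  assumes M: "star M" and J: "J \<subseteq> M" and K: "K \<subseteq> M"
  shows "crossing X (\<Union>J) (\<Union>K) \<longleftrightarrow> crossing M J K"
proof -
  have e: "\<Union>H = {} \<longleftrightarrow> H = {}" if "H \<subseteq> M" for H using star_Union_inj[OF M that, of "{}"] by auto
  have "\<Union>J \<inter> \<Union>K = {} \<longleftrightarrow> J \<inter> K = {}" "\<Union>J - \<Union>K = {} \<longleftrightarrow> J - K = {}" "\<Union>K - \<Union>J = {} \<longleftrightarrow> K - J = {}"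
    unfolding star_Union_ops[OF M J K, symmetric] star_Union_ops[OF M K J, symmetric]
    using J K by (intro e, blast)+
  moreover have "\<Union>J \<union> \<Union>K = X \<longleftrightarrow> J \<union> K = M"
  proof -
    have "\<Union>(J \<union> K) = \<Union>M \<longleftrightarrow> J \<union> K = M"
      using star_Union_inj[OF M, of "J \<union> K" M] J K by (metis Un_subset_iff order_refl)
    then show ?thesis using starD(2)[OF M] by simp
  qed
  ultimately show ?thesis by (simp only: crossing_def)
qed

lemma not_subset_part:
  assumes "star M" "J \<subseteq> M" "2 \<le> card J" "R \<in> M"
  shows "\<not> \<Union>J \<subseteq> R"
proof
  assume "\<Union>J \<subseteq> R"
  then have "\<Union>J \<subseteq> \<Union>{R}" by simp
  then have "J \<subseteq> {R}" using star_Union_subset[OF assms(1,2), of "{R}"] assms(4) by simp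
  then have "card J \<le> 1" using card_mono[of "{R}" J] by simp
  then show False using assms(3) by simp
qed

text \<open>A split has one of its sides inside a single part, which is impossible when at least two
  parts lie on either side.\<close>

lemma Union_not_split:
  assumes "star M" "J \<subseteq> M" "2 \<le> card J" "2 \<le> card (M - J)"
  shows "\<Union>J \<notin> splits"
  using starD(5)[OF assms(1), of "\<Union>J"] not_subset_part[OF assms(1)] star_complement[OF assms(1,2)] assms
  by (metis Diff_subset)

lemma star_part_complement_not_subset:
  assumes "star M" "R \<in> M" "Q \<in> M" shows "\<not> X - R \<subseteq> Q"
proof -
  have "card (M - {R}) = card M - 1" using assms starD(4) by simp
  then have "2 \<le> card (M - {R})" using starD(3)[OF assms(1)] by linarith
  moreover have "X - R = \<Union>(M - {R})" using star_complement[OF assms(1), of "{R}"] assms by simp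
  ultimately show ?thesis using not_subset_part[OF assms(1) _ _ assms(3)] by simp
qed

text \<open>Every other part of one star lies in a part of the other star different from the common
  one, and conversely; so the two partitions refine each other. A part thus acts as a directed edge,
  and the star as the node at its end.\<close>

lemma stars_share_part:
  assumes M: "star M" and M': "star M'" and R: "R \<in> M" "R \<in> M'"
  shows "M = M'"
proof -
  have sub: "M' \<subseteq> M" if M: "star M" and M': "star M'" and R: "R \<in> M" "R \<in> M'" for M M'
  proof
    have step: "\<exists>Q\<in>N. Q \<noteq> R \<and> R' \<subseteq> Q"
      if N: "star N" "star N'" "R \<in> N" "R \<in> N'" and R': "R' \<in> N'" "R' \<noteq> R" for N N' R'
    proof -
      have d: "R' \<inter> R = {}" using starD(6)[OF N(2)] N R' by blast
      have sp: "R' \<in> splits" using starD(1)[OF N(2)] R' by blast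
      obtain Q where Q: "Q \<in> N" "R' \<subseteq> Q \<or> X - R' \<subseteq> Q" using starD(5)[OF N(1) sp] by blast
      have RX: "R \<subseteq> X" using starD(2)[OF N(1)] N by blast
      have ne: "R \<noteq> {}" "R' \<noteq> {}" using starD(7)[OF N(2)] N(4) R' by blast+
      have "\<not> X - R' \<subseteq> Q"
      proof
        assume s: "X - R' \<subseteq> Q"
        then have "R \<subseteq> Q" using d RX by blast
        then have "Q = R" using starD(6)[OF N(1) Q(1) N(3)] ne by blast
        then show False using s star_part_complement_not_subset[OF N(2) R'(1) N(4)] by blast
      qed
      then have "R' \<subseteq> Q" using Q by blast
      moreover have "Q \<noteq> R" using calculation d ne by blast
      ultimately show ?thesis using Q by blast
    qed
    fix R' assume R': "R' \<in> M'"
    show "R' \<in> M"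
    proof (cases "R' = R")
      case False
      obtain Q where Q: "Q \<in> M" "Q \<noteq> R" "R' \<subseteq> Q" using step[OF M M' R R' False] by blast
      obtain Q' where Q': "Q' \<in> M'" "Q \<subseteq> Q'" using step[OF M' M R(2,1) Q(1,2)] by blast
      have "R' = Q'" using starD(6)[OF M' R' Q'(1)] Q Q' starD(7)[OF M' R'] by blast
      then show ?thesis using Q Q' by auto
    qed (use R in simp)
  qed
  show ?thesis using sub[OF M M' R] sub[OF M' M R(2,1)] by blast
qed

text \<open>If no such pair existed, each partition would refine the other and they would coincide.
  \<open>R\<close> and \<open>R'\<close> are the directions in which the two nodes see each
  other.\<close>

lemma distinct_stars_nested:
  assumes M: "star M" and M': "star M'" and ne: "M \<noteq> M'"
  shows "\<exists>R\<in>M. \<exists>R'\<in>M'. X - R \<subseteq> R'"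
proof (rule ccontr)
  assume no: "\<not> ?thesis"
  have ref: "\<exists>R'\<in>M'. R \<subseteq> R'" if "R \<in> M" for R
    using starD(5)[OF M', of R] starD(1)[OF M] that no by blast
  have ref': "\<exists>R\<in>M. R' \<subseteq> R" if R': "R' \<in> M'" for R'
  proof -
    obtain R where R: "R \<in> M" "R' \<subseteq> R \<or> X - R' \<subseteq> R"
      using starD(5)[OF M, of R'] starD(1)[OF M'] R' by blast
    moreover have "X - R \<subseteq> R'" if "X - R' \<subseteq> R" using that by blast
    ultimately show ?thesis using no R' by blast
  qed
  obtain R where R: "R \<in> M" using starD(3)[OF M] by fastforce
  obtain R' where R': "R' \<in> M'" "R \<subseteq> R'" using ref[OF R] by blast
  obtain Q where Q: "Q \<in> M" "R' \<subseteq> Q" using ref'[OF R'(1)] by blast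
  have "R = Q" using starD(6)[OF M R Q(1)] R' Q starD(7)[OF M R] by blast
  then have "R = R'" using R' Q by blast
  then show False using stars_share_part[OF M M' R] R' ne by blast
qed

text \<open>Facing parts \<open>R\<close> and \<open>R'\<close> cover \<open>X\<close>. According to
  whether each is used, the two unions cover \<open>X\<close>, are nested, or are disjoint. So
  crossing unions of parts always come from one star.\<close>

lemma nontrivial_Unions_not_crossing:
  assumes M: "star M" "J \<subseteq> M" and M': "star M'" "J' \<subseteq> M'" and ne: "M \<noteq> M'"
  shows "\<not> crossing X (\<Union>J) (\<Union>J')"
proof -
  obtain R R' where R: "R \<in> M" "R' \<in> M'" "X - R \<subseteq> R'" using distinct_stars_nested[OF M(1) M'(1) ne] by blast
  have d: "\<Union>K \<inter> Q = {}" if "star N" "K \<subseteq> N" "Q \<in> N" "Q \<notin> K" for K N and Q :: "'a set"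
    using starD(6)[OF that(1,3)] that(2-4) by blast
  have a: "R \<in> J \<Longrightarrow> R \<subseteq> \<Union>J" "R \<notin> J \<Longrightarrow> \<Union>J \<inter> R = {}" "R' \<in> J' \<Longrightarrow> R' \<subseteq> \<Union>J'" "R' \<notin> J' \<Longrightarrow> \<Union>J' \<inter> R' = {}"
    using d[OF M R(1)] d[OF M' R(2)] by auto
  have b: "\<Union>J \<subseteq> X" "\<Union>J' \<subseteq> X" using starD(2) M M' by blast+
  show ?thesis
  proof (cases "R \<in> J"; cases "R' \<in> J'")
    assume "R \<in> J" "R' \<in> J'"
    then have "\<Union>J \<union> \<Union>J' = X" using a b R(3) by blast
    then show ?thesis by (simp add: crossing_def)
  next
    assume "R \<in> J" "R' \<notin> J'"
    then have "\<Union>J' \<subseteq> \<Union>J" using a b R(3) by blast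
    then show ?thesis by (auto simp: crossing_def)
  next
    assume "R \<notin> J" "R' \<in> J'"
    then have "\<Union>J \<subseteq> \<Union>J'" using a b R(3) by blast
    then show ?thesis by (auto simp: crossing_def)
  next
    assume "R \<notin> J" "R' \<notin> J'"
    then have "\<Union>J \<inter> \<Union>J' = {}" using a b R(3) by blast
    then show ?thesis by (auto simp: crossing_def)
  qed
qed

lemma nontrivial_Union_unique:
  assumes M: "star M" "J \<subseteq> M" "2 \<le> card J" "2 \<le> card (M - J)"
    and M': "star M'" "J' \<subseteq> M'" "2 \<le> card J'" "2 \<le> card (M' - J')" and eq: "\<Union>J = \<Union>J'"
  shows "M = M' \<and> J = J'"
proof -
  have "M = M'"
  proof (rule ccontr)
    assume "M \<noteq> M'"
    then obtain R R' where R: "R \<in> M" "R' \<in> M'" "X - R \<subseteq> R'"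
      using distinct_stars_nested[OF M(1) M'(1)] by blast
    show False
    proof (cases "R \<in> J")
      case True
      then have "X - \<Union>J \<subseteq> R'" using R by blast
      then have "\<Union>(M' - J') \<subseteq> R'" using star_complement[OF M'(1,2)] eq by simp
      then show False using not_subset_part[OF M'(1) _ M'(4) R(2)] by blast
    next
      case False
      then have "\<Union>J \<subseteq> X - R" using starD(6)[OF M(1)] starD(2)[OF M(1)] M(2) R(1) by blast
      then show False using not_subset_part[OF M'(1-3) R(2)] R eq by blast
    qed
  qed
  then show ?thesis using star_Union_inj M M' eq by blast
qed

text \<open>The remaining parts are the maximal splits properly inside \<open>X - S\<close>. They
  cover it because singletons are splits, and they are disjoint because splits do not cross. The
  cardinality condition says that the edge does not end in a leaf.\<close>

lemma star_exists:
  assumes S: "S \<in> splits" and big: "2 \<le> card (X - S)"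
  shows "\<exists>M. star M \<and> S \<in> M"
proof -
  define A where "A = X - S"
  have AS: "A \<in> splits" using S by (simp add: A_def splits_complement)
  have AX: "A \<subseteq> X" "A \<noteq> X" "A \<noteq> {}" using splitsD[OF AS] by auto
  have finA: "finite A" using AX finite_X finite_subset by blast
  define mx where "mx B \<longleftrightarrow> B \<in> splits \<and> B \<subset> A \<and> (\<forall>C\<in>splits. C \<subset> A \<longrightarrow> B \<subseteq> C \<longrightarrow> C = B)" for B
  define M where "M = insert S {B. mx B}"
  have below: "\<exists>B. mx B \<and> C \<subseteq> B" if C: "C \<in> splits" "C \<subset> A" for C
  proof -
    have bnd: "\<forall>B. (B \<in> splits \<and> B \<subset> A \<and> C \<subseteq> B) \<longrightarrow> card B < Suc (card A)"
      using finA by (auto intro!: le_imp_less_Suc card_mono)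
    obtain B where B: "B \<in> splits \<and> B \<subset> A \<and> C \<subseteq> B"
      and Bm: "\<forall>D. (D \<in> splits \<and> D \<subset> A \<and> C \<subseteq> D) \<longrightarrow> card D \<le> card B"
      using ex_has_greatest_nat[of "\<lambda>B. B \<in> splits \<and> B \<subset> A \<and> C \<subseteq> B" C card "Suc (card A)"] bnd C
      by blast
    have "D = B" if D: "D \<in> splits" "D \<subset> A" "B \<subseteq> D" for D
    proof -
      have "finite D" using D finA finite_subset by blast
      moreover have "card D \<le> card B" using Bm D B by blast
      ultimately show ?thesis using D(3) by (metis card_seteq)
    qed
    then have "mx B" using B by (auto simp: mx_def)
    then show ?thesis using B by blast
  qed
  have disj: "B \<inter> C = {}" if B: "mx B" and C: "mx C" and ne: "B \<noteq> C" for B C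
  proof -
    have "B \<union> C \<noteq> X" using B C AX by (auto simp: mx_def)
    moreover have "\<not> B \<subseteq> C" "\<not> C \<subseteq> B" using B C ne unfolding mx_def by blast+
    ultimately show ?thesis using splits_not_crossing[of B C] B C by (auto simp: mx_def)
  qed
  have cov: "\<exists>B. mx B \<and> a \<in> B" if a: "a \<in> A" for a
  proof -
    have "{a} \<in> splits" using a AX by (intro singleton_split) auto
    moreover have "{a} \<subset> A"
    proof -
      have "A \<noteq> {a}" using big by (auto simp: A_def[symmetric])
      then show ?thesis using a by blast
    qed
    ultimately show ?thesis using below by blast
  qed
  have sA: "S \<inter> A = {}" "S \<union> A = X" using splitsD(1)[OF S] by (auto simp: A_def)
  have Snm: "\<not> mx S" using sA splitsD(2)[OF S] by (auto simp: mx_def)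
  have finM: "finite M"
  proof -
    have "{B. mx B} \<subseteq> Pow X" using splitsD(1) by (auto simp: mx_def)
    then have "finite {B. mx B}" using finite_X by (metis finite_Pow_iff finite_subset)
    then show ?thesis by (simp add: M_def)
  qed
  obtain a where a: "a \<in> A" using AX by blast
  obtain B where B: "mx B" "a \<in> B" using cov[OF a] by blast
  \<comment> \<open>A maximal split is a proper subset of \<open>A\<close>, so a second one is
    needed to cover \<open>A\<close>; together with \<open>S\<close> this gives three parts.\<close>
  obtain a' where a': "a' \<in> A" "a' \<notin> B" using B by (auto simp: mx_def)
  obtain B' where B': "mx B'" "a' \<in> B'" using cov[OF a'(1)] by blast
  have "S \<noteq> B" "S \<noteq> B'" "B \<noteq> B'" using B B' a' Snm by blast+
  then have "3 = card {S, B, B'}" by simp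
  also have "\<dots> \<le> card M" using finM B B' by (intro card_mono) (auto simp: M_def)
  finally have c3: "3 \<le> card M" .
  have "star M" unfolding star_def
  proof (intro conjI ballI c3)
    show "M \<subseteq> splits" using S by (auto simp: M_def mx_def)
    show "\<Union>M = X"
    proof
      show "\<Union>M \<subseteq> X" using \<open>M \<subseteq> splits\<close> splitsD(1) by blast
      show "X \<subseteq> \<Union>M" using cov sA by (auto simp: M_def)
    qed
    have "S \<inter> C = {}" if "mx C" for C using that sA by (auto simp: mx_def)
    then show "pairwise disjnt M" using disj by (auto simp: M_def pairwise_def disjnt_def)
    fix T assume T: "T \<in> splits"
    have TX: "T \<subseteq> X" using splitsD(1)[OF T] .
    have psub: "\<exists>R\<in>M. C \<subseteq> R" if "C \<in> splits" "C \<subset> A" for C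
      using below[OF that] by (auto simp: M_def)
    consider "T \<subset> A" | "T = A" | "A \<subseteq> T" | "T \<inter> A = {}" | "T \<union> A = X" "T \<noteq> S"| "T = S"
      using splits_not_crossing[OF T AS] by blast
    then show "\<exists>R\<in>M. T \<subseteq> R \<or> X - T \<subseteq> R"
    proof cases
      case 1
      then show ?thesis using psub[OF T] by blast
    next
      case 5
      then have "X - T \<subset> A" using sA TX by blast
      then show ?thesis using psub[OF splits_complement[OF T]] by blast
    qed (use sA TX in \<open>auto simp: M_def\<close>)
  qed
  then show ?thesis by (auto simp: M_def)
qed

text \<open>Let \<open>C\<close> be a smallest split containing \<open>A\<close> and take the star
  with part \<open>X - C\<close>. By minimality no other part contains \<open>A\<close>, and parts
  do not cross \<open>A\<close>; so each of them is inside \<open>A\<close> or disjoint from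
  it.\<close>

lemma member_split_or_star_Union:
  assumes A: "A \<in> F" "A \<noteq> {}" "A \<noteq> X"
  shows "A \<in> splits \<or>
    (\<exists>M J. star M \<and> J \<subseteq> M \<and> 2 \<le> card J \<and> 2 \<le> card (M - J) \<and> A = \<Union>J)"
proof (cases "A \<in> splits")
  case False
  have AX: "A \<subseteq> X" using F_sub[OF A(1)] .
  then obtain r where r: "r \<in> X" "r \<notin> A" using A by blast
  \<comment> \<open>Complements of singletons are splits, so some split contains
    \<open>A\<close>.\<close>
  have "X - {r} \<in> splits \<and> A \<subseteq> X - {r}" using r AX singleton_split splits_complement by auto
  then obtain C where C: "C \<in> splits" "A \<subseteq> C"
    and Cm: "\<And>D. D \<in> splits \<Longrightarrow> A \<subseteq> D \<Longrightarrow> card C \<le> card D"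
    using ex_has_least_nat[of "\<lambda>C. C \<in> splits \<and> A \<subseteq> C" "X - {r}" card] by blast
  have CX: "C \<subseteq> X" "C \<noteq> X" using splitsD[OF C(1)] by auto
  have finC: "finite C" using CX finite_X finite_subset by blast
  have AC: "A \<noteq> C" using C False by blast
  obtain a c where ac: "a \<in> A" "c \<in> C" "c \<notin> A" using A AC C by blast
  have "2 \<le> card C" using card_ge_2[OF finC, of a c] ac C by blast
  then obtain M where M: "star M" "X - C \<in> M"
    using star_exists[of "X - C"] splits_complement[OF C(1)] compl_compl[OF CX(1)] by auto
  have UC: "\<Union>(M - {X - C}) = C" using star_complement[OF M(1), of "{X - C}"] M CX by auto
  define J where "J = {R \<in> M. R \<subseteq> A}"
  have part: "R \<subseteq> A \<or> R \<inter> A = {}" if R: "R \<in> M" "R \<noteq> X - C" for R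
  proof -
    have RC: "R \<subseteq> C" using UC R by blast
    have Rs: "R \<in> splits" using starD(1)[OF M(1)] R by blast
    have "\<not> A \<subseteq> R"
    proof
      assume "A \<subseteq> R"
      then have "card C \<le> card R" using Cm Rs by blast
      then have "R = C" using RC finC by (metis card_seteq)
      then show False using star_part_complement_not_subset[OF M(1,2) R(1)] compl_compl[OF CX(1)] by simp
    qed
    moreover have "R \<union> A \<noteq> X" using RC C CX by blast
    ultimately show ?thesis using split_not_crossing_member[OF Rs A(1)] by blast
  qed
  have XC: "X - C \<notin> J" using starD(7)[OF M] C by (auto simp: J_def)
  have AJ: "A = \<Union>J"
  proof
    show "A \<subseteq> \<Union>J"
    proof
      fix x assume x: "x \<in> A"
      then obtain R where R: "R \<in> M" "R \<noteq> X - C" "x \<in> R" using C UC by blast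
      then show "x \<in> \<Union>J" using part[OF R(1,2)] x by (auto simp: J_def)
    qed
  qed (auto simp: J_def)
  have JM: "J \<subseteq> M" by (auto simp: J_def)
  have fin: "finite J" "finite (M - J)" using finite_subset[OF JM] starD(4)[OF M(1)] by auto
  have "2 \<le> card J"
  proof (rule ccontr)
    assume "\<not> ?thesis"
    moreover have "card J \<noteq> 0" using AJ A fin by auto
    ultimately have "card J = 1" by linarith
    then obtain R where "J = {R}" by (meson card_1_singletonE)
    then have "A = R" "R \<in> M" using AJ JM by auto
    then show False using starD(1)[OF M(1)] False by blast
  qed
  moreover have "2 \<le> card (M - J)"
  proof -
    obtain R where R: "R \<in> M" "R \<noteq> X - C" "c \<in> R" using ac UC by blast
    then have "R \<notin> J" using ac by (auto simp: J_def)
    then show ?thesis using card_ge_2[OF fin(2), of R "X - C"] R M XC by blast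
  qed
  ultimately show ?thesis using M JM AJ by blast
qed simp

section \<open>Full and rooted stars\<close>

definition full :: "'a set set \<Rightarrow> bool" where
  "full M \<longleftrightarrow> star M \<and> (\<forall>J\<subseteq>M. J \<noteq> {} \<longrightarrow> J \<noteq> M \<longrightarrow> \<Union>J \<in> F)"

text \<open>With three parts the last condition would be vacuous and a full star would be rooted at
  each of its parts; four parts make \<open>R\<close> unique and exclude fullness. Whether
  \<open>R\<close> itself is a member is deliberately left open, and this is what leads to
  subdivided edges.\<close>

definition rooted :: "'a set set \<Rightarrow> 'a set \<Rightarrow> bool" where
  "rooted M R \<longleftrightarrow> star M \<and> 4 \<le> card M \<and> R \<in> M \<and> (\<forall>J\<subseteq>M - {R}. J \<noteq> {} \<longrightarrow> \<Union>J \<in> F) \<and>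
     (\<forall>J\<subseteq>M. R \<in> J \<longrightarrow> 2 \<le> card J \<longrightarrow> 2 \<le> card (M - J) \<longrightarrow> \<Union>J \<notin> F)"

lemma full_Union: "full M \<Longrightarrow> J \<subseteq> M \<Longrightarrow> J \<noteq> {} \<Longrightarrow> J \<noteq> M \<Longrightarrow> \<Union>J \<in> F"
  by (simp add: full_def)

lemma rooted_Union: "rooted M R \<Longrightarrow> J \<subseteq> M - {R} \<Longrightarrow> J \<noteq> {} \<Longrightarrow> \<Union>J \<in> F"
  by (simp add: rooted_def)

lemma card_pair_compl:
  assumes "finite M" "4 \<le> card M" "R \<in> M" "R' \<in> M" "R \<noteq> R'"
  shows "card {R, R'} = 2" "2 \<le> card (M - {R, R'})"
  using assms card_Diff_subset[of "{R, R'}" M] by auto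

lemma rooted_pair: "rooted M R \<Longrightarrow> R' \<in> M \<Longrightarrow> R' \<noteq> R \<Longrightarrow> R \<union> R' \<notin> F"
proof -
  assume a: "rooted M R" "R' \<in> M" "R' \<noteq> R"
  then have "\<Union>{R, R'} \<notin> F" unfolding rooted_def
    using card_pair_compl[of M R R'] starD(4)[of M] by (metis empty_subsetI insert_iff insert_subset order_refl)
  then show ?thesis by simp
qed

lemma rooted_unique: "rooted M R \<Longrightarrow> rooted M R' \<Longrightarrow> R = R'"
proof (rule ccontr)
  assume a: "rooted M R" "rooted M R'" "R \<noteq> R'"
  have M: "finite M" "R \<in> M" "R' \<in> M" "4 \<le> card M" using a starD(4) by (auto simp: rooted_def)
  have "M - {R, R'} \<noteq> {}" using card_pair_compl(2)[OF M(1,4,2,3) a(3)] by (metis card.empty not_numeral_le_zero)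
  then obtain Q where Q: "Q \<in> M" "Q \<noteq> R" "Q \<noteq> R'" by blast
  have "\<Union>{R, Q} \<in> F" using a(2) Q M a(3) unfolding rooted_def
    by (metis Diff_iff empty_not_insert empty_subsetI insert_subset singletonD)
  then show False using rooted_pair[OF a(1) Q(1,2)] by simp
qed

lemma rooted_not_full: "rooted M R \<Longrightarrow> \<not> full M"
proof
  assume a: "rooted M R" "full M"
  have M: "finite M" "R \<in> M" "4 \<le> card M" using a starD(4) by (auto simp: rooted_def)
  have "M \<noteq> {R}" using M by auto
  then obtain Q where Q: "Q \<in> M" "Q \<noteq> R" using M by blast
  have "\<Union>{R, Q} \<in> F" using a(2) Q M card_pair_compl(2)[OF M(1,3,2) Q(1)] unfolding full_def
    by (metis Diff_cancel card.empty empty_not_insert empty_subsetI insert_subset not_numeral_le_zero)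
  then show False using rooted_pair[OF a(1) Q] by simp
qed

lemma rooted_complement: "rooted M R \<Longrightarrow> X - R \<in> F"
proof -
  assume a: "rooted M R"
  then have M: "star M" "R \<in> M" "4 \<le> card M" by (auto simp: rooted_def)
  then have "M \<noteq> {R}" by auto
  then have "M - {R} \<noteq> {}" using M by auto
  then have "\<Union>(M - {R}) \<in> F" using a by (auto simp: rooted_def)
  then show ?thesis using star_complement[OF M(1), of "{R}"] M by simp
qed

lemma rooted_part: "rooted M R \<Longrightarrow> R' \<in> M \<Longrightarrow> R' \<noteq> R \<Longrightarrow> R' \<in> F"
proof -
  assume "rooted M R" "R' \<in> M" "R' \<noteq> R"
  then have "\<Union>{R'} \<in> F" unfolding rooted_def by blast
  then show ?thesis by simp
qed

lemma full_part: "full M \<Longrightarrow> R \<in> M \<Longrightarrow> R \<in> F"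
proof -
  assume a: "full M" "R \<in> M"
  then have "3 \<le> card M" using starD(3)[of M] by (simp add: full_def)
  then have "M \<noteq> {R}" by auto
  then have "\<Union>{R} \<in> F" using a unfolding full_def by blast
  then show ?thesis by simp
qed

lemma full_complement: "full M \<Longrightarrow> R \<in> M \<Longrightarrow> X - R \<in> F"
proof -
  assume a: "full M" "R \<in> M"
  then have M: "star M" by (simp add: full_def)
  have "M \<noteq> {R}" using starD(3)[OF M] by auto
  then have "M - {R} \<noteq> {}" "M - {R} \<noteq> M" using a by auto
  then have "\<Union>(M - {R}) \<in> F" using a by (auto simp: full_def)
  then show ?thesis using star_complement[OF M(1), of "{R}"] a by simp
qed

text \<open>The sets of parts whose union is a member form a partitive crossing family on
  \<open>M\<close>. A non-trivial one is not a split, hence is crossed by a member, and that member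
  is a union of parts of the same star. So \<open>crossed_family_trichotomy\<close> applies, with
  \<open>J\<close> as the non-trivial member.\<close>

lemma nontrivial_full_or_rooted:
  assumes M: "star M" and J: "J \<subseteq> M" "2 \<le> card J" "2 \<le> card (M - J)" "\<Union>J \<in> F"
  shows "full M \<or> (\<exists>R. rooted M R \<and> R \<notin> J)"
proof -
  define P where "P = {J. J \<subseteq> M \<and> \<Union>J \<in> F}"
  have finM: "finite M" using starD(4)[OF M] .
  have M4: "4 \<le> card M" using J card_Diff_subset[of J M] finite_subset[OF J(1) finM] by linarith
  have pcfP: "partitive_crossing_family M P"
    unfolding partitive_crossing_family_def
  proof (intro conjI ballI impI)
    show "P \<subseteq> Pow M" by (auto simp: P_def)
    show "M \<in> P" "{} \<in> P" using pcf starD(2)[OF M] by (auto simp: P_def partitive_crossing_family_def)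
    fix A B assume A: "A \<in> P" and B: "B \<in> P" and cr: "crossing M A B"
    then have AB: "A \<subseteq> M" "B \<subseteq> M" "\<Union>A \<in> F" "\<Union>B \<in> F" by (auto simp: P_def)
    have "crossing X (\<Union>A) (\<Union>B)" using star_crossing[OF M AB(1,2)] cr by simp
    note c = pcf_closed[OF pcf AB(3,4) this]
    note ops = star_Union_ops[OF M AB(1,2)] star_Union_ops[OF M AB(2,1)]
    show "A \<inter> B \<in> P" using c(1) ops AB by (auto simp: P_def)
    show "A \<union> B \<in> P" using c(2) AB by (auto simp: P_def)
    show "A - B \<in> P" using c(3) ops AB by (auto simp: P_def)
    show "(A - B) \<union> (B - A) \<in> P" using c(5) ops AB unfolding P_def Union_Un_distrib by auto
  qed
  have weak: "\<exists>B\<in>P. crossing M A B" if A: "A \<in> P" "2 \<le> card A" "2 \<le> card (M - A)" for A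
  proof -
    have AM: "A \<subseteq> M" "\<Union>A \<in> F" using A by (auto simp: P_def)
    have "\<Union>A \<notin> splits" using Union_not_split[OF M AM(1) A(2,3)] .
    moreover have "\<Union>A \<noteq> {}" using not_subset_part[OF M AM(1) A(2)] J(2) starD(3)[OF M]
      by (metis card.empty empty_subsetI ex_in_conv not_numeral_le_zero)
    moreover have "\<Union>A \<noteq> X" using star_Union_inj[OF M AM(1) order_refl] starD(2)[OF M] A(3) by auto
    ultimately obtain B where B: "B \<in> F" "crossing X (\<Union>A) B" using AM F_sub by (auto simp: splits_def)
    have "B \<notin> splits" using splitsD(5)[of B "\<Union>A"] B AM crossing_commute by metis
    moreover have "B \<noteq> {}" "B \<noteq> X" using B(2) F_sub[OF AM(2)] unfolding crossing_def by blast+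
    ultimately obtain M' K where K: "star M'" "K \<subseteq> M'" "B = \<Union>K"
      using member_split_or_star_Union[OF B(1)] by blast
    have "M' = M" using nontrivial_Unions_not_crossing[OF M AM(1) K(1,2)] B K by blast
    then show ?thesis using star_crossing[OF M AM(1), of K] B K by (auto simp: P_def)
  qed
  have JP: "J \<in> P" using J by (simp add: P_def)
  have "(\<forall>J\<subseteq>M. 2 \<le> card J \<longrightarrow> 2 \<le> card (M - J) \<longrightarrow> J \<in> P) \<or>
    (\<exists>i\<in>M. \<forall>J\<subseteq>M. 2 \<le> card J \<longrightarrow> 2 \<le> card (M - J) \<longrightarrow> (J \<in> P \<longleftrightarrow> i \<notin> J))"
  proof (rule crossed_family_trichotomy[OF finM pcfP _ JP J(2,3)])
    show "\<exists>B\<in>P. crossing M A B" if "A \<in> P" "2 \<le> card A" "2 \<le> card (M - A)" for A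
      by (rule weak[OF that])
  qed
  then show ?thesis
  proof
    assume all: "\<forall>J\<subseteq>M. 2 \<le> card J \<longrightarrow> 2 \<le> card (M - J) \<longrightarrow> J \<in> P"
    have pr: "{a, b} \<in> P" if "a \<in> M" "b \<in> M" "a \<noteq> b" for a b
      using all that card_pair_compl[OF finM M4 that] by auto
    have cp: "M - {a, b} \<in> P" if "a \<in> M" "b \<in> M" "a \<noteq> b" for a b
    proof -
      have "M - (M - {a, b}) = {a, b}" using that by auto
      then show ?thesis using all that card_pair_compl[OF finM M4 that] by auto
    qed
    have abc: "\<exists>b c e. b \<in> M \<and> c \<in> M \<and> e \<in> M \<and> a \<noteq> b \<and> a \<noteq> c \<and> b \<noteq> c \<and> e \<noteq> a \<and> e \<noteq> b \<and> e \<noteq> c"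
      if "a \<in> M" for a
    proof -
      have "3 \<le> card (M - {a})" using M4 that finM by simp
      from three_elements[OF this] show ?thesis by blast
    qed
    \<comment> \<open>The trichotomy says nothing about single parts and their complements. They are
      recovered as the intersection of two pairs and the union of two complements of pairs.\<close>
    have s1: "{a} \<in> P" "M - {a} \<in> P" if a: "a \<in> M" for a
    proof -
      obtain b c e where bc: "b \<in> M" "c \<in> M" "e \<in> M" "a \<noteq> b" "a \<noteq> c" "b \<noteq> c" "e \<noteq> a" "e \<noteq> b" "e \<noteq> c"
        using abc[OF a] by blast
      have "crossing M {a, b} {a, c}" using a bc by (intro crossingI[of a _ _ b c e]) auto
      then have "{a, b} \<inter> {a, c} \<in> P"
        by (intro pcf_closed(1)[OF pcfP] pr) (use a bc in auto)
      moreover have "{a, b} \<inter> {a, c} = {a}" using bc by auto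
      ultimately show "{a} \<in> P" by (simp only:)
      have "crossing M (M - {a, b}) (M - {a, c})" using a bc by (intro crossingI[of e _ _ c b a]) auto
      then have "(M - {a, b}) \<union> (M - {a, c}) \<in> P" 
        by (intro pcf_closed(2)[OF pcfP] cp) (use a bc in auto)
      moreover have "(M - {a, b}) \<union> (M - {a, c}) = M - {a}" using bc by auto
      ultimately show "M - {a} \<in> P" by simp
    qed
    have "H \<in> P" if H: "H \<subseteq> M" "H \<noteq> {}" "H \<noteq> M" for H
    proof -
      have fH: "finite H" "finite (M - H)" using finite_subset[of H M] H finM by auto
      have "card H \<noteq> 0" "card (M - H) \<noteq> 0" using H fH by auto
      then consider "2 \<le> card H" "2 \<le> card (M - H)" | "card H = 1" | "card (M - H) = 1" by linarith
      then show ?thesis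
      proof cases
        case 2
        then show ?thesis using s1 H by (metis card_1_singletonE insert_subset)
      next
        case 3
        then obtain a where a: "M - H = {a}" by (meson card_1_singletonE)
        then have "H = M - {a}" "a \<in> M" using H by auto
        then show ?thesis using s1 by simp
      qed (use all H in blast)
    qed
    then have "full M" using M by (auto simp: full_def P_def)
    then show ?thesis ..
  next
    assume "\<exists>i\<in>M. \<forall>J\<subseteq>M. 2 \<le> card J \<longrightarrow> 2 \<le> card (M - J) \<longrightarrow> (J \<in> P \<longleftrightarrow> i \<notin> J)"
    then obtain R where R: "R \<in> M"
      and iff: "\<And>J. J \<subseteq> M \<Longrightarrow> 2 \<le> card J \<Longrightarrow> 2 \<le> card (M - J) \<Longrightarrow> J \<in> P \<longleftrightarrow> R \<notin> J" by blast
    have "3 \<le> card (M - {R})" using M4 R finM by simp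
    have abc: "\<exists>b c. b \<in> M - {R} \<and> c \<in> M - {R} \<and> a \<noteq> b \<and> a \<noteq> c \<and> b \<noteq> c" for a
    proof -
      obtain x y z where "x \<in> M - {R}" "y \<in> M - {R}" "z \<in> M - {R}" "x \<noteq> y" "x \<noteq> z" "y \<noteq> z"
        using three_elements[OF \<open>3 \<le> card (M - {R})\<close>] by blast
      then show ?thesis by metis
    qed
    have s1: "{a} \<in> P" if a: "a \<in> M" "a \<noteq> R" for a
    proof -
      obtain b c where bc: "b \<in> M" "c \<in> M" "b \<noteq> R" "c \<noteq> R" "a \<noteq> b" "a \<noteq> c" "b \<noteq> c"
        using abc[of a] by auto
      have "{a, b} \<in> P" "{a, c} \<in> P" using iff[of "{a, b}"] iff[of "{a, c}"] a bc
          card_pair_compl[OF finM M4 a(1) bc(1) bc(5)] card_pair_compl[OF finM M4 a(1) bc(2) bc(6)] by auto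
      moreover have "crossing M {a, b} {a, c}" using a bc R by (intro crossingI[of a _ _ b c R]) auto
      ultimately have "{a, b} \<inter> {a, c} \<in> P" by (rule pcf_closed(1)[OF pcfP])
      moreover have "{a, b} \<inter> {a, c} = {a}" using bc by auto
      ultimately show ?thesis by (simp only:)
    qed
    \<comment> \<open>The complement of a pair containing \<open>R\<close> avoids \<open>R\<close>,
      so it is a member; two such complements cross and have the required union.\<close>
    have all: "M - {R} \<in> P"
    proof -
      obtain b c where bc: "b \<in> M" "c \<in> M" "b \<noteq> R" "c \<noteq> R" "b \<noteq> c" using abc[of R] by auto
      have e: "M - (M - {R, x}) = {R, x}" if "x \<in> M" for x using that R by auto
      have P2: "M - {R, b} \<in> P" "M - {R, c} \<in> P"
        using iff[of "M - {R, b}"] iff[of "M - {R, c}"] R bc e[OF bc(1)] e[OF bc(2)]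
          card_pair_compl[OF finM M4 R bc(1)] card_pair_compl[OF finM M4 R bc(2)] by auto
      have "\<not> M \<subseteq> {R, b, c}" using M4 bc card_mono[of "{R, b, c}" M] by auto
      then obtain f where "f \<in> M" "f \<noteq> R" "f \<noteq> b" "f \<noteq> c" by blast
      then have "crossing M (M - {R, b}) (M - {R, c})" using bc R by (intro crossingI[of f _ _ c b R]) auto
      then have "(M - {R, b}) \<union> (M - {R, c}) \<in> P" 
        by (rule pcf_closed(2)[OF pcfP P2])
      moreover have "(M - {R, b}) \<union> (M - {R, c}) = M - {R}" using bc by auto
      ultimately show ?thesis by simp
    qed
    have "H \<in> P" if H: "H \<subseteq> M - {R}" "H \<noteq> {}" for H
    proof -
      have fH: "finite H" "finite (M - H)" using finite_subset[of H M] H finM by auto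
      have "card H \<noteq> 0" "card (M - H) \<noteq> 0" using H R fH by auto
      then consider "2 \<le> card H" "2 \<le> card (M - H)" | "card H = 1" | "card (M - H) = 1" by linarith
      then show ?thesis
      proof cases
        case 1
        then show ?thesis using iff[of H] H by blast
      next
        case 2
        then show ?thesis using s1 H by (metis Diff_iff card_1_singletonE insert_subset singletonI)
      next
        case 3
        then obtain a where a: "M - H = {a}" by (meson card_1_singletonE)
        then have "H = M - {R}" using H R by blast
        then show ?thesis using all by simp
      qed
    qed
    moreover have "\<Union>H \<notin> F" if "H \<subseteq> M" "R \<in> H" "2 \<le> card H" "2 \<le> card (M - H)" for H
      using iff[of H] that by (auto simp: P_def)
    ultimately have "rooted M R" using M M4 R by (auto simp: rooted_def P_def)
    moreover have "R \<notin> J" using iff[of J] J JP by blast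
    ultimately show ?thesis by blast
  qed
qed

text \<open>If \<open>M\<close> is rooted at \<open>R\<close>, then the neighbour on the side \<open>R\<close> must not be an in-neighbour of \<open>M\<close>;
  so if \<open>R\<close> is a member and the other end of the edge does not produce it either, the edge has to
  be subdivided.\<close>

definition unexpressed :: "'a set \<Rightarrow> bool" where
  "unexpressed R \<longleftrightarrow> R \<in> F \<and> (\<exists>M. rooted M R) \<and> \<not> (\<exists>M. full M \<and> X - R \<in> M)"

definition subdivided :: "'a set \<Rightarrow> bool" where
  "subdivided S \<longleftrightarrow> S \<in> splits \<and> (unexpressed S \<or> unexpressed (X - S))"

text \<open>These are the nodes of the tree described without a tree: leaves, branching nodes, and
  forced nodes of degree two. A leaf sees a single side, so the cardinality of a code is the degree
  of its node and tells the three kinds apart.\<close>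

definition codes :: "'a set set set" where
  "codes = (\<lambda>x. {X - {x}}) ` X \<union> {M. star M} \<union> {{S, X - S} | S. subdivided S}"

lemma subdivided_complement: "subdivided S \<Longrightarrow> subdivided (X - S)"
  using splits_complement compl_compl splitsD(1) unfolding subdivided_def by metis

lemma star_Pow: "star M \<Longrightarrow> M \<subseteq> Pow X"
  using starD(2) by blast

lemma codes_finite: "finite codes"
proof (rule finite_subset)
  show "codes \<subseteq> Pow (Pow X)" using star_Pow splitsD(1) by (auto simp: codes_def subdivided_def)
qed (simp add: finite_X)

end

section \<open>Rooted trees\<close>

lemma adjacent_sym: "adjacent T u v \<Longrightarrow> adjacent T v u"
  by (auto simp: adjacent_def)

text \<open>\<open>D\<close> plays the role of a component left after deletion of the edge from
  \<open>u\<close> to \<open>v\<close>. The condition is local to edges and can be checked without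
  any path.\<close>

definition cut :: "'a otree \<Rightarrow> 'a node set \<Rightarrow> 'a node \<Rightarrow> 'a node \<Rightarrow> bool" where
  "cut T D u v \<longleftrightarrow> u \<in> D \<and> v \<notin> D \<and> (\<forall>a b. adjacent T a b \<longrightarrow> a \<in> D \<longrightarrow> b \<notin> D \<longrightarrow> a = u \<and> b = v)"

lemma cut_Compl: "cut T D u v \<Longrightarrow> cut T (- D) v u"
  unfolding cut_def using adjacent_sym by blast

text \<open>A path can change sides only along the edge between \<open>a\<close> and
  \<open>b\<close>, in one direction or the other, and would then visit \<open>b\<close>.\<close>

lemma cut_stay:
  assumes "cut T D a b" "successively (adjacent T) xs" "xs \<noteq> []" "b \<notin> set xs"
  shows "hd xs \<in> D \<longleftrightarrow> last xs \<in> D"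
  using assms(2-4)
proof (induction xs rule: induct_list012)
  case (3 x y zs)
  have "adjacent T x y" "adjacent T y x" using 3(3) adjacent_sym by auto
  then have "x \<in> D \<longleftrightarrow> y \<in> D" using assms(1) 3(5) unfolding cut_def by (metis list.set_intros(1,2))
  moreover have "y \<in> D \<longleftrightarrow> last (y # zs) \<in> D" using 3 by auto
  ultimately show ?case by simp
qed auto

lemma successively_appendD:
  "successively P (xs @ ys) \<Longrightarrow> successively P xs \<and> successively P ys"
  by (simp add: successively_append_iff)

text \<open>To reach \<open>v\<close> from inside \<open>D\<close> the path must leave through
  \<open>u\<close>. If it visits \<open>u\<close>, the initial segment up to \<open>u\<close> avoids
  \<open>v\<close>, since \<open>v\<close> comes last and nodes do not repeat; so the path already
  started in \<open>D\<close>.\<close>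

lemma cut_path:
  assumes c: "cut T D u v" and p: "simple_path T z p v"
  shows "u \<in> set p \<longleftrightarrow> z \<in> D"
proof -
  have p': "p \<noteq> []" "hd p = z" "last p = v" "distinct p" "successively (adjacent T) p"
    using p by (auto simp: simple_path_def)
  have uv: "u \<in> D" "v \<notin> D" using c by (auto simp: cut_def)
  show ?thesis
  proof (cases "u \<in> set p")
    case False
    then have "hd p \<in> - D \<longleftrightarrow> last p \<in> - D" using cut_stay[OF cut_Compl[OF c]] p' by blast
    then show ?thesis using False p' uv by simp
  next
    case True
    then obtain ys zs where ys: "p = ys @ u # zs" by (meson split_list)
    then have zs: "zs \<noteq> []" using p' uv by auto
    then have "v \<in> set zs" using p' ys by (metis last_appendR last_ConsR last_in_set list.simps(3))
    then have "v \<notin> set (ys @ [u])" using p' ys by auto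
    moreover have "successively (adjacent T) (ys @ [u])" using p'(5) ys successively_appendD[of _ "ys @ [u]" zs] by simp
    ultimately have "hd (ys @ [u]) \<in> D \<longleftrightarrow> last (ys @ [u]) \<in> D" using cut_stay[OF c] by blast
    moreover have "hd (ys @ [u]) = z" using p' ys by (cases ys) auto
    ultimately show ?thesis using True uv by simp
  qed
qed

text \<open>If two paths differ in their first step, the first edge of one of them separates their
  ends, although both end in \<open>v\<close>.\<close>

lemma simple_path_unique:
  assumes cuts: "\<And>a b. adjacent T a b \<Longrightarrow> \<exists>D. cut T D a b"
  shows "simple_path T u p v \<Longrightarrow> simple_path T u q v \<Longrightarrow> p = q"
proof (induction p arbitrary: u q)
  case Nil
  then show ?case by (simp add: simple_path_def)
next
  case (Cons a p)
  have a: "a = u" using Cons.prems by (simp add: simple_path_def)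
  obtain q' where q: "q = u # q'" using Cons.prems(2) by (cases q) (auto simp: simple_path_def)
  have up: "u \<notin> set p" "u \<notin> set q'" using Cons.prems a q by (auto simp: simple_path_def)
  have ends: "(p = [] \<longleftrightarrow> u = v)" "(q' = [] \<longleftrightarrow> u = v)"
    using Cons.prems a q up last_in_set[of p] last_in_set[of q']
    by (auto simp: simple_path_def split: if_splits)
  show ?case
  proof (cases "p = []")
    case True
    then show ?thesis using ends q a by simp
  next
    case False
    then have ne: "p \<noteq> []" "q' \<noteq> []" using ends by auto
    have P: "simple_path T (hd p) p v" "adjacent T u (hd p)"
      using Cons.prems(1) a ne by (auto simp: simple_path_def successively_Cons)
    have Q: "simple_path T (hd q') q' v" "adjacent T u (hd q')"
      using Cons.prems(2) q ne by (auto simp: simple_path_def successively_Cons)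
    have "hd p = hd q'"
    proof (rule ccontr)
      assume d: "hd p \<noteq> hd q'"
      obtain D where D: "cut T D (hd p) u" using cuts[OF adjacent_sym[OF P(2)]] by blast
      have "hd p \<in> D \<longleftrightarrow> last p \<in> D" "hd q' \<in> D \<longleftrightarrow> last q' \<in> D"
        using cut_stay[OF D] P Q up by (auto simp: simple_path_def)
      moreover have "hd p \<in> D" "hd q' \<notin> D" using D adjacent_sym[OF Q(2)] d unfolding cut_def by metis+
      moreover have "last p = v" "last q' = v" using P Q by (auto simp: simple_path_def)
      ultimately show False by simp
    qed
    then have "p = q'" using Cons.IH P Q by metis
    then show ?thesis using a q by simp
  qed
qed

lemma simple_path_exists:
  assumes "(u, v) \<in> {(a, b). adjacent T a b}\<^sup>*" "u \<in> nodes T" "arcs T \<subseteq> nodes T \<times> nodes T"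
  shows "\<exists>p. simple_path T u p v"
  using assms(1)
proof (induction rule: rtrancl_induct)
  case base
  then show ?case using assms by (intro exI[of _ "[u]"]) (simp add: simple_path_def)
next
  case (step v w)
  then obtain p where p: "simple_path T u p v" by blast
  have vw: "adjacent T v w" using step by simp
  show ?case
  proof (cases "w \<in> set p")
    case True
    then obtain ys zs where "p = ys @ w # zs" by (meson split_list)
    then have "simple_path T u (ys @ [w]) w" using p successively_appendD[of _ "ys @ [w]" zs]
      by (cases ys) (auto simp: simple_path_def)
    then show ?thesis ..
  next
    case False
    have "w \<in> nodes T" using vw assms(3) by (auto simp: adjacent_def)
    then have "simple_path T u (p @ [w]) w" using p False vw
      by (auto simp: simple_path_def successively_append_iff)
    then show ?thesis ..
  qed
qed

lemma side_cut:
  assumes "cut T D u v" "\<And>w. w \<in> nodes T \<Longrightarrow> \<exists>p. simple_path T w p v"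
  shows "side T u v = {x. Leaf x \<in> leaves T \<and> Leaf x \<in> D}"
proof -
  have "(\<exists>p. simple_path T (Leaf x) p v \<and> u \<in> set p) \<longleftrightarrow> Leaf x \<in> D" if "Leaf x \<in> leaves T" for x
  proof -
    have "Leaf x \<in> nodes T" using that by (simp add: leaves_def)
    then show ?thesis using assms(2) cut_path[OF assms(1)] by blast
  qed
  then show ?thesis by (auto simp: side_def)
qed

text \<open>\<open>dep\<close> may be any measure that decreases towards the root: the length of the
  path to the root for a given tree, and \<open>dep_code\<close> for the canonical one.\<close>

locale rooted_graph =
  fixes T :: "'a otree" and rt :: "'a node" and par :: "'a node \<Rightarrow> 'a node" and dep :: "'a node \<Rightarrow> nat"
  assumes fin_nodes: "finite (nodes T)" and rt_node: "rt \<in> nodes T"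
    and par_node: "u \<in> nodes T \<Longrightarrow> u \<noteq> rt \<Longrightarrow> par u \<in> nodes T"
    and dep_par: "u \<in> nodes T \<Longrightarrow> u \<noteq> rt \<Longrightarrow> dep (par u) < dep u"
    and adj: "adjacent T u v \<longleftrightarrow> (u \<in> nodes T \<and> u \<noteq> rt \<and> v = par u) \<or> (v \<in> nodes T \<and> v \<noteq> rt \<and> u = par v)"
begin

definition up :: "('a node \<times> 'a node) set" where
  "up = {(u, par u) | u. u \<in> nodes T \<and> u \<noteq> rt}"

definition desc :: "'a node \<Rightarrow> 'a node set" where
  "desc u = {w \<in> nodes T. (w, u) \<in> up\<^sup>*}"

lemma up_iff: "(u, v) \<in> up \<longleftrightarrow> u \<in> nodes T \<and> u \<noteq> rt \<and> v = par u"
  by (auto simp: up_def)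

lemma desc_self: "u \<in> nodes T \<Longrightarrow> u \<in> desc u"
  by (simp add: desc_def)

lemma desc_nodes: "desc u \<subseteq> nodes T"
  by (auto simp: desc_def)

lemma desc_trans: "w \<in> desc v \<Longrightarrow> v \<in> desc u \<Longrightarrow> w \<in> desc u"
  by (auto simp: desc_def)

lemma desc_dep: "w \<in> desc u \<Longrightarrow> w = u \<or> dep u < dep w"
proof -
  assume "w \<in> desc u"
  then have "(w, u) \<in> up\<^sup>*" by (simp add: desc_def)
  then show ?thesis
  proof (induction rule: converse_rtrancl_induct)
    case (step y z)
    then show ?case using dep_par[of y] by (auto simp: up_iff)
  qed simp
qed

lemma desc_par: "w \<in> desc u \<Longrightarrow> w \<noteq> u \<Longrightarrow> w \<noteq> rt \<and> par w \<in> desc u"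
proof -
  assume w: "w \<in> desc u" "w \<noteq> u"
  then have "(w, u) \<in> up\<^sup>*" by (simp add: desc_def)
  then obtain z where "(w, z) \<in> up" "(z, u) \<in> up\<^sup>*" using w by (metis converse_rtranclE)
  then show ?thesis using par_node by (auto simp: up_iff desc_def)
qed

lemma child_desc: "u \<in> nodes T \<Longrightarrow> u \<noteq> rt \<Longrightarrow> u \<in> desc (par u)"
  by (auto simp: desc_def up_iff intro!: r_into_rtrancl)

lemma par_notin_desc: "u \<in> nodes T \<Longrightarrow> u \<noteq> rt \<Longrightarrow> par u \<notin> desc u"
  using desc_dep[of "par u" u] dep_par[of u] by auto

lemma desc_child_cases:
  assumes "w \<in> desc v" "w \<noteq> v"
  shows "\<exists>c\<in>nodes T. c \<noteq> rt \<and> par c = v \<and> w \<in> desc c"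
proof -
  have "(w, v) \<in> up\<^sup>*" using assms by (simp add: desc_def)
  then obtain c where c: "(w, c) \<in> up\<^sup>*" "(c, v) \<in> up" using assms by (metis rtranclE)
  then show ?thesis using assms by (auto simp: up_iff desc_def)
qed

lemma desc_nested:
  assumes "w \<in> desc u" "w \<in> desc v" "u \<in> nodes T" "v \<in> nodes T"
  shows "u \<in> desc v \<or> v \<in> desc u"
proof -
  have "single_valued up" by (auto simp: single_valued_def up_iff)
  from single_valued_confluent[OF this] show ?thesis using assms by (auto simp: desc_def)
qed

lemma in_desc_rt: "u \<in> nodes T \<Longrightarrow> u \<in> desc rt"
proof (induction "dep u" arbitrary: u rule: less_induct)
  case less
  show ?case
  proof (cases "u = rt")
    case False
    then have "par u \<in> desc rt" using less dep_par par_node by blast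
    then show ?thesis using child_desc desc_trans less False by blast
  qed (use less desc_self in blast)
qed

lemma rt_in_desc: "rt \<in> desc u \<Longrightarrow> u = rt"
  using desc_par by blast

lemma cut_up: "u \<in> nodes T \<Longrightarrow> u \<noteq> rt \<Longrightarrow> cut T (desc u) u (par u)"
  unfolding cut_def
proof (intro conjI allI impI)
  assume u: "u \<in> nodes T" "u \<noteq> rt"
  show "u \<in> desc u" "par u \<notin> desc u" using u desc_self par_notin_desc by blast+
  fix a b assume ab: "adjacent T a b" "a \<in> desc u" "b \<notin> desc u"
  have "\<not> (b \<in> nodes T \<and> b \<noteq> rt \<and> a = par b)" using ab child_desc[of b] desc_trans[of b a u] by blast
  then have b: "b = par a" using ab(1) adj[of a b] by blast
  then have "a = u" using ab(2,3) desc_par[of a u] by blast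
  then show "a = u" "b = par u" using b by simp_all
qed

lemma adjacent_cut: "adjacent T a b \<Longrightarrow> \<exists>D. cut T D a b"
proof -
  assume "adjacent T a b"
  then consider "a \<in> nodes T" "a \<noteq> rt" "b = par a" | "b \<in> nodes T" "b \<noteq> rt" "a = par b"
    using adj[of a b] by blast
  then show ?thesis
  proof cases
    case 1
    then show ?thesis using cut_up[of a] by blast
  next
    case 2
    then show ?thesis using cut_Compl[OF cut_up[of b]] by blast
  qed
qed

lemma arcs_sub: "arcs T \<subseteq> nodes T \<times> nodes T"
proof
  fix e assume e: "e \<in> arcs T"
  obtain u v where uv: "e = (u, v)" by (cases e)
  then have "adjacent T u v" using e by (simp add: adjacent_def)
  then show "e \<in> nodes T \<times> nodes T" using adj uv par_node by auto
qed

lemma not_adjacent_self: "\<not> adjacent T u u"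
  using adj dep_par by (metis less_irrefl)

lemma path_exists:
  assumes "u \<in> nodes T" "v \<in> nodes T" shows "\<exists>p. simple_path T u p v"
proof (rule simple_path_exists[OF _ assms(1) arcs_sub])
  let ?A = "{(a, b). adjacent T a b}"
  have "up \<subseteq> ?A" using adj by (auto simp: up_iff)
  then have sub: "up\<^sup>* \<subseteq> ?A\<^sup>*" by (rule rtrancl_mono)
  have "sym ?A" using adjacent_sym by (auto simp: sym_def)
  then have "sym (?A\<^sup>*)" by (rule sym_rtrancl)
  moreover have "(u, rt) \<in> ?A\<^sup>*" "(v, rt) \<in> ?A\<^sup>*" using in_desc_rt assms sub by (auto simp: desc_def)
  ultimately show "(u, v) \<in> ?A\<^sup>*" by (meson rtrancl_trans symD)
qed

lemma oriented_tree: "oriented_tree T"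
  unfolding oriented_tree_def
proof (intro conjI ballI allI)
  fix u v assume "u \<in> nodes T" "v \<in> nodes T"
  then obtain p where "simple_path T u p v" using path_exists by blast
  then show "\<exists>!p. simple_path T u p v" using simple_path_unique[OF adjacent_cut] by blast
next
  show "(v, v) \<notin> arcs T" for v using not_adjacent_self by (auto simp: adjacent_def)
qed (fact fin_nodes arcs_sub)+

lemma side_up:
  assumes "u \<in> nodes T" "u \<noteq> rt"
  shows "side T u (par u) = {x. Leaf x \<in> leaves T \<and> Leaf x \<in> desc u}"
  using side_cut[OF cut_up[OF assms]] path_exists par_node assms by blast

lemma side_down:
  assumes "u \<in> nodes T" "u \<noteq> rt"
  shows "side T (par u) u = {x. Leaf x \<in> leaves T \<and> Leaf x \<notin> desc u}"
  using side_cut[OF cut_Compl[OF cut_up[OF assms]]] path_exists assms by auto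

definition children :: "'a node \<Rightarrow> 'a node set" where
  "children v = {u \<in> nodes T. u \<noteq> rt \<and> par u = v}"

lemma nbrs_rt: "{w. adjacent T rt w} = children rt"
  using adj by (auto simp: children_def)

lemma nbrs_children: "v \<in> nodes T \<Longrightarrow> v \<noteq> rt \<Longrightarrow> {w. adjacent T v w} = insert (par v) (children v)"
  using adj by (auto simp: children_def)

lemma finite_children: "finite (children v)"
  using fin_nodes by (simp add: children_def)

lemma par_notin_children: "v \<in> nodes T \<Longrightarrow> v \<noteq> rt \<Longrightarrow> par v \<notin> children v"
  using dep_par[of v] dep_par[of "par v"] by (auto simp: children_def)

lemma card_nbrs: "v \<in> nodes T \<Longrightarrow> v \<noteq> rt \<Longrightarrow> card {w. adjacent T v w} = Suc (card (children v))"
  using nbrs_children par_notin_children finite_children by simp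

lemma children_desc_disjoint:
  assumes "a \<in> children v" "b \<in> children v" "a \<noteq> b" shows "desc a \<inter> desc b = {}"
proof (rule ccontr)
  assume "desc a \<inter> desc b \<noteq> {}"
  then obtain w where "w \<in> desc a" "w \<in> desc b" by blast
  then have "a \<in> desc b \<or> b \<in> desc a" using desc_nested[of w a b] assms by (auto simp: children_def)
  then have "v \<in> desc b \<or> v \<in> desc a"
    using desc_par[of a b] desc_par[of b a] assms by (auto simp: children_def)
  then show False using assms par_notin_desc[of a] par_notin_desc[of b] by (auto simp: children_def)
qed

end

text \<open>The parent is the second node on the unique path to the root. For an edge, either
  \<open>u\<close> is not on the path from \<open>v\<close>, and prepending \<open>u\<close> gives
  its own path; or it is, and then by uniqueness the initial segment from \<open>v\<close> to
  \<open>u\<close> is the edge itself.\<close>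

lemma oriented_tree_rooted:
  assumes T: "oriented_tree T" and rt: "rt \<in> nodes T"
  shows "\<exists>par dep. rooted_graph T rt par dep"
proof -
  define pth where "pth u = (THE p. simple_path T u p rt)" for u
  have ex1: "\<exists>!p. simple_path T u p v" if "u \<in> nodes T" "v \<in> nodes T" for u v
    using T that by (auto simp: oriented_tree_def)
  have pth: "simple_path T u (pth u) rt" if "u \<in> nodes T" for u
    unfolding pth_def using theI'[OF ex1[OF that rt]] .
  have uniq: "p = q" if "simple_path T u p v" "simple_path T u q v" for u v p q
  proof -
    have "u \<in> nodes T" "v \<in> nodes T" using that(1) hd_in_set[of p] last_in_set[of p]
      by (auto simp: simple_path_def)
    then show ?thesis using ex1 that by blast
  qed
  define par where "par u = hd (tl (pth u))" for u
  define dep where "dep u = length (pth u)" for u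
  have nbr: "a \<in> nodes T" "b \<in> nodes T" "a \<noteq> b" if "adjacent T a b" for a b
    using that T by (auto simp: adjacent_def oriented_tree_def)
  have step: "pth u = u # pth (par u) \<and> par u \<in> nodes T \<and> adjacent T u (par u)"
    if u: "u \<in> nodes T" "u \<noteq> rt" for u
  proof -
    obtain q where q: "pth u = u # q" using pth[OF u(1)] by (cases "pth u") (auto simp: simple_path_def)
    have "q \<noteq> []" using q pth[OF u(1)] u by (auto simp: simple_path_def)
    moreover have hq: "hd q = par u" using q by (simp add: par_def)
    ultimately have "simple_path T (par u) q rt" "adjacent T u (par u)" "par u \<in> nodes T"
      using pth[OF u(1)] q hd_in_set[of q] by (auto simp: simple_path_def successively_Cons)
    then show ?thesis using uniq[of "par u" q rt "pth (par u)"] pth q by blast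
  qed
  have "rooted_graph T rt par dep"
  proof
    show "finite (nodes T)" using T by (simp add: oriented_tree_def)
    show "rt \<in> nodes T" by fact
    show "par u \<in> nodes T" if "u \<in> nodes T" "u \<noteq> rt" for u using step that by blast
    show "dep (par u) < dep u" if "u \<in> nodes T" "u \<noteq> rt" for u
      using step[OF that] by (simp add: dep_def)
    fix u v
    show "adjacent T u v \<longleftrightarrow> (u \<in> nodes T \<and> u \<noteq> rt \<and> v = par u) \<or> (v \<in> nodes T \<and> v \<noteq> rt \<and> u = par v)"
    proof
      assume a: "adjacent T u v"
      note n = nbr[OF a]
      show "(u \<in> nodes T \<and> u \<noteq> rt \<and> v = par u) \<or> (v \<in> nodes T \<and> v \<noteq> rt \<and> u = par v)"
      proof (cases "u \<in> set (pth v)")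
        case False
        have hv: "pth v \<noteq> []" "hd (pth v) = v" "last (pth v) = rt"
          using pth[OF n(2)] by (auto simp: simple_path_def)
        then have "simple_path T u (u # pth v) rt" using pth[OF n(2)] False a n
          by (auto simp: simple_path_def successively_Cons)
        then have "pth u = u # pth v" using uniq pth n by blast
        then have "par u = v" using hv by (simp add: par_def)
        moreover have "u \<noteq> rt" using False hv last_in_set by metis
        ultimately show ?thesis using n by blast
      next
        case True
        then obtain ys zs where ys: "pth v = ys @ u # zs" by (meson split_list)
        have "simple_path T v (ys @ [u]) u" using pth[OF n(2)] ys successively_appendD[of _ "ys @ [u]" zs]
          by (cases ys) (auto simp: simple_path_def)
        moreover have "simple_path T v [v, u] u" using n adjacent_sym[OF a] by (simp add: simple_path_def)
        ultimately have "ys @ [u] = [v, u]" using uniq by blast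
        then have e: "pth v = v # u # zs" using ys by simp
        then have "par v = u" by (simp add: par_def)
        moreover have "v \<noteq> rt"
        proof
          assume "v = rt"
          then have "last (u # zs) = v" "distinct (v # u # zs)" using pth[OF n(2)] e by (auto simp: simple_path_def)
          then show False by (metis distinct.simps(2) last_in_set list.simps(3))
        qed
        ultimately show ?thesis using n by blast
      qed
    next
      assume "(u \<in> nodes T \<and> u \<noteq> rt \<and> v = par u) \<or> (v \<in> nodes T \<and> v \<noteq> rt \<and> u = par v)"
      then show "adjacent T u v" using step adjacent_sym by blast
    qed
  qed
  then show ?thesis by blast
qed

section \<open>Sides and codes\<close>

definition node_code :: "'a otree \<Rightarrow> 'a node \<Rightarrow> 'a set set" where
  "node_code T v = (\<lambda>u. side T u v) ` {u. adjacent T v u}"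

lemma node_codeI: "adjacent T u v \<Longrightarrow> side T u v \<in> node_code T v"
  using adjacent_sym by (auto simp: node_code_def)

lemma node_codeE:
  assumes "S \<in> node_code T v" obtains u where "adjacent T u v" "S = side T u v"
  using assms adjacent_sym by (auto simp: node_code_def)

text \<open>The root is a leaf, hence labelled by an element \<open>r\<close> of the ground set. Of
  the two sides of an edge, exactly the upper one contains \<open>r\<close>.\<close>

locale rooted_otree = rooted_graph T rt par dep
  for T :: "'a otree" and rt par dep +
  fixes X :: "'a set" and r :: 'a
  assumes leaves_eq: "leaves T = Leaf ` X" and rt_Leaf: "rt = Leaf r" and r_in: "r \<in> X"
    and finite_X: "finite X" and two_le_card: "2 \<le> card X"
begin

definition cl :: "'a node \<Rightarrow> 'a set" where
  "cl u = {x \<in> X. Leaf x \<in> desc u}"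

lemma Leaf_leaves: "Leaf x \<in> leaves T \<longleftrightarrow> x \<in> X"
  using leaves_eq by auto

lemma side_cl: "u \<in> nodes T \<Longrightarrow> u \<noteq> rt \<Longrightarrow> side T u (par u) = cl u"
  using side_up by (auto simp: Leaf_leaves cl_def)

lemma side_cl': "u \<in> nodes T \<Longrightarrow> u \<noteq> rt \<Longrightarrow> side T (par u) u = X - cl u"
  using side_down by (auto simp: Leaf_leaves cl_def)

lemma cl_sub: "cl u \<subseteq> X" by (auto simp: cl_def)

lemma cl_mono: "u \<in> desc v \<Longrightarrow> cl u \<subseteq> cl v"
  using desc_trans by (auto simp: cl_def)

lemma r_notin_cl: "u \<noteq> rt \<Longrightarrow> r \<notin> cl u"
  using rt_in_desc[of u] by (auto simp: cl_def rt_Leaf[symmetric])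

lemma leaf_iff: "v \<in> nodes T \<Longrightarrow> v \<in> Leaf ` X \<longleftrightarrow> card {w. adjacent T v w} \<le> 1"
  using leaves_eq by (auto simp: leaves_def)

text \<open>A deepest descendant has no children, so its degree is at most one and it is a leaf of
  the tree.\<close>

lemma cl_nonempty: "u \<in> nodes T \<Longrightarrow> cl u \<noteq> {}"
proof -
  assume u: "u \<in> nodes T"
  have fd: "finite (desc u)" using desc_nodes fin_nodes by (rule finite_subset)
  have "Max (dep ` desc u) \<in> dep ` desc u" using fd desc_self[OF u] by (intro Max_in) auto
  then obtain w where w: "w \<in> desc u" "dep w = Max (dep ` desc u)" by auto
  have mx: "dep z \<le> dep w" if "z \<in> desc u" for z using w that fd by simp
  have wn: "w \<in> nodes T" using w desc_nodes by blast
  have ch: "children w = {}"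
  proof (rule ccontr)
    assume "children w \<noteq> {}"
    then obtain c where c: "c \<in> nodes T" "c \<noteq> rt" "par c = w" by (auto simp: children_def)
    have "c \<in> desc w" using child_desc[OF c(1,2)] c(3) by simp
    then have "c \<in> desc u" using w desc_trans by blast
    then show False using mx[of c] dep_par[OF c(1,2)] c(3) by simp
  qed
  have "card {z. adjacent T w z} \<le> 1"
    using nbrs_rt card_nbrs[OF wn] ch by (cases "w = rt") auto
  then obtain x where "w = Leaf x" "x \<in> X" using leaf_iff[OF wn] by blast
  then show ?thesis using w by (auto simp: cl_def)
qed

lemma Leaf_node: "x \<in> X \<Longrightarrow> Leaf x \<in> nodes T"
  using leaves_eq by (auto simp: leaves_def)

lemma leaf_no_children: "v \<in> Leaf ` X \<Longrightarrow> v \<noteq> rt \<Longrightarrow> children v = {}"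
proof -
  assume v: "v \<in> Leaf ` X" "v \<noteq> rt"
  then have vn: "v \<in> nodes T" using Leaf_node by blast
  have "card (children v) = 0" using leaf_iff[OF vn] card_nbrs[OF vn v(2)] v by simp
  then show ?thesis using finite_children by simp
qed

lemma desc_no_children: "v \<in> nodes T \<Longrightarrow> children v = {} \<Longrightarrow> desc v = {v}"
  using desc_child_cases[of _ v] desc_self[of v] by (auto simp: children_def)

lemma cl_Leaf: "x \<in> X \<Longrightarrow> x \<noteq> r \<Longrightarrow> cl (Leaf x) = {x}"
proof -
  assume x: "x \<in> X" "x \<noteq> r"
  then have "Leaf x \<noteq> rt" using rt_Leaf by simp
  then have "desc (Leaf x) = {Leaf x}"
    using desc_no_children[OF Leaf_node[OF x(1)]] leaf_no_children[of "Leaf x"] x by blast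
  then show ?thesis using x by (auto simp: cl_def)
qed

lemma cl_rt: "cl rt = X"
  using in_desc_rt Leaf_node by (auto simp: cl_def)

lemma rt_child: "\<exists>c. children rt = {c}"
proof -
  have "card (children rt) \<le> 1" using leaf_iff[OF rt_node] nbrs_rt rt_Leaf r_in by auto
  moreover have "children rt \<noteq> {}"
  proof
    assume "children rt = {}"
    then have "desc rt = {rt}" by (rule desc_no_children[OF rt_node])
    moreover have "x = r" if "Leaf x = rt" for x using that rt_Leaf by simp
    ultimately have "cl rt \<subseteq> {r}" by (auto simp: cl_def)
    then have "card X \<le> 1" using cl_rt card_mono[of "{r}" X] by simp
    then show False using two_le_card by simp
  qed
  ultimately have "card (children rt) = 1" using finite_children by (simp add: le_Suc_eq)
  then show ?thesis by (meson card_1_singletonE)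
qed

lemma child_in_desc: "c \<in> children v \<Longrightarrow> c \<in> desc v"
  using child_desc by (auto simp: children_def)

lemma childD: "c \<in> children v \<Longrightarrow> c \<in> nodes T \<and> c \<noteq> rt \<and> par c = v"
  by (auto simp: children_def)

lemma cl_children: "v \<in> nodes T \<Longrightarrow> v \<notin> Leaf ` X \<Longrightarrow> cl v = (\<Union>c\<in>children v. cl c)"
proof
  assume v: "v \<in> nodes T" "v \<notin> Leaf ` X"
  show "cl v \<subseteq> (\<Union>c\<in>children v. cl c)"
  proof
    fix x assume x: "x \<in> cl v"
    then have "Leaf x \<noteq> v" "Leaf x \<in> desc v" using v by (auto simp: cl_def)
    then show "x \<in> (\<Union>c\<in>children v. cl c)" using desc_child_cases[of "Leaf x" v] x
      by (auto simp: cl_def children_def)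
  qed
  show "(\<Union>c\<in>children v. cl c) \<subseteq> cl v" using child_in_desc cl_mono by blast
qed

lemma cl_children_disjoint: "a \<in> children v \<Longrightarrow> b \<in> children v \<Longrightarrow> a \<noteq> b \<Longrightarrow> cl a \<inter> cl b = {}"
  using children_desc_disjoint by (fastforce simp: cl_def)

lemma adjacent_cases:
  assumes "adjacent T u v"
  obtains (up) "u \<in> nodes T" "u \<noteq> rt" "v = par u" "side T u v = cl u" "side T v u = X - cl u"
  | (down) "v \<in> nodes T" "v \<noteq> rt" "u = par v" "side T u v = X - cl v" "side T v u = cl v"
  using assms adj[of u v] side_cl side_cl' by auto

lemma side_basic:
  assumes "adjacent T u v"
  shows "side T v u = X - side T u v" "side T u v \<subseteq> X" "side T u v \<noteq> {}" "side T u v \<noteq> X"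
proof -
  have "side T v u = X - side T u v \<and> side T u v \<subseteq> X \<and> side T u v \<noteq> {} \<and> side T u v \<noteq> X"
    using assms
  proof (cases rule: adjacent_cases)
    case up
    have "cl u \<noteq> {}" "cl u \<noteq> X" using cl_nonempty[of u] r_notin_cl[of u] r_in up by auto
    then show ?thesis using up cl_sub by auto
  next
    case down
    have "cl v \<noteq> {}" "cl v \<noteq> X" using cl_nonempty[of v] r_notin_cl[of v] r_in down by auto
    then show ?thesis using down cl_sub[of v] by auto
  qed
  then show "side T v u = X - side T u v" "side T u v \<subseteq> X" "side T u v \<noteq> {}" "side T u v \<noteq> X"
    by blast+
qed

lemma side_disjoint:
  assumes "adjacent T u v" "adjacent T w v" "u \<noteq> w"
  shows "side T u v \<inter> side T w v = {}"
  using assms(1)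
proof (cases rule: adjacent_cases)
  case u: up
  from assms(2) show ?thesis
  proof (cases rule: adjacent_cases)
    case up
    then show ?thesis using u cl_children_disjoint[of u v w] assms(3) by (auto simp: children_def)
  next
    case down
    have "cl u \<subseteq> cl v" using child_desc[OF u(1,2)] u(3) cl_mono by blast
    then show ?thesis using u down by auto
  qed
next
  case d: down
  from assms(2) show ?thesis
  proof (cases rule: adjacent_cases)
    case up
    have "cl w \<subseteq> cl v" using child_desc[OF up(1,2)] up(3) cl_mono by blast
    then show ?thesis using up d by auto
  next
    case down
    then show ?thesis using d assms(3) by blast
  qed
qed

lemma sides_cover:
  assumes "v \<in> nodes T" "v \<notin> Leaf ` X" shows "\<Union>(node_code T v) = X"
proof
  show "\<Union>(node_code T v) \<subseteq> X" using side_basic(2) by (auto elim!: node_codeE)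
  have vr: "v \<noteq> rt" using assms rt_Leaf r_in by blast
  have "X - cl v \<in> node_code T v"
    using node_codeI[of T "par v" v] adj side_cl' assms vr by metis
  moreover have "cl c \<in> node_code T v" if "c \<in> children v" for c
    using node_codeI[of T c v] adj[of c v] side_cl[of c] childD[OF that] by metis
  ultimately show "X \<subseteq> \<Union>(node_code T v)" using cl_children[OF assms] by blast
qed

lemma leaf_nbr: "x \<in> X \<Longrightarrow> \<exists>u. adjacent T u (Leaf x)"
proof (cases "x = r")
  case True
  then show ?thesis using rt_child rt_Leaf adj by (metis childD insertI1)
next
  case False
  assume "x \<in> X"
  then show ?thesis using False rt_Leaf adj Leaf_node by (metis node.inject(1))
qed

lemma leaf_side: "x \<in> X \<Longrightarrow> adjacent T u (Leaf x) \<Longrightarrow> side T u (Leaf x) = X - {x}"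
proof -
  assume x: "x \<in> X" and a: "adjacent T u (Leaf x)"
  from a show ?thesis
  proof (cases rule: adjacent_cases)
    case up
    have "u \<in> children (Leaf x)" using up by (simp add: children_def)
    then have "Leaf x = rt" using leaf_no_children[of "Leaf x"] x by auto
    then have "x = r" using rt_Leaf by simp
    obtain c where c: "children rt = {c}" using rt_child by blast
    have "desc rt \<subseteq> insert rt (desc u)"
    proof
      fix w assume w: "w \<in> desc rt"
      have "u \<in> children rt" using \<open>u \<in> children (Leaf x)\<close> \<open>Leaf x = rt\<close> by simp
      then have cu: "children rt = {u}" using c by auto
      have "w \<in> desc u" if nw: "w \<noteq> rt"
      proof -
        obtain z where "z \<in> children rt" "w \<in> desc z"
          using desc_child_cases[OF w nw] by (auto simp: children_def)
        then show ?thesis using cu by simp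
      qed
      then show "w \<in> insert rt (desc u)" by blast
    qed
    moreover have "y = r" if "Leaf y = rt" for y using that rt_Leaf by simp
    ultimately have "X \<subseteq> insert r (cl u)" using cl_rt by (auto simp: cl_def)
    then have "cl u = X - {r}" using cl_sub[of u] r_notin_cl[of u] up by blast
    then show ?thesis using up \<open>x = r\<close> by simp
  next
    case down
    then show ?thesis using cl_Leaf[OF x] rt_Leaf by auto
  qed
qed

lemma leaf_code: "x \<in> X \<Longrightarrow> node_code T (Leaf x) = {X - {x}}"
proof -
  assume x: "x \<in> X"
  obtain u where u: "adjacent T u (Leaf x)" using leaf_nbr[OF x] ..
  have "X - {x} \<in> node_code T (Leaf x)" using node_codeI[OF u] leaf_side[OF x u] by simp
  moreover have "node_code T (Leaf x) \<subseteq> {X - {x}}" using leaf_side[OF x] by (auto elim!: node_codeE)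
  ultimately show ?thesis by blast
qed

lemma finite_nbrs: "finite {w. adjacent T v w}"
  using fin_nodes arcs_sub by (rule_tac finite_subset[of _ "nodes T"]) (auto simp: adjacent_def)

lemma card_code: "card (node_code T v) = card {w. adjacent T v w}"
  unfolding node_code_def
proof (rule card_image, rule inj_onI)
  fix u w assume "u \<in> {u. adjacent T v u}" "w \<in> {u. adjacent T v u}" and e: "side T u v = side T w v"
  then have a: "adjacent T u v" "adjacent T w v" using adjacent_sym by auto
  then show "u = w" using side_disjoint[OF a] side_basic(3)[OF a(1)] e by auto
qed

lemma side_inj: "adjacent T u v \<Longrightarrow> adjacent T w v \<Longrightarrow> side T u v = side T w v \<Longrightarrow> u = w"
  using side_disjoint side_basic(3) by (metis Int_absorb)

lemma code_disjoint:
  "R \<in> node_code T v \<Longrightarrow> R' \<in> node_code T v \<Longrightarrow> R \<noteq> R' \<Longrightarrow> R \<inter> R' = {}"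
  by (elim node_codeE) (use side_disjoint in blast)

lemma code_leaf_iff: "v \<in> nodes T \<Longrightarrow> v \<in> Leaf ` X \<longleftrightarrow> card (node_code T v) \<le> 1"
  using leaf_iff card_code by simp

lemma code_degree_two:
  assumes v: "v \<in> nodes T" "card (node_code T v) = 2" and S: "S \<in> node_code T v"
  shows "node_code T v = {S, X - S}"
proof -
  obtain R where R: "node_code T v = {S, R}" "R \<noteq> S"
    using v(2) S by (metis card_2_iff doubleton_eq_iff insertE singletonD)
  have "v \<notin> Leaf ` X" using code_leaf_iff[OF v(1)] v(2) by simp
  then have "S \<union> R = X" using sides_cover[OF v(1)] R by simp
  moreover have "S \<inter> R = {}" using code_disjoint[OF S] R by auto
  ultimately have "R = X - S" by blast
  then show ?thesis using R by simp
qed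

text \<open>The node \<open>v\<close> lies on one side of the edge; the other side lies entirely in
  the single direction \<open>w\<close> from which \<open>v\<close> sees the edge.\<close>

lemma edge_vs_node:
  assumes ab: "adjacent T a b" and v: "v \<in> nodes T"
  shows "\<exists>w. adjacent T w v \<and> (side T a b \<subseteq> side T w v \<or> X - side T a b \<subseteq> side T w v)"
proof -
  have main: "\<exists>w. adjacent T w v \<and> (cl a \<subseteq> side T w v \<or> X - cl a \<subseteq> side T w v)"
    if a: "a \<in> nodes T" "a \<noteq> rt" for a
  proof -
    consider "v \<in> desc a" | "a \<in> desc v" "a \<noteq> v" | "a \<notin> desc v" "v \<notin> desc a" by blast
    then show ?thesis
    proof cases
      case 1
      then have "v \<noteq> rt" using rt_in_desc a by blast
      then have "adjacent T (par v) v" "side T (par v) v = X - cl v" using adj v side_cl' by auto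
      then show ?thesis using cl_mono[OF 1] by blast
    next
      case 2
      then obtain w where w: "w \<in> nodes T" "w \<noteq> rt" "par w = v" "a \<in> desc w"
        using desc_child_cases by blast
      then have "adjacent T w v" "side T w v = cl w" using adj side_cl by auto
      then show ?thesis using cl_mono[OF w(4)] by blast
    next
      case 3
      then have "v \<noteq> rt" using in_desc_rt a by blast
      then have "adjacent T (par v) v" "side T (par v) v = X - cl v" using adj v side_cl' by auto
      moreover have "cl a \<inter> cl v = {}" using desc_nested[of _ a v] 3 a v by (auto simp: cl_def)
      ultimately show ?thesis using cl_sub[of a] by blast
    qed
  qed
  from ab show ?thesis
  proof (cases rule: adjacent_cases)
    case up
    then show ?thesis using main[of a] by simp
  next
    case down
    then show ?thesis using main[of b] cl_sub[of b] by (auto simp: double_diff)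
  qed
qed

section \<open>Edges and nodes that share a side\<close>

lemma same_cl_child:
  assumes e: "e \<in> children w" and w: "w \<noteq> rt" and c: "cl e = cl w"
  shows "card (node_code T w) = 2"
proof -
  have en: "e \<in> nodes T" "e \<noteq> rt" "par e = w" using childD[OF e] by auto
  then have wn: "w \<in> nodes T" using par_node by blast
  have "children w = {e}"
  proof (rule ccontr)
    assume "children w \<noteq> {e}"
    then obtain f where f: "f \<in> children w" "f \<noteq> e" using e by blast
    have "cl f \<subseteq> cl e" using cl_mono[OF child_in_desc[OF f(1)]] c by simp
    moreover have "cl f \<inter> cl e = {}" using cl_children_disjoint[OF f(1) e f(2)] .
    ultimately show False using cl_nonempty[of f] childD[OF f(1)] by blast
  qed
  then show ?thesis using card_code card_nbrs[OF wn w] by simp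
qed

text \<open>Two nodes with a common leaf below them are comparable. Since no leaf branches off in
  between, the chain from the parent of the lower node to the upper node consists of nodes of degree
  two.\<close>

lemma same_cl:
  assumes u: "u \<in> nodes T" "u \<noteq> rt" and u': "u' \<in> nodes T" "u' \<noteq> rt"
    and c: "cl u = cl u'" and ne: "u \<noteq> u'"
  shows "card (node_code T (par u)) = 2 \<and> card (node_code T u') = 2 \<or>
    card (node_code T (par u')) = 2 \<and> card (node_code T u) = 2"
proof -
  have main: "card (node_code T (par u)) = 2 \<and> card (node_code T u') = 2"
    if u: "u \<in> nodes T" "u \<noteq> rt" and u': "u' \<in> nodes T" "u' \<noteq> rt"
      and c: "cl u = cl u'" and ne: "u \<noteq> u'" and d: "u \<in> desc u'" for u u'
  proof
    have p: "par u \<in> desc u'" using desc_par[OF d ne] by blast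
    have "cl u \<subseteq> cl (par u)" using cl_mono[OF child_desc[OF u]] .
    then have e: "cl u = cl (par u)" using cl_mono[OF p] c by simp
    have "par u \<noteq> rt" using p u' rt_in_desc by blast
    then show "card (node_code T (par u)) = 2"
      using same_cl_child[of u "par u"] u e by (simp add: children_def)
    obtain f where f: "f \<in> children u'" "u \<in> desc f"
      using desc_child_cases[OF d ne] by (auto simp: children_def)
    have "cl f = cl u'" using cl_mono[OF f(2)] cl_mono[OF child_in_desc[OF f(1)]] c by simp
    then show "card (node_code T u') = 2" using same_cl_child[OF f(1) u'(2)] by simp
  qed
  obtain x where "Leaf x \<in> desc u" "Leaf x \<in> desc u'" using cl_nonempty[OF u(1)] c by (auto simp: cl_def)
  then consider "u \<in> desc u'" | "u' \<in> desc u" using desc_nested u u' by blast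
  then show ?thesis using main[OF u u' c ne] main[OF u' u c[symmetric] ne[symmetric]] by cases auto
qed

lemma same_side_edges:
  assumes uv: "adjacent T u v" and uv': "adjacent T u' v'" and s: "side T u v = side T u' v'"
  shows "(u = u' \<and> v = v') \<or> card (node_code T u) = 2 \<or> card (node_code T v) = 2"
  using uv
proof (cases rule: adjacent_cases)
  case 1: up
  from uv' show ?thesis
  proof (cases rule: adjacent_cases)
    case 2: up
    then show ?thesis using same_cl[OF 1(1,2) 2(1,2)] 1 2 s by auto
  next
    case 2: down
    then have "r \<in> side T u' v'" using r_notin_cl r_in by auto
    then show ?thesis using s 1 r_notin_cl by auto
  qed
next
  case 1: down
  from uv' show ?thesis
  proof (cases rule: adjacent_cases)
    case 2: up
    have "r \<in> side T u v" using 1 r_notin_cl r_in by auto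
    then show ?thesis using s 2 r_notin_cl by auto
  next
    case 2: down
    then have "cl v = cl v'" using 1 s cl_sub[of v] cl_sub[of v'] by (metis double_diff order_refl)
    then show ?thesis using same_cl[OF 1(1,2) 2(1,2)] 1 2 by auto
  qed
qed

text \<open>A side determines a directed edge up to subdivision, and passing over nodes of degree
  two it arrives at a definite node.\<close>

lemma same_part_nodes:
  assumes S: "S \<in> node_code T v" "S \<in> node_code T v'"
    and d: "card (node_code T v) \<noteq> 2" "card (node_code T v') \<noteq> 2"
  shows "v = v'"
proof -
  obtain u where u: "adjacent T u v" "S = side T u v" using S(1) by (rule node_codeE)
  obtain u' where u': "adjacent T u' v'" "S = side T u' v'" using S(2) by (rule node_codeE)
  from u(1) show ?thesis
  proof (cases rule: adjacent_cases)
    case 1: up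
    from u'(1) show ?thesis
    proof (cases rule: adjacent_cases)
      case 2: up
      then show ?thesis using same_cl[OF 1(1,2) 2(1,2)] 1 2 u u' d by auto
    next
      case 2: down
      then have "r \<in> side T u' v'" using r_notin_cl r_in by auto
      then show ?thesis using u u' 1 r_notin_cl by auto
    qed
  next
    case 1: down
    from u'(1) show ?thesis
    proof (cases rule: adjacent_cases)
      case 2: up
      have "r \<in> side T u v" using 1 r_notin_cl r_in by auto
      then show ?thesis using u u' 2 r_notin_cl by auto
    next
      case 2: down
      then have "cl v = cl v'" using 1 u u' cl_sub[of v] cl_sub[of v'] by (metis double_diff order_refl)
      then show ?thesis using same_cl[OF 1(1,2) 2(1,2)] 1 2 d by auto
    qed
  qed
qed

text \<open>The edge is pushed forward through nodes of degree two: upwards to the shallowest node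
  with the same leaves below it, downwards to the deepest one.\<close>

lemma part_at_branching_or_leaf:
  assumes ab: "adjacent T a b"
  shows "\<exists>v\<in>nodes T. side T a b \<in> node_code T v \<and> card (node_code T v) \<noteq> 2"
  using ab
proof (cases rule: adjacent_cases)
  case up
  define PP where "PP w \<longleftrightarrow> w \<in> nodes T \<and> w \<noteq> rt \<and> cl w = cl a" for w
  obtain w where w: "PP w" and wm: "\<And>z. PP z \<Longrightarrow> dep w \<le> dep z"
    using ex_has_least_nat[of PP a dep] up by (auto simp: PP_def)
  have wn: "w \<in> nodes T" "w \<noteq> rt" "cl w = cl a" using w by (auto simp: PP_def)
  have "cl w \<in> node_code T (par w)" using node_codeI[of T w "par w"] adj wn side_cl by metis
  moreover have "card (node_code T (par w)) \<noteq> 2"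
  proof
    assume d: "card (node_code T (par w)) = 2"
    have pn: "par w \<in> nodes T" using par_node wn by blast
    have nr: "par w \<noteq> rt"
    proof
      assume "par w = rt"
      then have "card (node_code T (par w)) \<le> 1" using code_leaf_iff[OF rt_node] rt_Leaf r_in by auto
      then show False using d by simp
    qed
    then have "card (children (par w)) = 1" using d card_code card_nbrs[OF pn] by simp
    moreover have "w \<in> children (par w)" using wn by (simp add: children_def)
    ultimately have ch: "children (par w) = {w}" by (metis card_1_singletonE singletonD)
    have "par w \<notin> Leaf ` X" using leaf_no_children[of "par w"] nr ch by auto
    then have "cl (par w) = cl w" using cl_children[OF pn] ch by simp
    then have "PP (par w)" using pn nr wn by (simp add: PP_def)
    then show False using wm[of "par w"] dep_par[OF wn(1,2)] by simp
  qed
  ultimately show ?thesis using par_node wn up by auto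
next
  case down
  define PP where "PP w \<longleftrightarrow> w \<in> nodes T \<and> w \<noteq> rt \<and> cl w = cl b" for w
  have "\<forall>z. PP z \<longrightarrow> dep z < Suc (Max (dep ` nodes T))"
    using fin_nodes by (auto simp: PP_def less_Suc_eq_le)
  moreover have "PP b" using down by (simp add: PP_def)
  ultimately obtain w where w: "PP w" and wm: "\<And>z. PP z \<Longrightarrow> dep z \<le> dep w"
    using ex_has_greatest_nat[of PP b dep] by blast
  have wn: "w \<in> nodes T" "w \<noteq> rt" "cl w = cl b" using w by (auto simp: PP_def)
  have "X - cl w \<in> node_code T w" using node_codeI[of T "par w" w] adj wn side_cl' by metis
  moreover have "card (node_code T w) \<noteq> 2"
  proof
    assume d: "card (node_code T w) = 2"
    then have "card (children w) = 1" using card_code card_nbrs[OF wn(1,2)] by simp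
    then obtain c where c: "children w = {c}" by (meson card_1_singletonE)
    have cn: "c \<in> nodes T" "c \<noteq> rt" "par c = w" using childD c by auto
    have "w \<notin> Leaf ` X" using leaf_no_children[of w] wn c by auto
    then have "cl w = cl c" using cl_children[OF wn(1)] c by simp
    then have "PP c" using cn wn by (simp add: PP_def)
    then show False using wm[of c] dep_par[OF cn(1,2)] cn by simp
  qed
  ultimately show ?thesis using wn down by auto
qed

lemma card_arcs: "card (arcs T) \<le> 2 * card (nodes T)"
proof -
  have "arcs T \<subseteq> (\<lambda>u. (u, par u)) ` nodes T \<union> (\<lambda>u. (par u, u)) ` nodes T"
  proof
    fix e assume e: "e \<in> arcs T"
    obtain u v where uv: "e = (u, v)" by (cases e)
    then have "adjacent T u v" using e by (simp add: adjacent_def)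
    then show "e \<in> (\<lambda>u. (u, par u)) ` nodes T \<union> (\<lambda>u. (par u, u)) ` nodes T"
      using adj[of u v] uv by blast
  qed
  then have "card (arcs T) \<le> card ((\<lambda>u. (u, par u)) ` nodes T \<union> (\<lambda>u. (par u, u)) ` nodes T)"
    using fin_nodes by (intro card_mono) auto
  also have "\<dots> \<le> card ((\<lambda>u. (u, par u)) ` nodes T) + card ((\<lambda>u. (par u, u)) ` nodes T)"
    by (rule card_Un_le)
  also have "\<dots> \<le> card (nodes T) + card (nodes T)"
    using fin_nodes by (intro add_mono card_image_le)
  finally show ?thesis by simp
qed

text \<open>Counting children: internal nodes of degree at least three are fewer than the leaves, and
  every node of degree two has its own child of another degree.\<close>

lemma card_nodes:
  assumes sep: "\<And>u v. adjacent T u v \<Longrightarrow> \<not> (card (node_code T u) = 2 \<and> card (node_code T v) = 2)"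
  shows "card (nodes T) \<le> 4 * card X"
proof -
  define N2 where "N2 = {v \<in> nodes T. card (node_code T v) = 2}"
  define N3 where "N3 = {v \<in> nodes T. 3 \<le> card (node_code T v)}"
  define L where "L = Leaf ` X"
  have fin: "finite N2" "finite N3" "finite L" using fin_nodes finite_X by (auto simp: N2_def N3_def L_def)
  have cl: "card L = card X" unfolding L_def by (rule card_image) (simp add: inj_on_def)
  have LN: "L \<subseteq> nodes T" using Leaf_node by (auto simp: L_def)
  have part: "nodes T = L \<union> N2 \<union> N3"
    using code_leaf_iff LN by (force simp: N2_def N3_def L_def)
  have dis: "L \<inter> N2 = {}" "L \<inter> N3 = {}" "N2 \<inter> N3 = {}"
    using code_leaf_iff LN by (force simp: N2_def N3_def L_def)+
  have cN: "card (nodes T) = card L + card N2 + card N3"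
    unfolding part using fin dis by (simp add: card_Un_disjoint Int_Un_distrib2)
  have rtL: "rt \<in> L" using rt_Leaf r_in by (simp add: L_def)
  have nr: "v \<noteq> rt" if "v \<in> N2 \<union> N3" for v using that rtL dis by blast
  have ch2: "card (children v) = 1" if "v \<in> N2" for v
    using that nr card_nbrs[of v] card_code[of v] by (auto simp: N2_def)
  have ch3: "2 \<le> card (children v)" if "v \<in> N3" for v
    using that nr card_nbrs[of v] card_code[of v] by (auto simp: N3_def)
  have "nodes T - {rt} = (\<Union>v\<in>nodes T. children v)"
    using par_node by (auto simp: children_def)
  then have "card (nodes T - {rt}) = (\<Sum>v\<in>nodes T. card (children v))"
    using card_UN_disjoint[OF fin_nodes, of children] finite_children by (auto simp: children_def)
  also have "\<dots> = (\<Sum>v\<in>L. card (children v)) + (\<Sum>v\<in>N2. card (children v)) + (\<Sum>v\<in>N3. card (children v))"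
    unfolding part using fin dis by (simp add: sum.union_disjoint Int_Un_distrib2)
  finally have s: "card (nodes T - {rt}) =
    (\<Sum>v\<in>L. card (children v)) + (\<Sum>v\<in>N2. card (children v)) + (\<Sum>v\<in>N3. card (children v))" .
  have "card (children rt) = 1" using rt_child by auto
  \<comment> \<open>The root is a leaf but has a child. Every node except the root is a child
    exactly once, so \<open>L + N2 + N3 - 1\<close> is at least \<open>1 + N2 + 2 * N3\<close> in
    terms of cardinalities.\<close>
  then have "1 \<le> (\<Sum>v\<in>L. card (children v))" using fin rtL
    by (metis member_le_sum zero_le)
  moreover have "(\<Sum>v\<in>N2. card (children v)) = card N2" using ch2 by simp
  moreover have "card N3 * 2 \<le> (\<Sum>v\<in>N3. card (children v))"
    using sum_bounded_below[of N3 2 "\<lambda>v. card (children v)"] ch3 by simp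
  moreover have "card (nodes T - {rt}) = card (nodes T) - 1" using rt_node fin_nodes by simp
  ultimately have n3: "card N3 \<le> card L" using s cN by linarith
  define f where "f v = (THE c. children v = {c})" for v
  have f: "children v = {f v}" if v: "v \<in> N2" for v
  proof -
    obtain c where "children v = {c}" using ch2[OF v] by (meson card_1_singletonE)
    then show ?thesis by (simp add: f_def)
  qed
  have "inj_on f N2"
  proof (rule inj_onI)
    fix a b assume "a \<in> N2" "b \<in> N2" "f a = f b"
    then show "a = b" using f childD by (metis singletonI)
  qed
  moreover have "f ` N2 \<subseteq> L \<union> N3"
  proof
    fix c assume "c \<in> f ` N2"
    then obtain v where v: "v \<in> N2" "c = f v" by blast
    have c: "c \<in> nodes T" "c \<noteq> rt" "par c = v" using f[OF v(1)] v childD by auto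
    then have "adjacent T c v" using adj by blast
    then have "c \<notin> N2" using sep v by (auto simp: N2_def)
    then show "c \<in> L \<union> N3" using c part by blast
  qed
  ultimately have "card N2 \<le> card (L \<union> N3)" using fin by (intro card_inj_on_le) auto
  also have "\<dots> = card L + card N3" using fin dis by (simp add: card_Un_disjoint)
  \<comment> \<open>Hence \<open>card N3\<close> is at most \<open>card X\<close> and
    \<open>card N2\<close> at most twice that; with the leaves this gives the factor 4.\<close>
  finally show ?thesis using cN n3 cl by linarith
qed

end

section \<open>Arbitrary tree representations\<close>

locale represented_family = partitive_family X F
  for X :: "'a set" and F +
  fixes T :: "'a otree"
  assumes rep: "tree_representation X F T"
begin

lemma rep_leaves: "leaves T = Leaf ` X" and rep_tree: "oriented_tree T"
  and rep_internal: "internal_nodes T \<subseteq> range Inner"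
  and rep_complete: "complete_nodes T \<subseteq> internal_nodes T"
  and rep_F: "F = represented_sets T \<union> {{}, X}"
  using rep unfolding tree_representation_def by blast+

definition root :: 'a where "root = (SOME r. r \<in> X)"

lemma root_in: "root \<in> X"
proof -
  have "X \<noteq> {}" using two_le_card by auto
  then show ?thesis unfolding root_def by (simp add: some_in_eq)
qed

text \<open>The rooting is fixed by choice operators so that \<open>rooted_otree\<close> can be
  interpreted once for the whole locale.\<close>

definition root_parent :: "'a node \<Rightarrow> 'a node" where
  "root_parent = (SOME par. \<exists>dep. rooted_graph T (Leaf root) par dep)"

definition root_depth :: "'a node \<Rightarrow> nat" where
  "root_depth = (SOME dep. rooted_graph T (Leaf root) root_parent dep)"

lemma rooted_at_root: "rooted_graph T (Leaf root) root_parent root_depth"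
proof -
  have "Leaf root \<in> nodes T" using rep_leaves root_in by (auto simp: leaves_def)
  then have "\<exists>par dep. rooted_graph T (Leaf root) par dep" by (rule oriented_tree_rooted[OF rep_tree])
  then have "\<exists>dep. rooted_graph T (Leaf root) root_parent dep" unfolding root_parent_def by (rule someI_ex)
  then show ?thesis unfolding root_depth_def by (rule someI_ex)
qed

sublocale RT: rooted_otree T "Leaf root" root_parent root_depth X root
proof -
  interpret rooted_graph T "Leaf root" root_parent root_depth by (rule rooted_at_root)
  show "rooted_otree T (Leaf root) root_parent root_depth X root"
    by unfold_locales (use rep_leaves root_in finite_X two_le_card in simp_all)
qed

abbreviation code :: "'a node \<Rightarrow> 'a set set" where
  "code \<equiv> node_code T"

definition ins :: "'a node \<Rightarrow> 'a set set" where
  "ins v = (\<lambda>u. side T u v) ` in_neighbours T v"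

lemma adjacent_nodes: "adjacent T u v \<Longrightarrow> u \<in> nodes T \<and> v \<in> nodes T"
  using RT.arcs_sub by (auto simp: adjacent_def)

lemma finite_code: "finite (code v)"
  using RT.finite_nbrs by (simp add: node_code_def)

lemma in_nbr_adjacent: "u \<in> in_neighbours T v \<Longrightarrow> adjacent T u v"
  by (simp add: in_neighbours_def adjacent_def)

lemma ins_code: "ins v \<subseteq> code v"
  unfolding ins_def by (auto intro!: node_codeI in_nbr_adjacent)

lemma inj_side: "inj_on (\<lambda>u. side T u v) (in_neighbours T v)"
  by (rule inj_onI) (rule RT.side_inj[OF in_nbr_adjacent in_nbr_adjacent])

lemma card_ins: "card (ins v) = card (in_neighbours T v)"
  unfolding ins_def by (rule card_image[OF inj_side])

lemma finite_ins: "finite (ins v)"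
  using finite_subset[OF ins_code finite_code] .

lemma ins_iff: "adjacent T u v \<Longrightarrow> side T u v \<in> ins v \<longleftrightarrow> (u, v) \<in> arcs T"
proof
  assume a: "adjacent T u v" "side T u v \<in> ins v"
  then obtain w where w: "(w, v) \<in> arcs T" "side T u v = side T w v" by (auto simp: ins_def in_neighbours_def)
  then have "adjacent T w v" by (simp add: adjacent_def)
  then show "(u, v) \<in> arcs T" using RT.side_inj[OF a(1)] w by blast
qed (auto simp: ins_def in_neighbours_def)

lemma arc_mem: "(u, v) \<in> arcs T \<Longrightarrow> side T u v \<in> F"
  unfolding rep_F represented_sets_def by blast

lemma complete_mem:
  assumes "v \<in> complete_nodes T" "J \<subseteq> ins v" "1 < card J" "card J < card (ins v)"
  shows "\<Union>J \<in> F"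
proof -
  obtain J' where J': "J' \<subseteq> in_neighbours T v" "J = (\<lambda>u. side T u v) ` J'"
    using assms(2) unfolding ins_def by (meson subset_imageE)
  have "card J = card J'" using J' inj_on_subset[OF inj_side J'(1)] by (simp add: card_image)
  then have "\<Union>J \<in> represented_sets T" unfolding represented_sets_def
    using assms J' card_ins by auto
  then show ?thesis using rep_F by blast
qed

lemma mem_cases:
  assumes "S \<in> F" "S \<noteq> {}" "S \<noteq> X"
  obtains (arc) u v where "(u, v) \<in> arcs T" "S = side T u v"
  | (complete) v J where "v \<in> complete_nodes T" "J \<subseteq> ins v" "1 < card J" "card J < card (ins v)" "S = \<Union>J"
proof -
  have "S \<in> represented_sets T" using assms rep_F by blast
  then consider (1) v J where "v \<in> complete_nodes T" "J \<subseteq> in_neighbours T v" "1 < card J"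
      "card J < card (in_neighbours T v)" "S = (\<Union>u\<in>J. side T u v)"
    | (2) u v where "(u, v) \<in> arcs T" "S = side T u v"
    unfolding represented_sets_def in_neighbours_def by blast
  then show thesis
  proof cases
    case 1
    let ?J = "(\<lambda>u. side T u v) ` J"
    have "card ?J = card J" using inj_on_subset[OF inj_side 1(2)] by (rule card_image)
    then show thesis using complete[of v ?J] 1 card_ins by (auto simp: ins_def)
  qed (rule arc)
qed

lemma complete_node: "v \<in> complete_nodes T \<Longrightarrow> v \<in> nodes T \<and> v \<notin> Leaf ` X"
  using rep_complete rep_leaves by (auto simp: internal_nodes_def)

text \<open>From \<open>v\<close> the edge is seen in one direction \<open>w\<close>, and a union of
  sides at \<open>v\<close> either contains the side of \<open>w\<close> or misses it.\<close>

lemma Union_not_crossing_edge: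
  assumes ab: "adjacent T a b" and v: "v \<in> nodes T" and J: "J \<subseteq> code v"
  shows "\<not> crossing X (side T a b) (\<Union>J)"
proof -
  obtain w where w: "adjacent T w v" and s: "side T a b \<subseteq> side T w v \<or> X - side T a b \<subseteq> side T w v"
    using RT.edge_vs_node[OF ab v] by blast
  have W: "side T w v \<in> code v" using node_codeI[OF w] .
  have d: "R \<inter> side T w v = {}" if "R \<in> J" "R \<noteq> side T w v" for R
    using RT.code_disjoint[OF _ W that(2)] that J by blast
  have sX: "side T a b \<subseteq> X" using RT.side_basic(2)[OF ab] .
  have UX: "\<Union>J \<subseteq> X"
  proof
    fix x assume "x \<in> \<Union>J"
    then obtain R where R: "R \<in> code v" "x \<in> R" using J by blast
    from R(1) obtain u where "adjacent T u v" "R = side T u v" by (rule node_codeE)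
    then show "x \<in> X" using RT.side_basic(2) R by blast
  qed
  show ?thesis
  proof (cases "side T w v \<in> J")
    case True
    then have "side T w v \<subseteq> \<Union>J" by blast
    then have "side T a b \<subseteq> \<Union>J \<or> side T a b \<union> \<Union>J = X" using s sX UX by blast
    then show ?thesis by (auto simp: crossing_def)
  next
    case False
    then have "\<Union>J \<inter> side T w v = {}" using d by blast
    then have "side T a b \<inter> \<Union>J = {} \<or> \<Union>J \<subseteq> side T a b" using s UX by blast
    then show ?thesis by (auto simp: crossing_def)
  qed
qed

section \<open>Edges, splits, branching nodes and stars\<close>

lemma edge_split:
  assumes uv: "adjacent T u v" shows "side T u v \<in> splits"
proof -
  have "side T u v \<in> F \<or> X - side T u v \<in> F"
    using uv arc_mem[of u v] arc_mem[of v u] RT.side_basic(1)[OF uv] by (auto simp: adjacent_def)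
  moreover have "\<not> crossing X (side T u v) B" if B: "B \<in> F" for B
  proof (cases "B = {} \<or> B = X")
    case True
    then show ?thesis using RT.side_basic(2)[OF uv] by (auto simp: crossing_def)
  next
    case False
    then have "B \<noteq> {}" "B \<noteq> X" by auto
    from B this show ?thesis
    proof (cases rule: mem_cases)
      case (arc u' v')
      then have a: "adjacent T u' v'" by (simp add: adjacent_def)
      then show ?thesis using Union_not_crossing_edge[OF uv, of v' "{B}"] node_codeI[OF a] arc
          adjacent_nodes by simp
    next
      case (complete v' J)
      have "J \<subseteq> code v'" using complete(2) ins_code by blast
      then show ?thesis using Union_not_crossing_edge[OF uv, of v' J] complete_node[OF complete(1)] complete(5) by simp
    qed
  qed
  ultimately show ?thesis using RT.side_basic[OF uv] by (auto simp: splits_def)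
qed

lemma code_splits: "code v \<subseteq> splits"
  using edge_split by (auto elim!: node_codeE)

text \<open>For a member given by an arc there is nothing to do. If a complete node yields a split
  from \<open>J\<close>, then \<open>J\<close> omits a single side \<open>l\<close>: were there a
  further omitted side, the member formed by \<open>l\<close> and one element of \<open>J\<close>
  would cross the split. So the split is the complement of \<open>l\<close>.\<close>

lemma split_edge:
  assumes S: "S \<in> splits" shows "\<exists>u v. adjacent T u v \<and> side T u v = S"
proof -
  have mem: "\<exists>u v. adjacent T u v \<and> side T u v = A" if A: "A \<in> F" "A \<in> splits" for A
  proof -
    have ne: "A \<noteq> {}" "A \<noteq> X" using splitsD[OF A(2)] by auto
    from A(1) ne show ?thesis
    proof (cases rule: mem_cases)
      case (arc a b)
      then show ?thesis by (auto simp: adjacent_def)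
    next
      case (complete w J)
      then have w: "w \<in> nodes T" "w \<notin> Leaf ` X" using complete_node by auto
      have "finite J" using complete(2) finite_ins finite_subset by blast
      obtain j j' where j: "j \<in> J" "j' \<in> J" "j \<noteq> j'" using two_elements[of J] complete by auto
      have "\<not> ins w \<subseteq> J" using complete(4) \<open>finite J\<close> card_mono[of J "ins w"] by linarith
      then obtain l where l: "l \<in> ins w" "l \<notin> J" by blast
      \<comment> \<open>Two in-neighbours are an admissible selection, because \<open>card J\<close>
        is at least two and smaller than \<open>card (ins w)\<close>.\<close>
      have jl: "\<Union>{j, l} \<in> F"
      proof (rule complete_mem[OF complete(1)])
        show "{j, l} \<subseteq> ins w" using j l complete(2) by blast
        have "j \<noteq> l" using j l by blast
        then show "1 < card {j, l}" "card {j, l} < card (ins w)" using complete(3,4) by auto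
      qed
      have Jc: "J \<subseteq> code w" "l \<in> code w" using complete(2) l ins_code by blast+
      have ne': "R \<noteq> {}" if "R \<in> code w" for R using that code_splits splitsD(2) by blast
      have dj: "R \<inter> R' = {}" if "R \<in> code w" "R' \<in> code w" "R \<noteq> R'" for R R'
        using RT.code_disjoint that by blast
      have all: "code w = insert l J"
      proof (rule ccontr)
        assume "code w \<noteq> insert l J"
        then obtain m where m: "m \<in> code w" "m \<noteq> l" "m \<notin> J" using Jc by blast
        obtain x where x: "x \<in> j" using ne' j Jc by blast
        obtain y where y: "y \<in> j'" using ne' j Jc by blast
        obtain z where z: "z \<in> l" using ne' Jc by blast
        obtain q where q: "q \<in> m" using ne' m by blast
        have nin: "e \<notin> R'" if "e \<in> R" "R \<in> code w" "R' \<in> code w" "R \<noteq> R'" for e R R'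
          using dj[OF that(2-4)] that(1) by blast
        have "y \<notin> \<Union>{j, l}" using nin[OF y] j l Jc by auto
        moreover have "z \<notin> \<Union>J" using nin[OF z] l Jc by auto
        moreover have "q \<notin> \<Union>J" "q \<notin> \<Union>{j, l}" using nin[OF q] m j l Jc by auto
        moreover have "q \<in> X" using q m code_splits splitsD(1) by blast
        ultimately have "crossing X (\<Union>J) (\<Union>{j, l})"
          using x y z j by (intro crossingI[of x _ _ y z q]) auto
        then show False using splitsD(5)[OF A(2) jl] complete by blast
      qed
      have "\<Union>(code w) = X" by (rule RT.sides_cover[OF w])
      moreover have "\<Union>J \<inter> l = {}" using dj l Jc by blast
      ultimately have Al: "A = X - l" using all complete(5) by auto
      from Jc(2) obtain u where u: "adjacent T u w" "l = side T u w" by (rule node_codeE)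
      then show ?thesis using adjacent_sym[OF u(1)] RT.side_basic(1)[OF u(1)] Al by auto
    qed
  qed
  show ?thesis
  proof (cases "S \<in> F")
    case True
    then show ?thesis using mem S by blast
  next
    case False
    then have "X - S \<in> F" using splitsD(4)[OF S] by blast
    then obtain u v where uv: "adjacent T u v" "side T u v = X - S"
      using mem[OF _ splits_complement[OF S]] by blast
    then have "side T v u = S" using RT.side_basic(1)[OF uv(1)] compl_compl[OF splitsD(1)[OF S]] by simp
    then show ?thesis using adjacent_sym[OF uv(1)] by blast
  qed
qed

lemma branching_star:
  assumes "v \<in> nodes T" "3 \<le> card (code v)" shows "star (code v)"
  unfolding star_def
proof (intro conjI ballI)
  show "code v \<subseteq> splits" by (rule code_splits)
  have nl: "v \<notin> Leaf ` X" using RT.code_leaf_iff assms by auto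
  show "\<Union>(code v) = X" by (rule RT.sides_cover[OF assms(1) nl])
  show "pairwise disjnt (code v)" using RT.code_disjoint by (auto simp: pairwise_def disjnt_def)
  show "3 \<le> card (code v)" by fact
  have edge: "\<exists>R\<in>code v. side T a b \<subseteq> R \<or> X - side T a b \<subseteq> R" if ab: "adjacent T a b" for a b
    using RT.edge_vs_node[OF ab assms(1)] node_codeI by blast
  fix S assume S: "S \<in> splits"
  show "\<exists>R\<in>code v. S \<subseteq> R \<or> X - S \<subseteq> R" using split_edge[OF S] edge by blast
qed

text \<open>A part \<open>R\<close> is the side of an edge, which is pushed forward to a node of
  degree other than two. That node is not a leaf, since \<open>X - R\<close> contains at least two
  parts; so its code is a star sharing \<open>R\<close> with \<open>M\<close>.\<close>

lemma star_branching:
  assumes M: "star M" shows "\<exists>v\<in>nodes T. code v = M"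
proof -
  obtain R where R: "R \<in> M" using starD(3)[OF M] by fastforce
  then have "R \<in> splits" using starD(1)[OF M] by blast
  then obtain a b where ab: "adjacent T a b" "side T a b = R" using split_edge by blast
  obtain v where v: "v \<in> nodes T" "R \<in> code v" "card (code v) \<noteq> 2"
    using RT.part_at_branching_or_leaf[OF ab(1)] ab by blast
  have "v \<notin> Leaf ` X"
  proof
    assume "v \<in> Leaf ` X"
    then obtain x where x: "v = Leaf x" "x \<in> X" by blast
    then have "R = X - {x}" using RT.leaf_code v(2) by simp
    then have xR: "X - R \<subseteq> {x}" by blast
    have XR: "X - R = \<Union>(M - {R})" using star_complement[OF M, of "{R}"] R by simp
    have "2 \<le> card (M - {R})" using starD(3,4)[OF M] R by simp
    then obtain Q Q' where Q: "Q \<in> M - {R}" "Q' \<in> M - {R}" "Q \<noteq> Q'" using two_elements[of "M - {R}"] by blast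
    have d: "Q \<inter> Q' = {}" "Q \<noteq> {}" "Q' \<noteq> {}"
      using starD(6)[OF M, of Q Q'] starD(7)[OF M, of Q] starD(7)[OF M, of Q'] Q by blast+
    have "Q \<subseteq> X - R" "Q' \<subseteq> X - R" unfolding XR using Q by blast+
    then have "Q \<subseteq> {x}" "Q' \<subseteq> {x}" using xR by blast+
    then show False using d by blast
  qed
  then have "3 \<le> card (code v)" using RT.code_leaf_iff[OF v(1)] v(3) by linarith
  then have "star (code v)" using branching_star v by blast
  then have "code v = M" using stars_share_part[OF _ M v(2) R] by blast
  then show ?thesis using v by blast
qed

lemma star_code_inj:
  assumes "star (code v)" "code v = code v'" shows "v = v'"
proof -
  have "3 \<le> card (code v)" using starD(3)[OF assms(1)] .
  then obtain R where "R \<in> code v" by fastforce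
  then show ?thesis using RT.same_part_nodes[of R v v'] assms \<open>3 \<le> card (code v)\<close> by simp
qed

lemma ins_star:
  assumes "v \<in> nodes T" "3 \<le> card (ins v)" shows "star (code v)"
  using branching_star[OF assms(1)] card_mono[OF finite_code ins_code] assms(2) le_trans by blast

text \<open>A selection smaller than \<open>ins v\<close> omits some side. If it omits only one,
  then every side comes from an in-neighbour, and the union is the complement of the omitted
  side.\<close>

lemma complete_Union:
  assumes v: "v \<in> complete_nodes T" and J: "J \<subseteq> ins v" "1 < card J" "card J < card (ins v)"
  shows "star (code v)"
    "2 \<le> card (code v - J) \<and> \<Union>J \<notin> splits \<or> ins v = code v \<and> X - \<Union>J \<in> code v \<and> \<Union>J \<in> splits"
proof -
  show st: "star (code v)" using ins_star complete_node[OF v] J by simp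
  have Jc: "J \<subseteq> code v" using J ins_code by blast
  have fJ: "finite J" using finite_subset[OF Jc finite_code] .
  have cd: "card (code v - J) = card (code v) - card J" using card_Diff_subset[OF fJ Jc] .
  have le: "card (ins v) \<le> card (code v)" using card_mono[OF finite_code ins_code] .
  show "2 \<le> card (code v - J) \<and> \<Union>J \<notin> splits \<or> ins v = code v \<and> X - \<Union>J \<in> code v \<and> \<Union>J \<in> splits"
  proof (cases "2 \<le> card (code v - J)")
    case True
    then show ?thesis using Union_not_split[OF st Jc] J by simp
  next
    case False
    then have "card (code v - J) = 1" "card (code v) \<le> card (ins v)" using cd le J by linarith+
    then have ie: "ins v = code v" using card_seteq[OF finite_code ins_code] by blast
    obtain l where l: "code v - J = {l}" using \<open>card (code v - J) = 1\<close> by (meson card_1_singletonE)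
    have "X - \<Union>J = l" using star_complement[OF st Jc] l by simp
    moreover have "l \<in> code v" using l by blast
    moreover have "\<Union>J \<subseteq> X" using Jc starD(2)[OF st] by blast
    ultimately show ?thesis using ie code_splits splits_complement_iff by blast
  qed
qed

text \<open>Arcs only produce splits, so the union must come from a complete node, and
  \<open>nontrivial_Union_unique\<close> together with \<open>star_code_inj\<close> identifies this
  node as \<open>v\<close>.\<close>

lemma nontrivial_Union_complete:
  assumes st: "star (code v)" and J: "J \<subseteq> code v" "2 \<le> card J" "2 \<le> card (code v - J)" "\<Union>J \<in> F"
  shows "v \<in> complete_nodes T \<and> J \<subseteq> ins v \<and> card J < card (ins v)"
proof -
  have ns: "\<Union>J \<notin> splits" using Union_not_split[OF st J(1-3)] .
  have "J \<noteq> {}" "J \<noteq> code v" using J(2,3) by auto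
  then have "\<Union>J \<noteq> \<Union>{}" "\<Union>J \<noteq> \<Union>(code v)"
    using star_Union_inj[OF st J(1), of "{}"] star_Union_inj[OF st J(1) order_refl] by blast+
  then have ne: "\<Union>J \<noteq> {}" "\<Union>J \<noteq> X" using starD(2)[OF st] by auto
  from J(4) ne show ?thesis
  proof (cases rule: mem_cases)
    case (arc a b)
    then show ?thesis using edge_split[of a b] ns by (simp add: adjacent_def)
  next
    case (complete w K)
    have Kc: "K \<subseteq> code w" using complete ins_code by blast
    have w: "star (code w)" "2 \<le> card (code w - K)"
      using complete_Union[OF complete(1-4)] ns complete(5) by auto
    have "code v = code w \<and> J = K"
      using nontrivial_Union_unique[OF st J(1-3) w(1) Kc _ w(2)] complete(3,5) by simp
    then have "v = w" "J = K" using star_code_inj[OF st] by auto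
    then show ?thesis using complete by simp
  qed
qed

text \<open>All unions of proper non-empty selections of in-neighbours are members. If some side is
  not selected, closure of \<open>F\<close> makes the union of all in-neighbours a member too, and
  this is only consistent when exactly one side is left out.\<close>

lemma complete_cases:
  assumes v: "v \<in> complete_nodes T" and k: "3 \<le> card (ins v)"
  shows "full (code v) \<and> ins v = code v \<or> (\<exists>R. rooted (code v) R \<and> ins v = code v - {R})"
proof -
  have st: "star (code v)" using ins_star complete_node[OF v] k by simp
  have single: "S \<in> F" if S: "S \<in> ins v" for S
    using S arc_mem by (auto simp: ins_def in_neighbours_def)
  have sub: "\<Union>J \<in> F" if J: "J \<subseteq> ins v" "J \<noteq> {}" "J \<noteq> ins v" for J
  proof (cases "card J = 1")
    case True
    then obtain S where "J = {S}" by (meson card_1_singletonE)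
    then show ?thesis using single J by simp
  next
    case False
    have "finite J" using J finite_ins finite_subset by blast
    then have "card J \<noteq> 0" using J by simp
    then have "1 < card J" using False by linarith
    moreover have "card J < card (ins v)" using J finite_ins by (intro psubset_card_mono) auto
    ultimately show ?thesis using complete_mem[OF v J(1)] by blast
  qed
  show ?thesis
  proof (cases "ins v = code v")
    case True
    then have "full (code v)" using st sub by (auto simp: full_def)
    then show ?thesis using True by blast
  next
    case False
    obtain a b c where abc: "a \<in> ins v" "b \<in> ins v" "c \<in> ins v" "a \<noteq> b" "a \<noteq> c" "b \<noteq> c"
      using three_elements[OF k] by blast
    obtain R where R: "R \<in> code v" "R \<notin> ins v" using False ins_code by blast
    \<comment> \<open>The node itself lists only selections smaller than \<open>ins v\<close>. The
      union of all of them is obtained from two crossing members, \<open>R\<close> being outside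
      both.\<close>
    have "crossing (code v) (ins v - {a}) (ins v - {b})"
      using abc R by (intro crossingI[of c _ _ b a R]) auto
    then have "crossing X (\<Union>(ins v - {a})) (\<Union>(ins v - {b}))"
      using star_crossing[OF st] ins_code by (metis Diff_subset subset_trans)
    moreover have "\<Union>(ins v - {a}) \<in> F" "\<Union>(ins v - {b}) \<in> F" using abc by (intro sub; blast)+
    ultimately have "\<Union>(ins v - {a}) \<union> \<Union>(ins v - {b}) \<in> F" using pcf_closed(2)[OF pcf] by blast
    moreover have "\<Union>(ins v - {a}) \<union> \<Union>(ins v - {b}) = \<Union>(ins v)" using abc by blast
    ultimately have all: "\<Union>(ins v) \<in> F" by simp
    have fc: "finite (code v - ins v)" using finite_code by simp
    \<comment> \<open>Otherwise \<open>nontrivial_Union_complete\<close> would make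
      \<open>ins v\<close> smaller than itself.\<close>
    have "\<not> 2 \<le> card (code v - ins v)"
      using nontrivial_Union_complete[OF st ins_code _ _ all] k by auto
    moreover have "card (code v - ins v) \<noteq> 0" using R fc by auto
    ultimately have "card (code v - ins v) = 1" by linarith
    then have ie: "code v - ins v = {R}" using R by (metis DiffI card_1_singletonE singletonD)
    then have ins: "ins v = code v - {R}" using ins_code by blast
    have "4 \<le> card (code v)"
    proof -
      have "card (ins v) < card (code v)" using False ins_code finite_code by (intro psubset_card_mono) auto
      then show ?thesis using k by simp
    qed
    moreover have "\<Union>J \<in> F" if "J \<subseteq> code v - {R}" "J \<noteq> {}" for J
      using sub[of J] all that ins by auto
    moreover have "\<Union>J \<notin> F" if "J \<subseteq> code v" "R \<in> J" "2 \<le> card J" "2 \<le> card (code v - J)" for J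
      using nontrivial_Union_complete[OF st that(1,3,4)] that(2) R by blast
    ultimately have "rooted (code v) R" using st R by (auto simp: rooted_def)
    then show ?thesis using ins by blast
  qed
qed

text \<open>With four sides every pair of sides has a non-trivial union, which only the complete
  node \<open>v\<close> can produce; and each side occurs in some pair.\<close>

lemma full_complete:
  assumes f: "full (code v)" and c: "4 \<le> card (code v)"
  shows "v \<in> complete_nodes T \<and> ins v = code v"
proof -
  have st: "star (code v)" using f by (simp add: full_def)
  have "v \<in> complete_nodes T \<and> R \<in> ins v" if R: "R \<in> code v" for R
  proof -
    have "code v \<noteq> {R}" using c by auto
    then obtain Q where Q: "Q \<in> code v" "R \<noteq> Q" using R by blast
    note p = card_pair_compl[OF finite_code c R Q]
    have "{R, Q} \<noteq> code v" using p c by auto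
    then have "\<Union>{R, Q} \<in> F" using R Q by (intro full_Union[OF f]) auto
    then show ?thesis using nontrivial_Union_complete[OF st, of "{R, Q}"] p R Q by simp
  qed
  moreover have "code v \<noteq> {}" using c by auto
  ultimately show ?thesis using ins_code by blast
qed

text \<open>Pairs avoiding \<open>R\<close> force the label and the in-neighbours. If
  \<open>R\<close> were an in-neighbour as well, the node would produce a pair containing
  \<open>R\<close>.\<close>

lemma rooted_complete:
  assumes rr: "rooted (code v) R" shows "v \<in> complete_nodes T \<and> ins v = code v - {R}"
proof -
  have st: "star (code v)" and c: "4 \<le> card (code v)" and R: "R \<in> code v"
    using rr by (auto simp: rooted_def)
  have "3 \<le> card (code v - {R})" using c R finite_code by simp
  then obtain A B where ABC: "A \<in> code v - {R}" "B \<in> code v - {R}" "A \<noteq> B"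
    using three_elements by metis
  have mem: "v \<in> complete_nodes T \<and> Q \<in> ins v" if Q: "Q \<in> code v" "Q \<noteq> R" for Q
  proof -
    obtain P where P: "P \<in> code v" "P \<noteq> R" "Q \<noteq> P" using ABC by (cases "Q = A") auto
    note p = card_pair_compl[OF finite_code c Q(1) P(1,3)]
    have "\<Union>{Q, P} \<in> F" using Q P by (intro rooted_Union[OF rr]) auto
    then show ?thesis using nontrivial_Union_complete[OF st, of "{Q, P}"] p P Q by simp
  qed
  then have v: "v \<in> complete_nodes T" using ABC by blast
  have "R \<notin> ins v"
  proof
    assume "R \<in> ins v"
    then have e: "ins v = code v" using mem ins_code by blast
    have A: "A \<in> code v" "R \<noteq> A" using ABC by auto
    note p = card_pair_compl[OF finite_code c R A]
    have "\<Union>{R, A} \<in> F" using complete_mem[OF v, of "{R, A}"] e p c R A by simp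
    then show False using rooted_pair[OF rr A(1)] A by auto
  qed
  then show ?thesis using v mem ins_code by blast
qed

text \<open>The node rooted at \<open>R\<close> has no incoming arc from the side \<open>R\<close>,
  so the member \<open>R\<close> comes from elsewhere. A complete node producing it would have a
  full star with part \<open>X - R\<close>, which \<open>unexpressed\<close> excludes. An arc
  producing it lies on another edge with the same side, and then the neighbour \<open>a\<close> has
  degree two.\<close>

lemma subdivided_node:
  assumes S: "subdivided S" shows "\<exists>v\<in>nodes T. code v = {S, X - S}"
proof -
  have main: "\<exists>v\<in>nodes T. code v = {R, X - R}" if u: "unexpressed R" for R
  proof -
    obtain M where M: "rooted M R" and RF: "R \<in> F" and nf: "\<And>M. full M \<Longrightarrow> X - R \<notin> M"
      using u by (auto simp: unexpressed_def)
    have st: "star M" "R \<in> M" using M by (auto simp: rooted_def)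
    obtain v where v: "v \<in> nodes T" "code v = M" using star_branching[OF st(1)] by blast
    have Rs: "R \<in> splits" using starD(1)[OF st(1)] st(2) by blast
    have "R \<in> code v" using v st by simp
    then obtain a where a: "adjacent T a v" "R = side T a v" by (rule node_codeE)
    have "R \<notin> ins v" using rooted_complete[of v R] v M by auto
    then have na: "(a, v) \<notin> arcs T" using ins_iff[OF a(1)] a(2) by simp
    have ne: "R \<noteq> {}" "R \<noteq> X" using splitsD[OF Rs] by auto
    from RF ne show ?thesis
    proof (cases rule: mem_cases)
      case (arc u' v')
      then have "adjacent T u' v'" by (simp add: adjacent_def)
      then consider "a = u' \<and> v = v'" | "card (code a) = 2" | "card (code v) = 2"
        using RT.same_side_edges[OF a(1)] a(2) arc by blast
      then show ?thesis
      proof cases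
        case 1
        then show ?thesis using na arc by blast
      next
        case 2
        have an: "a \<in> nodes T" using adjacent_nodes[OF a(1)] by blast
        have "X - R \<in> code a" using node_codeI[OF adjacent_sym[OF a(1)]] RT.side_basic(1)[OF a(1)] a(2) by simp
        from RT.code_degree_two[OF an 2 this] have "code a = {X - R, R}"
          using compl_compl[OF splitsD(1)[OF Rs]] by simp
        then show ?thesis using an by (auto simp: insert_commute)
      next
        case 3
        then show ?thesis using v starD(3)[OF st(1)] by simp
      qed
    next
      case (complete w J)
      have "ins w = code w" "X - R \<in> code w"
        using complete_Union(2)[OF complete(1-4)] Rs complete(5) by auto
      moreover have "full (code w)"
        using complete_cases[OF complete(1)] complete(3,4) \<open>ins w = code w\<close> unfolding rooted_def by fastforce
      ultimately show ?thesis using nf by blast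
    qed
  qed
  have "S \<subseteq> X" using S splitsD(1) by (auto simp: subdivided_def)
  then show ?thesis using S main[of S] main[of "X - S"] compl_compl
    by (auto simp: subdivided_def insert_commute)
qed

lemma codes_sub: "codes \<subseteq> code ` nodes T"
proof
  fix M assume "M \<in> codes"
  then consider x where "x \<in> X" "M = {X - {x}}" | "star M" | S where "subdivided S" "M = {S, X - S}"
    by (auto simp: codes_def)
  then show "M \<in> code ` nodes T"
  proof cases
    case 1
    then show ?thesis using RT.leaf_code[OF 1(1)] RT.Leaf_node[OF 1(1)] by (metis imageI)
  next
    case 2
    then show ?thesis using star_branching by blast
  next
    case 3
    then show ?thesis using subdivided_node by (metis imageI)
  qed
qed

end

section \<open>Reduced tree representations\<close>

lemma same_graph:
  assumes "nodes T' = nodes T" "\<And>u v. adjacent T' u v \<longleftrightarrow> adjacent T u v"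
  shows "simple_path T' = simple_path T" "leaves T' = leaves T" "internal_nodes T' = internal_nodes T"
    "side T' = side T"
proof -
  have a: "adjacent T' = adjacent T" using assms(2) by blast
  show p: "simple_path T' = simple_path T" by (intro ext) (simp add: simple_path_def assms(1) a)
  show l: "leaves T' = leaves T" by (simp add: leaves_def assms(1) a)
  show "internal_nodes T' = internal_nodes T" by (simp add: internal_nodes_def assms(1) l)
  show "side T' = side T" by (intro ext) (simp add: side_def p l)
qed

lemma represented_sets_alt:
  "represented_sets T =
     {(\<Union>u\<in>J. side T u v) | v J. v \<in> complete_nodes T \<and> J \<subseteq> in_neighbours T v \<and>
        1 < card J \<and> card J < card (in_neighbours T v)}
   \<union> {side T u v | u v. (u, v) \<in> arcs T}"
  unfolding represented_sets_def in_neighbours_def by blast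

text \<open>The bound on the number of nodes is an assumption here because it needs the canonical
  tree, which comes later; \<open>reduced_unique\<close> discharges it by minimality.\<close>

locale reduced_family = represented_family +
  assumes reduced: "reduced_tree_representation X F T"
    and card_nodes_le: "card (nodes T) \<le> card codes"
begin

text \<open>By \<open>codes_sub\<close> the chain from \<open>card codes\<close> over the image to
  \<open>card (nodes T)\<close> is increasing, and the assumed bound closes it.\<close>

lemma code_inj: "inj_on code (nodes T)" and code_image: "code ` nodes T = codes"
proof -
  have fin: "finite (code ` nodes T)" using RT.fin_nodes by simp
  have le: "card codes \<le> card (code ` nodes T)" using card_mono[OF fin codes_sub] .
  have le': "card (code ` nodes T) \<le> card (nodes T)" using card_image_le[OF RT.fin_nodes] .
  show "code ` nodes T = codes" using card_seteq[OF fin codes_sub] le' card_nodes_le by simp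
  show "inj_on code (nodes T)" using eq_card_imp_inj_on[OF RT.fin_nodes, of code] le le' card_nodes_le by linarith
qed

text \<open>If arcs already produce all unions of \<open>v\<close>, relabelling \<open>v\<close> as
  prime changes no represented set, against reducedness.\<close>

lemma complete_not_redundant:
  assumes v: "v \<in> complete_nodes T"
    and red: "\<And>J. J \<subseteq> ins v \<Longrightarrow> 1 < card J \<Longrightarrow> card J < card (ins v) \<Longrightarrow> \<exists>a b. (a, b) \<in> arcs T \<and> \<Union>J = side T a b"
  shows False
proof -
  define T' where "T' = T\<lparr>complete_nodes := complete_nodes T - {v}\<rparr>"
  have g: "nodes T' = nodes T" "\<And>a b. adjacent T' a b \<longleftrightarrow> adjacent T a b" "arcs T' = arcs T"
    by (simp_all add: T'_def adjacent_def)
  note e = same_graph[OF g(1,2)]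
  have inn: "in_neighbours T' = in_neighbours T" by (intro ext) (simp add: in_neighbours_def g(3))
  have ct: "complete_nodes T' = complete_nodes T - {v}" by (simp add: T'_def)
  have sub: "represented_sets T \<subseteq> represented_sets T'"
  proof
    fix S assume "S \<in> represented_sets T"
    then consider (1) w J where "w \<in> complete_nodes T" "J \<subseteq> in_neighbours T w" "1 < card J"
      "card J < card (in_neighbours T w)" "S = (\<Union>u\<in>J. side T u w)"
      | (2) a b where "(a, b) \<in> arcs T" "S = side T a b"
      unfolding represented_sets_alt by blast
    then show "S \<in> represented_sets T'"
    proof cases
      case 1
      show ?thesis
      proof (cases "w = v")
        case False
        then show ?thesis unfolding represented_sets_alt ct inn e(4) g(3) using 1 by blast
      next
        case True
        let ?J = "(\<lambda>u. side T u v) ` J"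
        have "card ?J = card J" using inj_on_subset[OF inj_side] 1(2) True by (intro card_image) blast
        then have "\<exists>a b. (a, b) \<in> arcs T \<and> \<Union>?J = side T a b"
          using 1 True card_ins by (intro red) (auto simp: ins_def)
        then show ?thesis unfolding represented_sets_alt ct inn e(4) g(3) using 1(5) True by blast
      qed
    next
      case 2
      then show ?thesis unfolding represented_sets_alt ct inn e(4) g(3) by blast
    qed
  qed
  moreover have "represented_sets T' \<subseteq> represented_sets T"
    unfolding represented_sets_alt ct inn e(4) g(3) by blast
  ultimately have "represented_sets T' = represented_sets T" by blast
  then have "tree_representation X F T'"
    using rep unfolding tree_representation_def oriented_tree_def e g ct by auto
  then show False using reduced v unfolding reduced_tree_representation_def T'_def by blast
qed

lemma complete_three_ins: "v \<in> complete_nodes T \<Longrightarrow> 3 \<le> card (ins v)"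
proof (rule ccontr)
  assume v: "v \<in> complete_nodes T" and n: "\<not> 3 \<le> card (ins v)"
  have "\<not> (1 < card J \<and> card J < card (ins v))" for J :: "'a set set" using n by linarith
  then show False using complete_not_redundant[OF v] by blast
qed

lemma complete_full_or_rooted:
  "v \<in> complete_nodes T \<Longrightarrow>
     full (code v) \<and> ins v = code v \<or> (\<exists>R. rooted (code v) R \<and> ins v = code v - {R})"
  using complete_cases complete_three_ins by blast

text \<open>Rootedness forbids the arc by \<open>rooted_complete\<close>. Otherwise suppose the arc
  is absent: then \<open>v\<close> is not complete, since a complete node has all sides as
  in-neighbours except the one it is rooted at. Adding the arc would thus contribute only the member
  \<open>side T u v\<close> itself, against reducedness.\<close>

lemma arc_iff:
  assumes uv: "adjacent T u v"
  shows "(u, v) \<in> arcs T \<longleftrightarrow> side T u v \<in> F \<and> \<not> rooted (code v) (side T u v)"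
proof
  assume a: "(u, v) \<in> arcs T"
  then have "side T u v \<in> ins v" using ins_iff[OF uv] by blast
  then show "side T u v \<in> F \<and> \<not> rooted (code v) (side T u v)"
    using arc_mem[OF a] rooted_complete[of v "side T u v"] by auto
next
  assume s: "side T u v \<in> F \<and> \<not> rooted (code v) (side T u v)"
  show "(u, v) \<in> arcs T"
  proof (rule ccontr)
    assume n: "(u, v) \<notin> arcs T"
    then have vu: "(v, u) \<in> arcs T" using uv by (simp add: adjacent_def)
    have nin: "side T u v \<notin> ins v" using n ins_iff[OF uv] by blast
    have vc: "v \<notin> complete_nodes T"
    proof
      assume "v \<in> complete_nodes T"
      from complete_full_or_rooted[OF this] show False using nin s node_codeI[OF uv] by auto
    qed
    define T' where "T' = T\<lparr>arcs := insert (u, v) (arcs T)\<rparr>"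
    have g: "nodes T' = nodes T" "complete_nodes T' = complete_nodes T" "arcs T' = insert (u, v) (arcs T)"
      by (simp_all add: T'_def)
    have ad: "adjacent T' a b \<longleftrightarrow> adjacent T a b" for a b
      using uv by (auto simp: adjacent_def g)
    note e = same_graph[OF g(1) ad]
    have inn: "in_neighbours T' w = in_neighbours T w" if "w \<in> complete_nodes T" for w
      using that vc by (auto simp: in_neighbours_def g)
    have "represented_sets T' = represented_sets T \<union> {side T u v}"
    proof -
      have "{(\<Union>u\<in>J. side T u v) | v J. v \<in> complete_nodes T \<and> J \<subseteq> in_neighbours T' v \<and>
        1 < card J \<and> card J < card (in_neighbours T' v)} =
        {(\<Union>u\<in>J. side T u v) | v J. v \<in> complete_nodes T \<and> J \<subseteq> in_neighbours T v \<and>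
        1 < card J \<and> card J < card (in_neighbours T v)}"
        (is "?C' = ?C") using inn by (intro Collect_cong) metis
      moreover have "{side T a b | a b. (a, b) \<in> insert (u, v) (arcs T)} =
        {side T a b | a b. (a, b) \<in> arcs T} \<union> {side T u v}" by blast
      ultimately show ?thesis unfolding represented_sets_alt e(4) g by (simp only: Un_assoc)
    qed
    then have F': "F = represented_sets T' \<union> {{}, X}" using rep_F s by blast
    have uvn: "u \<in> nodes T" "v \<in> nodes T" "u \<noteq> v" using adjacent_nodes[OF uv] RT.not_adjacent_self uv by auto
    have "oriented_tree T'" using rep_tree uvn unfolding oriented_tree_def e g by auto
    then have "tree_representation X F T'"
      using rep F' unfolding tree_representation_def e g by blast
    then show False using reduced vu n unfolding reduced_tree_representation_def T'_def by blast
  qed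
qed

text \<open>Rooted stars and full stars with at least four parts have non-trivial unions, which no
  arc produces. A full star with three parts only yields complements of single sides, that is, the
  sets of arcs leaving \<open>v\<close>; its label is kept exactly when one of these arcs is
  absent.\<close>

lemma complete_iff:
  assumes v: "v \<in> nodes T"
  shows "v \<in> complete_nodes T \<longleftrightarrow> (\<exists>R. rooted (code v) R) \<or>
     full (code v) \<and> (4 \<le> card (code v) \<or> (\<exists>u. adjacent T u v \<and> (v, u) \<notin> arcs T))"
proof
  assume vc: "v \<in> complete_nodes T"
  show "(\<exists>R. rooted (code v) R) \<or>
     full (code v) \<and> (4 \<le> card (code v) \<or> (\<exists>u. adjacent T u v \<and> (v, u) \<notin> arcs T))"
  proof (rule ccontr)
    assume n: "\<not> ?thesis"
    then have f: "full (code v)" "ins v = code v" and c: "\<not> 4 \<le> card (code v)"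
      and arcs: "\<And>u. adjacent T u v \<Longrightarrow> (v, u) \<in> arcs T"
      using complete_full_or_rooted[OF vc] by auto
    have st: "star (code v)" using f by (simp add: full_def)
    then have c3: "card (code v) = 3" using c starD(3) by force
    show False
    proof (rule complete_not_redundant[OF vc])
      fix J assume J: "J \<subseteq> ins v" "1 < card J" "card J < card (ins v)"
      have Jc: "J \<subseteq> code v" using J f by simp
      have "card (code v - J) = card (code v) - card J"
        using card_Diff_subset[OF finite_subset[OF Jc finite_code] Jc] .
      then have "card (code v - J) = 1" using J f c3 by simp
      then obtain l where l: "code v - J = {l}" by (meson card_1_singletonE)
      then have "l \<in> code v" by blast
      then obtain u where u: "adjacent T u v" "l = side T u v" by (rule node_codeE)
      have "X - \<Union>J = l" using star_complement[OF st Jc] l by simp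
      moreover have "\<Union>J \<subseteq> X" using Jc starD(2)[OF st] by blast
      ultimately have "\<Union>J = X - l" by blast
      then have "\<Union>J = side T v u" using RT.side_basic(1)[OF u(1)] u(2) by simp
      then show "\<exists>a b. (a, b) \<in> arcs T \<and> \<Union>J = side T a b" using arcs[OF u(1)] by blast
    qed
  qed
next
  assume "(\<exists>R. rooted (code v) R) \<or>
     full (code v) \<and> (4 \<le> card (code v) \<or> (\<exists>u. adjacent T u v \<and> (v, u) \<notin> arcs T))"
  then consider R where "rooted (code v) R" | "full (code v)" "4 \<le> card (code v)"
    | u where "full (code v)" "adjacent T u v" "(v, u) \<notin> arcs T" by blast
  then show "v \<in> complete_nodes T"
  proof cases
    case 1
    then show ?thesis using rooted_complete by blast
  next
    case 2
    then show ?thesis using full_complete by blast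
  next
    case 3
    define S where "S = side T v u"
    have st: "star (code v)" using 3 by (simp add: full_def)
    have vu: "adjacent T v u" using adjacent_sym[OF 3(2)] .
    have Sx: "S = X - side T u v" unfolding S_def by (rule RT.side_basic(1)[OF 3(2)])
    have SF: "S \<in> F" unfolding Sx by (rule full_complement[OF 3(1) node_codeI[OF 3(2)]])
    \<comment> \<open>The member \<open>S\<close> has no arc into \<open>u\<close>, and by
      \<open>arc_iff\<close> rootedness is the only possible reason. So \<open>u\<close> has degree
      at least four, the edge is not subdivided, and \<open>S\<close> must come from
      \<open>v\<close> as a complete node.\<close>
    have rt: "rooted (code u) S" using arc_iff[OF vu] 3(3) SF by (simp add: S_def)
    have c: "card (code v) \<noteq> 2" "card (code u) \<noteq> 2"
      using starD(3)[OF st] rt unfolding rooted_def by auto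
    have ne: "S \<noteq> {}" "S \<noteq> X" using RT.side_basic[OF vu] by (auto simp: S_def)
    from SF ne show ?thesis
    proof (cases rule: mem_cases)
      case (arc a b)
      have "adjacent T a b" using arc by (simp add: adjacent_def)
      then have "v = a \<and> u = b" using RT.same_side_edges[OF vu] c arc by (auto simp: S_def)
      then show ?thesis using arc 3(3) by blast
    next
      case (complete w J)
      have w: "star (code w)" using complete_Union(1)[OF complete(1-4)] .
      have "S \<in> splits" unfolding S_def by (rule edge_split[OF vu])
      then have "X - S \<in> code w" using complete_Union(2)[OF complete(1-4)] complete(5) by auto
      moreover have "X - S = side T u v" using RT.side_basic(2)[OF 3(2)] Sx by blast
      then have "X - S \<in> code v" using node_codeI[OF 3(2)] by simp
      ultimately have "v = w" using RT.same_part_nodes[of "X - S" v w] c starD(3)[OF w] by simp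
      then show ?thesis using complete by simp
    qed
  qed
qed

text \<open>Both nodes see the same split from opposite ends. The last condition says that no node
  of degree two lies strictly between them, and \<open>code u \<noteq> code v\<close> excludes
  taking the subdividing node for both ends.\<close>

lemma edge_code_iff:
  assumes u: "u \<in> nodes T" and v: "v \<in> nodes T"
  shows "adjacent T u v \<and> side T u v = S \<longleftrightarrow>
    S \<in> code v \<and> X - S \<in> code u \<and> code u \<noteq> code v \<and>
    ({S, X - S} \<in> codes \<longrightarrow> {S, X - S} \<in> {code u, code v})"
proof
  assume "adjacent T u v \<and> side T u v = S"
  then have uv: "adjacent T u v" and S: "side T u v = S" by auto
  have Sv: "S \<in> code v" using node_codeI[OF uv] S by simp
  have Su: "X - S \<in> code u" using node_codeI[OF adjacent_sym[OF uv]] RT.side_basic(1)[OF uv] S by simp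
  have SX: "X - (X - S) = S" using compl_compl[OF RT.side_basic(2)[OF uv]] S by simp
  have ne: "code u \<noteq> code v" using code_inj u v RT.not_adjacent_self uv by (metis inj_onD)
  have "{S, X - S} \<in> {code u, code v}" if mem: "{S, X - S} \<in> codes"
  proof -
    obtain n where n: "n \<in> nodes T" "code n = {S, X - S}" using mem code_image by (metis imageE)
    then have "S \<in> code n" by simp
    then obtain w where w: "adjacent T w n" "S = side T w n" by (rule node_codeE)
    from RT.same_side_edges[OF uv w(1)] S w(2)
    consider "v = n" | "card (code u) = 2" | "card (code v) = 2" by auto
    then show ?thesis
    proof cases
      case 1
      then show ?thesis using n by simp
    next
      case 2
      then show ?thesis using RT.code_degree_two[OF u 2 Su] SX by (simp add: insert_commute)
    next
      case 3
      then show ?thesis using RT.code_degree_two[OF v 3 Sv] by simp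
    qed
  qed
  then show "S \<in> code v \<and> X - S \<in> code u \<and> code u \<noteq> code v \<and>
    ({S, X - S} \<in> codes \<longrightarrow> {S, X - S} \<in> {code u, code v})" using Sv Su ne by blast
next
  assume A: "S \<in> code v \<and> X - S \<in> code u \<and> code u \<noteq> code v \<and>
    ({S, X - S} \<in> codes \<longrightarrow> {S, X - S} \<in> {code u, code v})"
  have "S \<in> code v" using A by blast
  then obtain w where w: "adjacent T w v" "S = side T w v" by (rule node_codeE)
  have "X - S \<in> code u" using A by blast
  then obtain z where z: "adjacent T z u" "X - S = side T z u" by (rule node_codeE)
  have SX: "S \<subseteq> X" using RT.side_basic(2)[OF w(1)] w(2) by simp
  have uz: "adjacent T u z" "side T u z = S"
    using adjacent_sym[OF z(1)] RT.side_basic(1)[OF z(1)] z(2) compl_compl[OF SX] by auto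
  have wn: "w \<in> nodes T" "z \<in> nodes T" using adjacent_nodes w z by blast+
  show "adjacent T u v \<and> side T u v = S"
  proof (cases "u = w")
    case True
    then show ?thesis using w by simp
  next
    case False
    have cw: "X - S \<in> code w" using node_codeI[OF adjacent_sym[OF w(1)]] RT.side_basic(1)[OF w(1)] w(2) by simp
    have cz: "S \<in> code z" using node_codeI[OF uz(1)] uz(2) by simp
    have two: "card (code x) = 2 \<Longrightarrow> S \<in> code x \<or> X - S \<in> code x \<Longrightarrow> x \<in> nodes T \<Longrightarrow> code x = {S, X - S}" for x
      using RT.code_degree_two[of x S] RT.code_degree_two[of x "X - S"] compl_compl[OF SX]
      by (auto simp: insert_commute)
    \<comment> \<open>As \<open>u\<close> differs from \<open>w\<close>, the set \<open>S\<close> is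
      the side of two different edges. Each of these has an end of degree two, and its code must be
      \<open>{S, X - S}\<close>.\<close>
    have 1: "code w = {S, X - S} \<or> code v = {S, X - S}"
    proof -
      have "card (code w) = 2 \<or> card (code v) = 2"
        using RT.same_side_edges[OF w(1) uz(1)] w(2) uz(2) False by auto
      then show ?thesis using two[OF _ _ wn(1)] two[OF _ _ v] cw \<open>S \<in> code v\<close> by blast
    qed
    have 2: "code u = {S, X - S} \<or> code z = {S, X - S}"
    proof -
      have "card (code u) = 2 \<or> card (code z) = 2"
        using RT.same_side_edges[OF uz(1) w(1)] w(2) uz(2) False by auto
      then show ?thesis using two[OF _ _ wn(2)] two[OF _ _ u] cz \<open>X - S \<in> code u\<close> by blast
    qed
    have "{S, X - S} \<in> codes" using 1 code_image wn v by (metis imageI)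
    then have "{S, X - S} \<in> {code u, code v}" using A by (elim conjE) (erule (1) mp)
    then have 3: "code u = {S, X - S} \<or> code v = {S, X - S}" by (metis insertE singletonD)
    have ne: "code u \<noteq> code v" using A by (elim conjE)
    show ?thesis
    proof (cases "code v = {S, X - S}")
      case True
      then have "code z = code v" using 2 ne by metis
      then have "z = v" using code_inj wn v by (metis inj_onD)
      then show ?thesis using uz by simp
    next
      case False
      then have "code w = code u" using 1 3 by metis
      then have "w = u" using code_inj wn u by (metis inj_onD)
      then show ?thesis using w by simp
    qed
  qed
qed

text \<open>Adjacent nodes of degree two would have equal codes, against injectivity; so
  \<open>card_nodes\<close> gives \<open>4 * card X\<close> nodes, and \<open>card_arcs\<close> at
  most twice as many arcs.\<close>

lemma otree_size_le: "otree_size T \<le> 12 * card X"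
proof -
  have "card (nodes T) \<le> 4 * card X"
  proof (rule RT.card_nodes)
    fix u v assume uv: "adjacent T u v"
    show "\<not> (card (code u) = 2 \<and> card (code v) = 2)"
    proof
      assume c: "card (code u) = 2 \<and> card (code v) = 2"
      define S where "S = side T u v"
      have n: "u \<in> nodes T" "v \<in> nodes T" using adjacent_nodes[OF uv] by auto
      have SX: "X - (X - S) = S" using compl_compl[OF RT.side_basic(2)[OF uv]] by (simp add: S_def)
      have "S \<in> code v" using node_codeI[OF uv] by (simp add: S_def)
      then have "code v = {S, X - S}" using RT.code_degree_two[OF n(2)] c by blast
      moreover have "X - S \<in> code u"
        using node_codeI[OF adjacent_sym[OF uv]] RT.side_basic(1)[OF uv] by (simp add: S_def)
      then have "code u = {X - S, X - (X - S)}" using RT.code_degree_two[OF n(1)] c by blast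
      ultimately have "code u = code v" using SX by (simp add: insert_commute)
      then have "u = v" using code_inj n by (metis inj_onD)
      then show False using uv RT.not_adjacent_self by blast
    qed
  qed
  then show ?thesis using RT.card_arcs by (simp add: otree_size_def)
qed

end

lemma reduced_representations_isomorphic:
  assumes "reduced_family X F T" "reduced_family X F T'"
  shows "otree_iso T T'"
proof -
  interpret A: reduced_family X F T by fact
  interpret B: reduced_family X F T' by fact
  have bijA: "bij_betw (node_code T) (nodes T) A.codes"
    using A.code_inj A.code_image by (simp add: bij_betw_def)
  have bijB: "bij_betw (node_code T') (nodes T') A.codes"
    using B.code_inj B.code_image by (simp add: bij_betw_def)
  define f where "f = inv_into (nodes T') (node_code T') \<circ> node_code T"
  have f: "bij_betw f (nodes T) (nodes T')"
    unfolding f_def by (rule bij_betw_trans[OF bijA bij_betw_inv_into[OF bijB]])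
  have fn: "f v \<in> nodes T'" if "v \<in> nodes T" for v using f that by (metis bij_betwE)
  have code_f: "node_code T' (f v) = node_code T v" if "v \<in> nodes T" for v
  proof -
    have "node_code T v \<in> node_code T' ` nodes T'" using that A.code_image B.code_image by blast
    then show ?thesis by (simp add: f_def f_inv_into_f)
  qed
  have edge: "adjacent T u v \<and> side T u v = S \<longleftrightarrow> adjacent T' (f u) (f v) \<and> side T' (f u) (f v) = S"
    if "u \<in> nodes T" "v \<in> nodes T" for u v S
    unfolding A.edge_code_iff[OF that] B.edge_code_iff[OF fn[OF that(1)] fn[OF that(2)]]
    using code_f that by simp
  have adj: "adjacent T u v \<longleftrightarrow> adjacent T' (f u) (f v)" if "u \<in> nodes T" "v \<in> nodes T" for u v
    using edge[OF that] by blast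
  have arcs: "(u, v) \<in> arcs T \<longleftrightarrow> (f u, f v) \<in> arcs T'" if uv: "u \<in> nodes T" "v \<in> nodes T" for u v
  proof (cases "adjacent T u v")
    case True
    then have "adjacent T' (f u) (f v)" "side T' (f u) (f v) = side T u v" using edge[OF uv] by blast+
    then show ?thesis using A.arc_iff[OF True] B.arc_iff code_f uv by simp
  next
    case False
    then show ?thesis using adj[OF uv] by (auto simp: adjacent_def)
  qed
  have "v \<in> complete_nodes T \<longleftrightarrow> f v \<in> complete_nodes T'" if v: "v \<in> nodes T" for v
  proof -
    have "(\<exists>u. adjacent T u v \<and> (v, u) \<notin> arcs T) \<longleftrightarrow> (\<exists>u. adjacent T' u (f v) \<and> (f v, u) \<notin> arcs T')"
    proof
      assume "\<exists>u. adjacent T u v \<and> (v, u) \<notin> arcs T"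
      then obtain u where u: "adjacent T u v" "(v, u) \<notin> arcs T" by blast
      then have "u \<in> nodes T" using A.adjacent_nodes by blast
      then show "\<exists>u. adjacent T' u (f v) \<and> (f v, u) \<notin> arcs T'" using u adj arcs v by blast
    next
      assume "\<exists>u. adjacent T' u (f v) \<and> (f v, u) \<notin> arcs T'"
      then obtain u' where u': "adjacent T' u' (f v)" "(f v, u') \<notin> arcs T'" by blast
      then have "u' \<in> nodes T'" using B.adjacent_nodes by blast
      then obtain u where "u \<in> nodes T" "u' = f u" using f by (metis bij_betw_imp_surj_on imageE)
      then show "\<exists>u. adjacent T u v \<and> (v, u) \<notin> arcs T" using u' adj arcs v by blast
    qed
    then show ?thesis using A.complete_iff[OF v] B.complete_iff[OF fn[OF v]] code_f[OF v] by simp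
  qed
  moreover have "f (Leaf x) = Leaf x" if x: "Leaf x \<in> nodes T" for x
  proof -
    \<comment> \<open>Internal nodes are required to be of the form \<open>Inner\<close>, so a node
      named \<open>Leaf x\<close> is a leaf and has the code \<open>{X - {x}}\<close> in both
      trees.\<close>
    have "Leaf x \<in> leaves T" using x A.rep_internal by (auto simp: internal_nodes_def)
    then have xX: "x \<in> X" using A.rep_leaves by auto
    have "node_code T' (f (Leaf x)) = node_code T' (Leaf x)"
      using code_f[OF x] A.RT.leaf_code[OF xX] B.RT.leaf_code[OF xX] by simp
    then show ?thesis using B.code_inj fn[OF x] B.RT.Leaf_node[OF xX] by (metis inj_onD)
  qed
  ultimately show ?thesis unfolding otree_iso_def using f arcs by blast
qed

section \<open>The canonical tree representation\<close>

context partitive_family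
begin

text \<open>This is the end of the directed edge with \<open>S\<close> behind it, passing over a
  possible subdivision. If only one element is ahead, the end is a leaf, and \<open>{S}\<close> is
  its code.\<close>

definition node_at :: "'a set \<Rightarrow> 'a set set" where
  "node_at S = (if card (X - S) = 1 then {S} else (THE M. star M \<and> S \<in> M))"

lemma star_part_big: "star M \<Longrightarrow> S \<in> M \<Longrightarrow> card (X - S) \<noteq> 1"
proof
  assume M: "star M" "S \<in> M" and "card (X - S) = 1"
  then obtain x where x: "X - S = {x}" by (meson card_1_singletonE)
  then have "x \<in> X" by blast
  then obtain Q where "Q \<in> M" "x \<in> Q" using starD(2)[OF M(1)] by blast
  then show False using star_part_complement_not_subset[OF M, of Q] x by simp
qed

lemma node_at_star: "star M \<Longrightarrow> S \<in> M \<Longrightarrow> node_at S = M"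
proof -
  assume M: "star M" "S \<in> M"
  have "(THE M. star M \<and> S \<in> M) = M" using M stars_share_part by (intro the_equality) blast+
  then show ?thesis using star_part_big[OF M] by (simp add: node_at_def)
qed

lemma node_at_leaf: "x \<in> X \<Longrightarrow> node_at (X - {x}) = {X - {x}}"
  unfolding node_at_def by (simp add: double_diff)

lemma node_at_cases:
  assumes S: "S \<in> splits"
  obtains (leaf) x where "x \<in> X" "S = X - {x}" "node_at S = {S}" | (star) "star (node_at S)" "S \<in> node_at S"
proof (cases "card (X - S) = 1")
  case True
  then obtain x where x: "X - S = {x}" by (meson card_1_singletonE)
  then have "S = X - {x}" "x \<in> X" using splitsD(1)[OF S] by blast+
  then show thesis using leaf[of x] node_at_leaf[of x] by simp
next
  case False
  have "X - S \<noteq> {}" using splitsD[OF S] by blast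
  then have "card (X - S) \<noteq> 0" using finite_X by simp
  then have "2 \<le> card (X - S)" using False by linarith
  then obtain M where M: "star M" "S \<in> M" using star_exists[OF S] by blast
  then show thesis using star node_at_star[OF M] by simp
qed

lemma node_at_code: "S \<in> splits \<Longrightarrow> node_at S \<in> codes"
  by (erule node_at_cases) (auto simp: codes_def)

lemma in_node_at: "S \<in> splits \<Longrightarrow> S \<in> node_at S"
  by (erule node_at_cases) auto

lemma split_neq_complement: "S \<in> splits \<Longrightarrow> S \<noteq> X - S"
  using splitsD[of S] by blast

lemma node_at_card: "S \<in> splits \<Longrightarrow> card (node_at S) \<noteq> 2"
  by (erule node_at_cases) (auto dest: starD(3))

lemma codes_cases:
  assumes "M \<in> codes"
  obtains (leaf) x where "x \<in> X" "M = {X - {x}}" | (star) "star M"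
  | (mid) S where "subdivided S" "M = {S, X - S}" "S \<noteq> X - S"
proof -
  from assms consider x where "x \<in> X" "M = {X - {x}}" | "star M" | S where "subdivided S" "M = {S, X - S}"
    unfolding codes_def by blast
  then show thesis
  proof cases
    case (3 S)
    then have "S \<noteq> X - S" by (intro split_neq_complement) (simp add: subdivided_def)
    then show thesis using mid 3 by blast
  qed (use leaf star in blast)+
qed

lemma code_sub_splits: "M \<in> codes \<Longrightarrow> M \<subseteq> splits"
  by (erule codes_cases)
    (use starD(1) splits_complement singleton_split in \<open>auto simp: subdivided_def\<close>)

text \<open>Parts of stars and leaves determine their node; only a subdividing node shares its parts
  with other nodes.\<close>

lemma code_eq_node_at:
  assumes M: "M \<in> codes" and Q: "Q \<in> M" and ne: "M \<noteq> {Q, X - Q}"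
  shows "M = node_at Q"
  using M
proof (cases rule: codes_cases)
  case (leaf x)
  then show ?thesis using Q node_at_leaf by simp
next
  case star
  then show ?thesis using Q node_at_star by simp
next
  case (mid S)
  have "S \<subseteq> X" using mid splitsD(1) by (auto simp: subdivided_def)
  then have "M = {Q, X - Q}" using mid Q by auto
  then show ?thesis using ne by blast
qed

lemma mid_in_codes_iff: "S \<in> splits \<Longrightarrow> {S, X - S} \<in> codes \<longleftrightarrow> subdivided S"
proof
  assume S: "S \<in> splits" and m: "{S, X - S} \<in> codes"
  have c: "card {S, X - S} = 2" using split_neq_complement[OF S] by simp
  from m show "subdivided S"
  proof (cases rule: codes_cases)
    case (leaf x)
    then have "card {S, X - S} = 1" by (metis is_singletonI is_singleton_altdef)
    then show ?thesis using c by simp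
  next
    case star
    then show ?thesis using starD(3) c by fastforce
  next
    case (mid R)
    then have "S = R \<or> S = X - R" by (metis doubleton_eq_iff)
    then show ?thesis using mid subdivided_complement by blast
  qed
qed (auto simp: codes_def)

end

text \<open>Codes are families of sets, whereas tree nodes have type \<open>'a node\<close>.
  \<open>kap\<close> is an arbitrary naming of the codes by nodes, prescribed only on the
  leaves.\<close>

locale canonical = partitive_family X F
  for X :: "'a set" and F +
  fixes r :: 'a and kap :: "'a node \<Rightarrow> 'a set set" and N :: "'a node set"
  assumes r_in: "r \<in> X" and kap_bij: "bij_betw kap N codes"
    and kap_Leaf: "\<And>x. x \<in> X \<Longrightarrow> Leaf x \<in> N \<and> kap (Leaf x) = {X - {x}}"
    and N_sub: "N \<subseteq> Leaf ` X \<union> range Inner"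
begin

section \<open>Parents and children of codes\<close>

definition rpart :: "'a set set \<Rightarrow> 'a set" where
  "rpart M = (THE Q. Q \<in> M \<and> r \<in> Q)"

text \<open>Going towards \<open>r\<close> over the edge with lower side \<open>A\<close>, the next
  node is the subdividing one, if there is one and it is not \<open>M\<close> itself; otherwise it
  is the far end of the edge.\<close>

definition par_code :: "'a set set \<Rightarrow> 'a set set" where
  "par_code M = (let A = X - rpart M in if subdivided A \<and> M \<noteq> {A, X - A} then {A, X - A} else node_at A)"

lemma code_disjoint:
  assumes "M \<in> codes" "P \<in> M" "Q \<in> M" "P \<noteq> Q" shows "P \<inter> Q = {}"
  using assms(1)
proof (cases rule: codes_cases)
  case star
  then show ?thesis using starD(6) assms by blast
qed (use assms in auto)

lemma rpart_eq: "M \<in> codes \<Longrightarrow> Q \<in> M \<Longrightarrow> r \<in> Q \<Longrightarrow> rpart M = Q"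
  unfolding rpart_def using code_disjoint by (intro the_equality) blast+

lemma rpart_ex:
  assumes "M \<in> codes" "M \<noteq> {X - {r}}" shows "\<exists>Q\<in>M. r \<in> Q"
  using assms(1)
proof (cases rule: codes_cases)
  case (leaf x)
  then show ?thesis using assms r_in by auto
next
  case star
  then show ?thesis using starD(2) r_in by blast
next
  case (mid S)
  then show ?thesis using r_in by auto
qed

lemma rpart:
  assumes "M \<in> codes" "M \<noteq> {X - {r}}" shows "rpart M \<in> M" "r \<in> rpart M" "rpart M \<in> splits"
  using rpart_ex[OF assms] rpart_eq[OF assms(1)] code_sub_splits[OF assms(1)] by auto

lemma code_rest:
  assumes "M \<in> codes" "M \<noteq> {X - {r}}" "S \<in> M" "S \<noteq> rpart M" shows "r \<notin> S" "S \<subseteq> X - rpart M"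
proof -
  have "S \<inter> rpart M = {}" using code_disjoint[OF assms(1,3) rpart(1)[OF assms(1,2)] assms(4)] .
  moreover have "S \<subseteq> X" using code_sub_splits[OF assms(1)] assms(3) splitsD(1) by blast
  ultimately show "r \<notin> S" "S \<subseteq> X - rpart M" using rpart(2)[OF assms(1,2)] by blast+
qed

lemma node_at_rpart:
  assumes A: "A \<in> splits" "r \<notin> A"
  shows "node_at A = {X - {r}} \<or> node_at A \<noteq> {X - {r}} \<and> A \<subset> X - rpart (node_at A)"
proof (cases "node_at A = {X - {r}}")
  case False
  from A(1) show ?thesis
  proof (cases rule: node_at_cases)
    case (leaf x)
    then have "x = r" using A(2) r_in by blast
    then show ?thesis using leaf False by simp
  next
    case star
    have c: "node_at A \<in> codes" using node_at_code[OF A(1)] .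
    have ne: "A \<noteq> rpart (node_at A)" using rpart(2)[OF c False] A(2) by blast
    have "A \<subseteq> X - rpart (node_at A)" using code_rest(2)[OF c False star(2) ne] .
    moreover have "X - rpart (node_at A) \<noteq> A"
      using star_part_complement_not_subset[OF star(1) rpart(1)[OF c False] star(2)] by blast
    ultimately show ?thesis using False by blast
  qed
qed simp

text \<open>The part containing \<open>r\<close> shrinks on the way to the root, except from a node
  to the subdividing node directly above it, where it stays the same. The summand 1 for degrees
  other than two breaks this tie, and the factor 2 makes room for it.\<close>

definition dep_code :: "'a set set \<Rightarrow> nat" where
  "dep_code M = (if M = {X - {r}} then 0 else 2 * card (rpart M) + (if card M = 2 then 0 else 1))"

lemma mid_not_root: "A \<in> splits \<Longrightarrow> {A, X - A} \<noteq> {X - {r}}"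
  using split_neq_complement by auto

lemma par_code_props:
  assumes M: "M \<in> codes" and nr: "M \<noteq> {X - {r}}"
  defines "A \<equiv> X - rpart M"
  shows "par_code M \<in> codes" "A \<in> par_code M" "dep_code (par_code M) < dep_code M"
    "par_code M \<noteq> {X - {r}} \<Longrightarrow> A \<subseteq> X - rpart (par_code M)"
    "A \<in> splits" "r \<notin> A" "X - A = rpart M"
proof -
  note q = rpart[OF M nr]
  have QX: "rpart M \<subseteq> X" using splitsD(1)[OF q(3)] .
  show A: "A \<in> splits" unfolding A_def by (rule splits_complement[OF q(3)])
  show rA: "r \<notin> A" using q by (simp add: A_def)
  show XA: "X - A = rpart M" unfolding A_def by (rule compl_compl[OF QX])
  have p: "par_code M = (if subdivided A \<and> M \<noteq> {A, X - A} then {A, X - A} else node_at A)"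
    by (simp add: par_code_def A_def Let_def)
  have fQ: "finite (rpart M)" using QX finite_X finite_subset by blast
  have "par_code M \<in> codes \<and> A \<in> par_code M \<and> dep_code (par_code M) < dep_code M \<and>
    (par_code M \<noteq> {X - {r}} \<longrightarrow> A \<subseteq> X - rpart (par_code M))"
  proof (cases "subdivided A \<and> M \<noteq> {A, X - A}")
    case True
    then have pm: "par_code M = {A, X - A}" using p by simp
    have c: "{A, X - A} \<in> codes" using mid_in_codes_iff[OF A] True by blast
    have rp: "rpart {A, X - A} = rpart M" using rpart_eq[OF c, of "rpart M"] XA q(2) by simp
    have "card M \<noteq> 2"
    proof
      assume c2: "card M = 2"
      from M show False
      proof (cases rule: codes_cases)
        case (mid S)
        have "S \<subseteq> X" using mid splitsD(1) by (auto simp: subdivided_def)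
        then have "M = {A, X - A}" using mid q(1) XA A_def by auto
        then show False using True by blast
      qed (use c2 starD(3)[of M] in auto)
    qed
    moreover have "card {A, X - A} = 2" using split_neq_complement[OF A] by simp
    ultimately have "dep_code {A, X - A} < dep_code M"
      using mid_not_root[OF A] nr rp unfolding dep_code_def by simp
    then show ?thesis using pm c rp A_def by simp
  next
    case False
    then have pm: "par_code M = node_at A" using p by auto
    have Qne: "card (rpart M) \<noteq> 0" using q(2) fQ by auto
    show ?thesis
    proof (cases "node_at A = {X - {r}}")
      case True
      have "dep_code (node_at A) = 0" using True by (simp add: dep_code_def)
      moreover have "0 < dep_code M" using Qne nr by (simp add: dep_code_def)
      ultimately show ?thesis using pm True node_at_code[OF A] in_node_at[OF A] by simp
    next
      case n: False
      then have ss: "A \<subset> X - rpart (node_at A)" using node_at_rpart[OF A rA] by blast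
      have cd: "node_at A \<in> codes" using node_at_code[OF A] .
      have sX: "rpart (node_at A) \<subseteq> X" using splitsD(1)[OF rpart(3)[OF cd n]] .
      have "rpart (node_at A) \<subset> rpart M" using ss sX QX unfolding A_def by blast
      then have "card (rpart (node_at A)) < card (rpart M)" by (rule psubset_card_mono[OF fQ])
      then have "dep_code (node_at A) < dep_code M" using n nr by (simp add: dep_code_def)
      then show ?thesis using pm cd in_node_at[OF A] ss by auto
    qed
  qed
  then show "par_code M \<in> codes" "A \<in> par_code M" "dep_code (par_code M) < dep_code M"
    "par_code M \<noteq> {X - {r}} \<Longrightarrow> A \<subseteq> X - rpart (par_code M)" by blast+
qed

text \<open>A given root part occurs in at most two codes, the one given by \<open>node_at\<close>
  and the subdividing one. If both occur, the second is the parent of the first, so their parents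
  differ.\<close>

lemma child_code_unique:
  assumes M: "M \<in> codes" "M \<noteq> {X - {r}}" and M': "M' \<in> codes" "M' \<noteq> {X - {r}}"
    and rp: "rpart M = rpart M'" and p: "par_code M = par_code M'"
  shows "M = M'"
proof -
  define A where "A = X - rpart M"
  note q = par_code_props[OF M]
  have A: "A \<in> splits" "X - A = rpart M" using q(5,7) by (auto simp: A_def)
  have pM: "par_code M = (if subdivided A \<and> M \<noteq> {A, X - A} then {A, X - A} else node_at A)"
    by (simp add: par_code_def A_def Let_def)
  have pM': "par_code M' = (if subdivided A \<and> M' \<noteq> {A, X - A} then {A, X - A} else node_at A)"
    by (simp add: par_code_def A_def rp Let_def)
  have c2: "card {A, X - A} = 2" using split_neq_complement[OF A(1)] by simp
  have nm: "node_at A \<noteq> {A, X - A}" using node_at_card[OF A(1)] c2 by auto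
  have sw: "{rpart M, X - rpart M} = {A, X - A}" using A(2) A_def by auto
  have at: "L = node_at (rpart M)" if "L \<in> codes" "rpart M \<in> L" "L \<noteq> {A, X - A}" for L
    using code_eq_node_at[OF that(1,2)] that(3) sw by simp
  have in1: "rpart M \<in> M" using rpart(1)[OF M] .
  have in2: "rpart M \<in> M'" using rpart(1)[OF M'] rp by simp
  show ?thesis
  proof (cases "subdivided A")
    case True
    then show ?thesis using p pM pM' nm at[OF M(1) in1] at[OF M'(1) in2]
      by (cases "M = {A, X - A}"; cases "M' = {A, X - A}") auto
  next
    case False
    then have "{A, X - A} \<notin> codes" using mid_in_codes_iff[OF A(1)] by simp
    then show ?thesis using at[OF M(1) in1] at[OF M'(1) in2] M(1) M'(1) by metis
  qed
qed

text \<open>The child across \<open>S\<close> is the subdividing node if the edge has one and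
  \<open>M\<close> is not it; otherwise it is \<open>node_at (X - S)\<close>.\<close>

lemma child_code_exists:
  assumes M: "M \<in> codes" and S: "S \<in> M" "r \<notin> S"
  shows "\<exists>L\<in>codes. L \<noteq> {X - {r}} \<and> X - rpart L = S \<and> par_code L = M"
proof -
  have Ss: "S \<in> splits" using code_sub_splits[OF M] S by blast
  have SX: "S \<subseteq> X" using splitsD(1)[OF Ss] .
  have XS: "X - (X - S) = S" using compl_compl[OF SX] .
  have rS: "r \<in> X - S" using S r_in by blast
  have Xs: "X - S \<in> splits" using splits_complement[OF Ss] .
  have mk: "L \<noteq> {X - {r}} \<and> X - rpart L = S" if L: "L \<in> codes" "X - S \<in> L" for L
    using rpart_eq[OF L rS] XS rS L(2) by auto
  have pc: "par_code L = (if subdivided S \<and> L \<noteq> {S, X - S} then {S, X - S} else node_at S)"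
    if "X - rpart L = S" for L using that by (simp add: par_code_def Let_def)
  define L1 where "L1 = node_at (X - S)"
  have L1: "L1 \<in> codes" "X - S \<in> L1" using node_at_code[OF Xs] in_node_at[OF Xs] by (auto simp: L1_def)
  have c2: "card {S, X - S} = 2" using split_neq_complement[OF Ss] by simp
  have L1m: "L1 \<noteq> {S, X - S}" using node_at_card[OF Xs] c2 by (auto simp: L1_def)
  show ?thesis
  proof (cases "subdivided S")
    case True
    show ?thesis
    proof (cases "M = {S, X - S}")
      case eq: True
      then have "par_code L1 = M" using pc mk[OF L1] L1m True by simp
      then show ?thesis using mk[OF L1] L1 by blast
    next
      case False
      then have Ma: "M = node_at S" using code_eq_node_at[OF M S(1)] by blast
      have m: "{S, X - S} \<in> codes" using mid_in_codes_iff[OF Ss] True by blast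
      have k: "{S, X - S} \<noteq> {X - {r}} \<and> X - rpart {S, X - S} = S" using mk[OF m] by simp
      then have "par_code {S, X - S} = M" using pc[of "{S, X - S}"] Ma by simp
      then show ?thesis using k m by (intro bexI[of _ "{S, X - S}"] conjI) simp_all
    qed
  next
    case False
    then have "{S, X - S} \<notin> codes" using mid_in_codes_iff[OF Ss] by simp
    then have "M \<noteq> {S, X - S}" using M by auto
    then have "M = node_at S" using code_eq_node_at[OF M S(1)] by blast
    then have "par_code L1 = M" using pc mk[OF L1] False by simp
    then show ?thesis using mk[OF L1] L1 by blast
  qed
qed

definition nd :: "'a set set \<Rightarrow> 'a node" where "nd = inv_into N kap"

lemma kap_code: "u \<in> N \<Longrightarrow> kap u \<in> codes"
  using kap_bij by (auto simp: bij_betw_def)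

lemma nd_node: "M \<in> codes \<Longrightarrow> nd M \<in> N" and kap_nd: "M \<in> codes \<Longrightarrow> kap (nd M) = M"
  using kap_bij unfolding nd_def bij_betw_def by (auto simp: inv_into_into f_inv_into_f)

lemma nd_kap: "u \<in> N \<Longrightarrow> nd (kap u) = u"
  using kap_bij by (simp add: nd_def bij_betw_def)

lemma kap_inj: "u \<in> N \<Longrightarrow> v \<in> N \<Longrightarrow> kap u = kap v \<Longrightarrow> u = v"
  using nd_kap by metis

lemma root_N: "Leaf r \<in> N" "kap (Leaf r) = {X - {r}}"
  using kap_Leaf[OF r_in] by auto

lemma kap_not_root: "u \<in> N \<Longrightarrow> u \<noteq> Leaf r \<Longrightarrow> kap u \<noteq> {X - {r}}"
  using kap_inj root_N by metis

section \<open>The tree on the codes\<close>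

definition pr :: "'a node \<Rightarrow> 'a node" where "pr u = nd (par_code (kap u))"

definition below :: "'a node \<Rightarrow> 'a set" where "below u = X - rpart (kap u)"

text \<open>The arcs follow the criterion of \<open>arc_iff\<close>: each side that is a member gets
  its arc unless the target is rooted at that side. The labels are generous, as every full star is
  complete, so the tree need not be reduced; only its number of nodes matters later.\<close>

definition ctree :: "'a otree" where
  "ctree = \<lparr>nodes = N,
     arcs = {(u, pr u) | u. u \<in> N \<and> u \<noteq> Leaf r \<and> below u \<in> F \<and> \<not> rooted (kap (pr u)) (below u)} \<union>
       {(pr u, u) | u. u \<in> N \<and> u \<noteq> Leaf r \<and> X - below u \<in> F \<and> \<not> rooted (kap u) (X - below u)},
     complete_nodes = {v \<in> N. full (kap v) \<or> (\<exists>R. rooted (kap v) R)}\<rparr>"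

lemma ctree_sel: "nodes ctree = N" "complete_nodes ctree = {v \<in> N. full (kap v) \<or> (\<exists>R. rooted (kap v) R)}"
  by (simp_all add: ctree_def)

lemma below_props:
  assumes u: "u \<in> N" "u \<noteq> Leaf r"
  shows "pr u \<in> N" "kap (pr u) = par_code (kap u)" "below u \<in> kap (pr u)" "X - below u \<in> kap u"
    "below u \<in> splits" "r \<notin> below u" "r \<in> X - below u" "dep_code (kap (pr u)) < dep_code (kap u)"
    "X - below u = rpart (kap u)"
    "pr u \<noteq> Leaf r \<Longrightarrow> below u \<subseteq> below (pr u)"
proof -
  note k = kap_code[OF u(1)] kap_not_root[OF u]
  note q = par_code_props[OF k] and q' = rpart[OF k]
  show n: "pr u \<in> N" and kp: "kap (pr u) = par_code (kap u)"
    using nd_node[OF q(1)] kap_nd[OF q(1)] by (simp_all add: pr_def)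
  show "below u \<in> kap (pr u)" "X - below u \<in> kap u" "below u \<in> splits" "r \<notin> below u" "r \<in> X - below u"
    "dep_code (kap (pr u)) < dep_code (kap u)" "X - below u = rpart (kap u)"
    using q q' kp r_in by (simp_all add: below_def)
  show "below u \<subseteq> below (pr u)" if "pr u \<noteq> Leaf r"
    using q(4) kp kap_not_root[OF n that] by (simp add: below_def)
qed

text \<open>If an edge had no arc, its two ends would be rooted towards each other with both sides
  members. The star at the lower end is not full, so the lower side is unexpressed and the edge is
  subdivided; but then the upper end has degree two and is not rooted.\<close>

lemma one_arc:
  assumes u: "u \<in> N" "u \<noteq> Leaf r"
  shows "below u \<in> F \<and> \<not> rooted (kap (pr u)) (below u) \<or> X - below u \<in> F \<and> \<not> rooted (kap u) (X - below u)"
proof (rule ccontr)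
  assume n: "\<not> ?thesis"
  define A where "A = below u"
  note b = below_props[OF u, folded A_def]
  have AX: "X - (X - A) = A" using compl_compl[OF splitsD(1)[OF b(5)]] .
  have up: "rooted (kap (pr u)) A"
  proof (rule ccontr)
    assume nr: "\<not> rooted (kap (pr u)) A"
    then have "A \<notin> F" using n by (simp add: A_def)
    then have "X - A \<in> F" using splitsD(4)[OF b(5)] by blast
    then have "rooted (kap u) (X - A)" using n by (simp add: A_def)
    then have "X - (X - A) \<in> F" by (rule rooted_complement)
    then show False using \<open>A \<notin> F\<close> AX by simp
  qed
  then have "X - A \<in> F" by (rule rooted_complement)
  then have dn: "rooted (kap u) (X - A)" using n by (simp add: A_def)
  then have "A \<in> F" using rooted_complement AX by metis
  have "\<not> full M" if "X - A \<in> M" for M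
  proof
    assume f: "full M"
    then have "star M" "star (kap u)" using dn by (auto simp: full_def rooted_def)
    then have "M = kap u" using stars_share_part that b(4) by blast
    then show False using rooted_not_full[OF dn] f by simp
  qed
  then have "unexpressed A" using \<open>A \<in> F\<close> up by (auto simp: unexpressed_def)
  then have sub: "subdivided A" using b(5) by (simp add: subdivided_def)
  have "kap u \<noteq> {A, X - A}"
  proof
    assume "kap u = {A, X - A}"
    then have "card (kap u) \<le> 2" by (simp add: card_insert_if)
    then show False using dn starD(3)[of "kap u"] by (simp add: rooted_def)
  qed
  then have "kap (pr u) = {A, X - A}" using b(2) sub by (simp add: par_code_def A_def below_def Let_def)
  then have "card (kap (pr u)) \<le> 2" by (simp add: card_insert_if)
  then show False using up starD(3)[of "kap (pr u)"] by (simp add: rooted_def)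
qed

lemma ctree_adjacent:
  "adjacent ctree u v \<longleftrightarrow> (u \<in> N \<and> u \<noteq> Leaf r \<and> v = pr u) \<or> (v \<in> N \<and> v \<noteq> Leaf r \<and> u = pr v)"
proof
  assume "adjacent ctree u v"
  then show "(u \<in> N \<and> u \<noteq> Leaf r \<and> v = pr u) \<or> (v \<in> N \<and> v \<noteq> Leaf r \<and> u = pr v)"
    by (auto simp: adjacent_def ctree_def)
next
  have "adjacent ctree w (pr w)" if "w \<in> N" "w \<noteq> Leaf r" for w
    using one_arc[OF that] that by (auto simp: adjacent_def ctree_def)
  then show "(u \<in> N \<and> u \<noteq> Leaf r \<and> v = pr u) \<or> (v \<in> N \<and> v \<noteq> Leaf r \<and> u = pr v) \<Longrightarrow> adjacent ctree u v"
    using adjacent_sym by blast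
qed

lemma finite_N: "finite N"
  using bij_betw_finite[OF kap_bij] codes_finite by simp

sublocale G: rooted_graph ctree "Leaf r" pr "\<lambda>u. dep_code (kap u)"
  by unfold_locales
    (use finite_N root_N below_props ctree_adjacent in \<open>simp_all add: ctree_sel\<close>)

lemma children_bij: "v \<in> N \<Longrightarrow> bij_betw below (G.children v) {S \<in> kap v. r \<notin> S}"
proof (rule bij_betw_imageI)
  assume v: "v \<in> N"
  show "inj_on below (G.children v)"
  proof (rule inj_onI)
    fix a b assume "a \<in> G.children v" "b \<in> G.children v" and e: "below a = below b"
    then have a: "a \<in> N" "a \<noteq> Leaf r" "pr a = v" and b: "b \<in> N" "b \<noteq> Leaf r" "pr b = v"
      by (auto simp: G.children_def ctree_sel)
    have "rpart (kap a) = rpart (kap b)" using below_props(9)[OF a(1,2)] below_props(9)[OF b(1,2)] e by simp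
    moreover have "par_code (kap a) = par_code (kap b)"
      using below_props(2)[OF a(1,2)] below_props(2)[OF b(1,2)] a b by simp
    ultimately have "kap a = kap b"
      using child_code_unique[OF kap_code[OF a(1)] kap_not_root[OF a(1,2)]
          kap_code[OF b(1)] kap_not_root[OF b(1,2)]] by blast
    then show "a = b" using kap_inj a b by blast
  qed
  show "below ` G.children v = {S \<in> kap v. r \<notin> S}"
  proof
    show "below ` G.children v \<subseteq> {S \<in> kap v. r \<notin> S}"
      using below_props(3,6) by (auto simp: G.children_def ctree_sel)
    show "{S \<in> kap v. r \<notin> S} \<subseteq> below ` G.children v"
    proof
      fix S assume "S \<in> {S \<in> kap v. r \<notin> S}"
      then obtain L where L: "L \<in> codes" "L \<noteq> {X - {r}}" "X - rpart L = S" "par_code L = kap v"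
        using child_code_exists[OF kap_code[OF v], of S] by blast
      have n: "nd L \<in> N" "kap (nd L) = L" using nd_node[OF L(1)] kap_nd[OF L(1)] by auto
      then have "nd L \<noteq> Leaf r" using L root_N by auto
      moreover have "pr (nd L) = v" using n L nd_kap[OF v] by (simp add: pr_def)
      moreover have "below (nd L) = S" using n L by (simp add: below_def)
      ultimately show "S \<in> below ` G.children v" using n by (auto simp: G.children_def ctree_sel)
    qed
  qed
qed

lemma finite_kap: "v \<in> N \<Longrightarrow> finite (kap v)"
proof -
  assume "v \<in> N"
  then have "kap v \<subseteq> Pow X" using code_sub_splits[OF kap_code] splitsD(1) by blast
  then show ?thesis using finite_X finite_subset by blast
qed

lemma card_nbrs_kap: "v \<in> N \<Longrightarrow> card {w. adjacent ctree v w} = card (kap v)"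
proof (cases "v = Leaf r")
  case True
  assume v: "v \<in> N"
  have "{S \<in> kap v. r \<notin> S} = kap v" using True root_N by auto
  then show ?thesis using True G.nbrs_rt bij_betw_same_card[OF children_bij[OF v]] by simp
next
  case False
  assume v: "v \<in> N"
  note k = kap_code[OF v] kap_not_root[OF v False]
  have "{S \<in> kap v. r \<notin> S} = kap v - {rpart (kap v)}"
    using code_rest(1)[OF k] rpart[OF k] by auto
  then have "card (G.children v) = card (kap v) - 1"
    using bij_betw_same_card[OF children_bij[OF v]] rpart(1)[OF k] finite_kap[OF v] by simp
  moreover have "card (kap v) \<noteq> 0" using rpart(1)[OF k] finite_kap[OF v] by auto
  ultimately show ?thesis using G.card_nbrs[of v] v False by (simp add: ctree_sel)
qed

lemma kap_leaf_iff: "v \<in> N \<Longrightarrow> v \<in> Leaf ` X \<longleftrightarrow> card (kap v) \<le> 1"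
proof
  assume v: "v \<in> N" and c: "card (kap v) \<le> 1"
  from kap_code[OF v] show "v \<in> Leaf ` X"
  proof (cases rule: codes_cases)
    case (leaf x)
    then have "kap v = kap (Leaf x)" using kap_Leaf[of x] by simp
    then show ?thesis using kap_inj[OF v] kap_Leaf leaf by blast
  qed (use c starD(3)[of "kap v"] in auto)
qed (use kap_Leaf in auto)

lemma ctree_leaves: "leaves ctree = Leaf ` X"
  using kap_leaf_iff card_nbrs_kap kap_Leaf by (auto simp: leaves_def ctree_sel)

sublocale R: rooted_otree ctree "Leaf r" pr "\<lambda>u. dep_code (kap u)" X r
  by unfold_locales (use ctree_leaves r_in finite_X two_le_card in simp_all)

lemma below_Leaf: "x \<in> X \<Longrightarrow> x \<noteq> r \<Longrightarrow> below (Leaf x) = {x}"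
  using kap_Leaf[of x] rpart_eq[OF kap_code, of "Leaf x" "X - {x}"] r_in by (auto simp: below_def)

lemma below_mono: "w \<in> G.desc u \<Longrightarrow> u \<noteq> Leaf r \<Longrightarrow> below w \<subseteq> below u"
proof (induction "dep_code (kap w)" arbitrary: w rule: less_induct)
  case less
  show ?case
  proof (cases "w = u")
    case False
    have w: "w \<in> N" using less.prems G.desc_nodes by (auto simp: ctree_sel)
    have p: "w \<noteq> Leaf r" "pr w \<in> G.desc u" using G.desc_par[OF less.prems(1) False] by auto
    have "pr w \<noteq> Leaf r" using p G.rt_in_desc less.prems by metis
    then have "below w \<subseteq> below (pr w)" using below_props(10)[OF w p(1)] by blast
    moreover have "below (pr w) \<subseteq> below u" using less.hyps[OF below_props(8)[OF w p(1)] p(2)] less.prems by blast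
    ultimately show ?thesis by blast
  qed simp
qed

text \<open>Unless \<open>u\<close> is a leaf, \<open>x\<close> lies in the part of some child of
  \<open>u\<close>, whose set of descendants is smaller.\<close>

lemma leaf_desc: "u \<in> N \<Longrightarrow> u \<noteq> Leaf r \<Longrightarrow> x \<in> below u \<Longrightarrow> Leaf x \<in> G.desc u"
proof (induction "card (G.desc u)" arbitrary: u rule: less_induct)
  case less
  note u = less.prems(1,2)
  note k = kap_code[OF u(1)] kap_not_root[OF u]
  have self: "u \<in> G.desc u" using G.desc_self u by (simp add: ctree_sel)
  from k(1) show ?case
  proof (cases rule: codes_cases)
    case (leaf y)
    then have "u = Leaf y" using kap_inj[OF u(1)] kap_Leaf by metis
    moreover have "y \<noteq> r" using calculation u by blast
    ultimately have "x = y" using below_Leaf leaf less.prems by auto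
    then show ?thesis using self \<open>u = Leaf y\<close> by simp
  next
    have nl: "\<Union>(kap u) = X" if "star (kap u) \<or> (\<exists>S. subdivided S \<and> kap u = {S, X - S})"
    proof -
      have "\<Union>{S, X - S} = X" if "subdivided S" for S
        using splitsD(1)[of S] that by (auto simp: subdivided_def)
      then show ?thesis using that starD(2)[of "kap u"] by metis
    qed
    have step: "Leaf x \<in> G.desc u" if cov: "\<Union>(kap u) = X"
    proof -
      have "x \<in> X" using less.prems by (simp add: below_def)
      then obtain S where S: "S \<in> kap u" "x \<in> S" using cov by blast
      then have "S \<noteq> rpart (kap u)" using less.prems(3) by (auto simp: below_def)
      then have "r \<notin> S" using code_rest(1)[OF k S(1)] by blast
      then have "S \<in> below ` G.children u"
        using children_bij[OF u(1)] S by (auto simp: bij_betw_def)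
      then obtain w where w: "w \<in> G.children u" "below w = S" by blast
      have wn: "w \<in> N" "w \<noteq> Leaf r" "pr w = u" using w by (auto simp: G.children_def ctree_sel)
      have wd: "w \<in> G.desc u" using G.child_desc[of w] wn by (simp add: ctree_sel)
      have "u \<notin> G.desc w" using G.par_notin_desc[of w] wn by (simp add: ctree_sel)
      then have "G.desc w \<subset> G.desc u" using wd self G.desc_trans by blast
      moreover have "finite (G.desc u)" using G.desc_nodes finite_N ctree_sel finite_subset by metis
      ultimately have "card (G.desc w) < card (G.desc u)" by (metis psubset_card_mono)
      then have "Leaf x \<in> G.desc w" using less.hyps[of w] wn w S by simp
      then show ?thesis using wd G.desc_trans by blast
    qed
    {
      case star
      then show ?thesis using step nl by blast
    next
      case (mid S)
      then show ?thesis using step nl by blast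
    }
  qed
qed

lemma cl_below: "u \<in> N \<Longrightarrow> u \<noteq> Leaf r \<Longrightarrow> R.cl u = below u"
proof
  assume u: "u \<in> N" "u \<noteq> Leaf r"
  show "R.cl u \<subseteq> below u"
  proof
    fix x assume x: "x \<in> R.cl u"
    then have d: "Leaf x \<in> G.desc u" "x \<in> X" by (auto simp: R.cl_def)
    have "x \<noteq> r" using x R.r_notin_cl u by blast
    then show "x \<in> below u" using below_mono[OF d(1) u(2)] below_Leaf d by simp
  qed
  show "below u \<subseteq> R.cl u" using leaf_desc[OF u] by (auto simp: R.cl_def below_def)
qed

lemma side_below: "u \<in> N \<Longrightarrow> u \<noteq> Leaf r \<Longrightarrow> side ctree u (pr u) = below u \<and> side ctree (pr u) u = X - below u"
  using R.side_cl[of u] R.side_cl'[of u] cl_below[of u] by (simp add: ctree_sel)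

lemma ctree_code: "v \<in> N \<Longrightarrow> node_code ctree v = kap v"
proof
  assume v: "v \<in> N"
  show "node_code ctree v \<subseteq> kap v"
  proof
    fix S assume "S \<in> node_code ctree v"
    then obtain u where u: "adjacent ctree u v" "S = side ctree u v" by (rule node_codeE)
    then show "S \<in> kap v" using ctree_adjacent[of u v] side_below below_props(3,4) by auto
  qed
  show "kap v \<subseteq> node_code ctree v"
  proof
    fix S assume S: "S \<in> kap v"
    show "S \<in> node_code ctree v"
    proof (cases "r \<in> S")
      case True
      then have nr: "v \<noteq> Leaf r" using S root_N by auto
      then have "S = rpart (kap v)" using rpart_eq[OF kap_code[OF v] S True] by simp
      then have "S = side ctree (pr v) v" using side_below[OF v nr] below_props(9)[OF v nr] by simp
      moreover have "adjacent ctree (pr v) v" using ctree_adjacent v nr by blast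
      ultimately show ?thesis using node_codeI by blast
    next
      case False
      then have "S \<in> below ` G.children v" using children_bij[OF v] S by (auto simp: bij_betw_def)
      then obtain w where "w \<in> G.children v" "below w = S" by blast
      then have w: "w \<in> N" "w \<noteq> Leaf r" "pr w = v" "below w = S" by (auto simp: G.children_def ctree_sel)
      then have "adjacent ctree w v" using ctree_adjacent by blast
      moreover have "side ctree w v = S" using side_below[OF w(1,2)] w by simp
      ultimately show ?thesis using node_codeI by blast
    qed
  qed
qed

section \<open>Sets represented by the canonical tree\<close>

lemma ctree_arc_iff:
  assumes a: "adjacent ctree u v"
  shows "(u, v) \<in> arcs ctree \<longleftrightarrow> side ctree u v \<in> F \<and> \<not> rooted (kap v) (side ctree u v)"
proof -
  have no: "\<not> (pr (pr w) = w \<and> pr w \<noteq> Leaf r)" if "w \<in> N" "w \<noteq> Leaf r" for w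
    using below_props(8)[OF that] below_props(8)[OF below_props(1)[OF that]] by force
  have arcs: "(a, b) \<in> arcs ctree \<longleftrightarrow>
    (a \<in> N \<and> a \<noteq> Leaf r \<and> b = pr a \<and> below a \<in> F \<and> \<not> rooted (kap (pr a)) (below a)) \<or>
    (b \<in> N \<and> b \<noteq> Leaf r \<and> a = pr b \<and> X - below b \<in> F \<and> \<not> rooted (kap b) (X - below b))" for a b
    by (auto simp: ctree_def)
  consider "u \<in> N" "u \<noteq> Leaf r" "v = pr u" | "v \<in> N" "v \<noteq> Leaf r" "u = pr v"
    using a ctree_adjacent by blast
  then show ?thesis
  proof cases
    case 1
    then have "\<not> (v \<in> N \<and> v \<noteq> Leaf r \<and> u = pr v)" using no[of u] by auto
    then show ?thesis using arcs[of u v] side_below[of u] 1 by auto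
  next
    case 2
    then have "\<not> (u \<in> N \<and> u \<noteq> Leaf r \<and> v = pr u)" using no[of v] by auto
    then show ?thesis using arcs[of u v] side_below[of v] 2 by auto
  qed
qed

lemma ctree_in_nbrs:
  assumes v: "v \<in> N"
  shows "(\<lambda>u. side ctree u v) ` in_neighbours ctree v = {S \<in> kap v. S \<in> F \<and> \<not> rooted (kap v) S}"
proof
  have adj: "adjacent ctree u v" if "u \<in> in_neighbours ctree v" for u
    using that by (simp add: in_neighbours_def adjacent_def)
  show "(\<lambda>u. side ctree u v) ` in_neighbours ctree v \<subseteq> {S \<in> kap v. S \<in> F \<and> \<not> rooted (kap v) S}"
    using adj ctree_arc_iff node_codeI ctree_code[OF v] by (fastforce simp: in_neighbours_def)
  show "{S \<in> kap v. S \<in> F \<and> \<not> rooted (kap v) S} \<subseteq> (\<lambda>u. side ctree u v) ` in_neighbours ctree v"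
  proof
    fix S assume S: "S \<in> {S \<in> kap v. S \<in> F \<and> \<not> rooted (kap v) S}"
    then have "S \<in> node_code ctree v" using ctree_code[OF v] by simp
    then obtain u where u: "adjacent ctree u v" "S = side ctree u v" by (rule node_codeE)
    then have "(u, v) \<in> arcs ctree" using ctree_arc_iff S by simp
    then show "S \<in> (\<lambda>u. side ctree u v) ` in_neighbours ctree v" using u by (auto simp: in_neighbours_def)
  qed
qed

lemma ctree_inj_side: "inj_on (\<lambda>u. side ctree u v) (in_neighbours ctree v)"
  by (rule inj_onI) (rule R.side_inj, auto simp: in_neighbours_def adjacent_def)

lemma complete_represented:
  assumes v: "v \<in> complete_nodes ctree" and J: "J \<subseteq> {S \<in> kap v. S \<in> F \<and> \<not> rooted (kap v) S}"
    and c: "1 < card J" "card J < card {S \<in> kap v. S \<in> F \<and> \<not> rooted (kap v) S}"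
  shows "\<Union>J \<in> represented_sets ctree"
proof -
  have vN: "v \<in> N" using v by (simp add: ctree_sel)
  obtain J' where J': "J' \<subseteq> in_neighbours ctree v" "J = (\<lambda>u. side ctree u v) ` J'"
    using J unfolding ctree_in_nbrs[OF vN, symmetric] by (meson subset_imageE)
  have "card J = card J'" using J' inj_on_subset[OF ctree_inj_side J'(1)] by (simp add: card_image)
  moreover have "card {S \<in> kap v. S \<in> F \<and> \<not> rooted (kap v) S} = card (in_neighbours ctree v)"
    unfolding ctree_in_nbrs[OF vN, symmetric] by (rule card_image[OF ctree_inj_side])
  ultimately show ?thesis unfolding represented_sets_alt using v J' c by auto
qed

lemma arc_represented: "(u, v) \<in> arcs ctree \<Longrightarrow> side ctree u v \<in> represented_sets ctree"
  unfolding represented_sets_alt by blast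

lemma full_ins: "full M \<Longrightarrow> {S \<in> M. S \<in> F \<and> \<not> rooted M S} = M"
  using full_part rooted_not_full by blast

lemma rooted_ins: "rooted M R \<Longrightarrow> {S \<in> M. S \<in> F \<and> \<not> rooted M S} = M - {R}"
  using rooted_part rooted_unique by blast

lemma represented_mem: "S \<in> represented_sets ctree \<Longrightarrow> S \<in> F"
proof -
  assume "S \<in> represented_sets ctree"
  then consider (1) v J where "v \<in> complete_nodes ctree" "J \<subseteq> in_neighbours ctree v" "1 < card J"
      "card J < card (in_neighbours ctree v)" "S = (\<Union>u\<in>J. side ctree u v)"
    | (2) u v where "(u, v) \<in> arcs ctree" "S = side ctree u v"
    unfolding represented_sets_alt by blast
  then show "S \<in> F"
  proof cases
    case 1
    have vN: "v \<in> N" using 1 by (simp add: ctree_sel)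
    define K where "K = (\<lambda>u. side ctree u v) ` J"
    have KI: "K \<subseteq> {S \<in> kap v. S \<in> F \<and> \<not> rooted (kap v) S}"
      unfolding ctree_in_nbrs[OF vN, symmetric] K_def using 1(2) by blast
    have cK: "card K = card J" unfolding K_def using inj_on_subset[OF ctree_inj_side 1(2)] by (rule card_image)
    have cI: "card {S \<in> kap v. S \<in> F \<and> \<not> rooted (kap v) S} = card (in_neighbours ctree v)"
      unfolding ctree_in_nbrs[OF vN, symmetric] by (rule card_image[OF ctree_inj_side])
    have K: "K \<noteq> {}" "K \<noteq> {S \<in> kap v. S \<in> F \<and> \<not> rooted (kap v) S}" using cK cI 1(3,4) by auto
    have "\<Union>K \<in> F"
    proof (cases "full (kap v)")
      case True
      then show ?thesis using K KI full_ins[OF True] full_Union[OF True, of K] by auto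
    next
      case False
      then obtain R where R: "rooted (kap v) R" using 1(1) by (auto simp: ctree_sel)
      then show ?thesis using K(1) KI rooted_ins[OF R] rooted_Union[OF R, of K] by auto
    qed
    then show ?thesis using 1(5) by (simp add: K_def)
  next
    case 2
    then have "adjacent ctree u v" by (simp add: adjacent_def)
    then show ?thesis using ctree_arc_iff 2 by simp
  qed
qed

text \<open>A split \<open>S\<close> has an arc into \<open>node_at S\<close> unless that star is
  rooted at \<open>S\<close>. In this case either the edge is subdivided and the arc goes to the
  subdividing node, or a full star at the other end produces \<open>S\<close> as the union of all
  its parts but \<open>X - S\<close>. A member that is no split is a non-trivial union at a full or
  rooted star.\<close>

lemma mem_represented:
  assumes S: "S \<in> F" "S \<noteq> {}" "S \<noteq> X" shows "S \<in> represented_sets ctree"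
proof -
  have edge: "S \<in> represented_sets ctree" if M: "M \<in> codes" "S \<in> M" "\<not> rooted M S" for M
  proof -
    note n = nd_node[OF M(1)] kap_nd[OF M(1)]
    have "S \<in> node_code ctree (nd M)" using ctree_code[OF n(1)] n M by simp
    then obtain u where u: "adjacent ctree u (nd M)" "S = side ctree u (nd M)" by (rule node_codeE)
    then have "(u, nd M) \<in> arcs ctree" using ctree_arc_iff S M n by simp
    then show ?thesis using arc_represented u by simp
  qed
  have star_codes: "M \<in> codes" if "star M" for M using that by (simp add: codes_def)
  show ?thesis
  proof (cases "S \<in> splits")
    case sp: True
    show ?thesis
    proof (cases "rooted (node_at S) S")
      case False
      then show ?thesis using edge[OF node_at_code[OF sp] in_node_at[OF sp]] by blast
    next
      case rt: True
      show ?thesis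
      proof (cases "subdivided S")
        case True
        have "\<not> star {S, X - S}" using starD(3)[of "{S, X - S}"] split_neq_complement[OF sp] by auto
        then have "\<not> rooted {S, X - S} S" by (simp add: rooted_def)
        moreover have "{S, X - S} \<in> codes" using mid_in_codes_iff[OF sp] True by blast
        ultimately show ?thesis using edge by blast
      next
        case False
        then have "\<not> unexpressed S" using sp by (simp add: subdivided_def)
        then obtain M where M: "full M" "X - S \<in> M" using rt S(1) by (auto simp: unexpressed_def)
        have st: "star M" using M by (simp add: full_def)
        note n = nd_node[OF star_codes[OF st]] kap_nd[OF star_codes[OF st]]
        have vc: "nd M \<in> complete_nodes ctree" using n M by (simp add: ctree_sel)
        have U: "\<Union>(M - {X - S}) = S"
          using star_complement[OF st, of "{X - S}"] M compl_compl[OF splitsD(1)[OF sp]] by simp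
        have cc: "card (M - {X - S}) = card M - 1" using M starD(4)[OF st] by simp
        have "\<Union>(M - {X - S}) \<in> represented_sets ctree"
          using complete_represented[OF vc, of "M - {X - S}"] n full_ins[OF M(1)] cc starD(3)[OF st] by auto
        then show ?thesis using U by simp
      qed
    qed
  next
    case False
    then obtain M J where J: "star M" "J \<subseteq> M" "2 \<le> card J" "2 \<le> card (M - J)" "S = \<Union>J"
      using member_split_or_star_Union[OF S] by blast
    have UJ: "\<Union>J \<in> F" using S J by simp
    note n = nd_node[OF star_codes[OF J(1)]] kap_nd[OF star_codes[OF J(1)]]
    have cJ: "card (M - J) = card M - card J"
      using card_Diff_subset[OF finite_subset[OF J(2) starD(4)[OF J(1)]] J(2)] .
    from nontrivial_full_or_rooted[OF J(1-4) UJ]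
    show ?thesis
    proof
      assume f: "full M"
      then have vc: "nd M \<in> complete_nodes ctree" using n by (simp add: ctree_sel)
      then show ?thesis
        using complete_represented[OF vc, of J, unfolded n(2) full_ins[OF f]] J cJ by simp
    next
      assume "\<exists>R. rooted M R \<and> R \<notin> J"
      then obtain R where R: "rooted M R" "R \<notin> J" by blast
      then have vc: "nd M \<in> complete_nodes ctree" using n by (auto simp: ctree_sel)
      have "R \<in> M" using R by (simp add: rooted_def)
      then have "card (M - {R}) = card M - 1" using starD(4)[OF J(1)] by simp
      then have "card J < card (M - {R})" using cJ J(4) by linarith
      moreover have "J \<subseteq> M - {R}" using J(2) R(2) by blast
      ultimately show ?thesis
        using complete_represented[OF vc, of J, unfolded n(2) rooted_ins[OF R(1)]] J(3,5) by simp
    qed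
  qed
qed

lemma ctree_representation: "tree_representation X F ctree"
  unfolding tree_representation_def
proof (intro conjI)
  show "oriented_tree ctree" by (rule G.oriented_tree)
  show "leaves ctree = Leaf ` X" by (rule ctree_leaves)
  show "internal_nodes ctree \<subseteq> range Inner" using N_sub ctree_leaves by (auto simp: internal_nodes_def ctree_sel)
  show "complete_nodes ctree \<subseteq> internal_nodes ctree"
  proof
    fix v assume v: "v \<in> complete_nodes ctree"
    then have "v \<in> N" "star (kap v)" by (auto simp: ctree_sel full_def rooted_def)
    then have "v \<notin> Leaf ` X" using kap_leaf_iff starD(3) by fastforce
    then show "v \<in> internal_nodes ctree" using \<open>v \<in> N\<close> ctree_leaves by (simp add: internal_nodes_def ctree_sel)
  qed
  have "{} \<in> F" "X \<in> F" using pcf by (auto simp: partitive_crossing_family_def)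
  then show "F = represented_sets ctree \<union> {{}, X}" using represented_mem mem_represented by blast
qed

lemma card_ctree: "card (nodes ctree) = card codes"
  using bij_betw_same_card[OF kap_bij] by (simp add: ctree_sel)

end

section \<open>Existence, uniqueness and size\<close>

lemma (in partitive_family) canonical_exists:
  "\<exists>T. tree_representation X F T \<and> card (nodes T) = card codes"
proof -
  obtain r where r: "r \<in> X" using two_le_card by fastforce
  define rest where "rest = codes - (\<lambda>x. {X - {x}}) ` X"
  have "finite rest" using codes_finite by (simp add: rest_def)
  then obtain h where h: "bij_betw h {0..<card rest} rest" using ex_bij_betw_nat_finite by blast
  define kap where "kap v = (case v of Leaf x \<Rightarrow> {X - {x}} | Inner i \<Rightarrow> h i)" for v :: "'a node"
  define N where "N = Leaf ` X \<union> Inner ` {0..<card rest}"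
  have hr: "h i \<in> rest" if "i < card rest" for i using h that by (auto simp: bij_betw_def)
  have "inj_on kap N"
  proof (rule inj_onI)
    fix u v assume u: "u \<in> N" and v: "v \<in> N" and e: "kap u = kap v"
    have no: "kap (Inner i) \<noteq> kap (Leaf x)" if "i < card rest" "x \<in> X" for i x
      using hr[OF that(1)] that(2) by (auto simp: kap_def rest_def)
    show "u = v"
    proof (cases u; cases v)
      fix x y assume uv: "u = Leaf x" "v = Leaf y"
      then have "x \<in> X" "y \<in> X" "X - {x} = X - {y}" using u v e by (auto simp: N_def kap_def)
      then show ?thesis using uv by blast
    next
      fix i j assume uv: "u = Inner i" "v = Inner j"
      then have "i < card rest" "j < card rest" "h i = h j" using u v e by (auto simp: N_def kap_def)
      then show ?thesis using h uv by (auto simp: bij_betw_def inj_on_def)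
    next
      fix x i assume uv: "u = Leaf x" "v = Inner i"
      then show ?thesis using u v e no[of i x] by (auto simp: N_def)
    next
      fix x i assume uv: "u = Inner i" "v = Leaf x"
      then show ?thesis using u v e no[of i x] by (auto simp: N_def)
    qed
  qed
  moreover have "kap ` N = codes"
  proof -
    have "kap ` N = (\<lambda>x. {X - {x}}) ` X \<union> h ` {0..<card rest}"
      unfolding N_def image_Un image_image by (simp add: kap_def)
    also have "h ` {0..<card rest} = rest" using h by (simp add: bij_betw_def)
    finally show ?thesis by (auto simp: rest_def codes_def)
  qed
  ultimately have "bij_betw kap N codes" by (simp add: bij_betw_def)
  then interpret C: canonical X F r kap N
    by unfold_locales (use r in \<open>auto simp: N_def kap_def\<close>)
  show ?thesis using C.ctree_representation C.card_ctree by blast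
qed

text \<open>Among the representations with fewest nodes one maximising a bounded weight is taken;
  each change forbidden by reducedness would increase the weight.\<close>

lemma reduced_exists:
  assumes T0: "tree_representation X F T0"
  shows "\<exists>T. reduced_tree_representation X F T"
proof -
  obtain T1 where T1: "tree_representation X F T1"
    and min: "\<And>T. tree_representation X F T \<Longrightarrow> card (nodes T1) \<le> card (nodes T)"
    using ex_has_least_nat[of "tree_representation X F" T0 "\<lambda>T. card (nodes T)"] T0 by blast
  define n where "n = card (nodes T1)"
  define PP where "PP T \<longleftrightarrow> tree_representation X F T \<and> card (nodes T) = n" for T
  \<comment> \<open>The second summand counts the nodes not labelled complete. Adding an arc or
    dropping a complete label raises \<open>w\<close> by one, and \<open>w\<close> is at most
    \<open>n * n + n\<close>.\<close>
  define w where "w T = card (arcs T) + (n - card (complete_nodes T))" for T :: "'a otree"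
  have fin: "finite (nodes T)" "finite (arcs T)" "card (arcs T) \<le> n * n" "complete_nodes T \<subseteq> nodes T"
    "finite (complete_nodes T)" if "PP T" for T
  proof -
    show f: "finite (nodes T)" using that by (auto simp: PP_def tree_representation_def oriented_tree_def)
    have a: "arcs T \<subseteq> nodes T \<times> nodes T" using that by (auto simp: PP_def tree_representation_def oriented_tree_def)
    have ff: "finite (nodes T \<times> nodes T)" using f by simp
    show "finite (arcs T)" using finite_subset[OF a ff] .
    show "card (arcs T) \<le> n * n" using card_mono[OF ff a] that by (simp add: PP_def card_cartesian_product)
    show c: "complete_nodes T \<subseteq> nodes T" using that by (auto simp: PP_def tree_representation_def internal_nodes_def)
    show "finite (complete_nodes T)" using finite_subset[OF c f] .
  qed
  have "\<forall>T. PP T \<longrightarrow> w T < Suc (n * n + n)"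
  proof (intro allI impI)
    fix T assume "PP T"
    then show "w T < Suc (n * n + n)" using fin(3)[of T] by (simp add: w_def)
  qed
  moreover have "PP T1" using T1 by (simp add: PP_def n_def)
  ultimately obtain T where T: "PP T" and mx: "\<And>T'. PP T' \<Longrightarrow> w T' \<le> w T"
    using ex_has_greatest_nat[of PP T1 w] by blast
  have "reduced_tree_representation X F T"
    unfolding reduced_tree_representation_def
  proof (intro conjI allI impI ballI notI)
    show "tree_representation X F T" using T by (simp add: PP_def)
    show "card (nodes T) \<le> card (nodes T')" if "tree_representation X F T'" for T'
      using min[OF that] T by (simp add: PP_def n_def)
  next
    fix u v assume uv: "(u, v) \<in> arcs T \<and> (v, u) \<notin> arcs T"
      and r: "tree_representation X F (T\<lparr>arcs := insert (v, u) (arcs T)\<rparr>)"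
    have "PP (T\<lparr>arcs := insert (v, u) (arcs T)\<rparr>)" using r T by (simp add: PP_def)
    then show False using mx[of "T\<lparr>arcs := insert (v, u) (arcs T)\<rparr>"] uv fin(2)[OF T] by (simp add: w_def)
  next
    fix v assume v: "v \<in> complete_nodes T"
      and r: "tree_representation X F (T\<lparr>complete_nodes := complete_nodes T - {v}\<rparr>)"
    have "PP (T\<lparr>complete_nodes := complete_nodes T - {v}\<rparr>)" using r T by (simp add: PP_def)
    then have "w (T\<lparr>complete_nodes := complete_nodes T - {v}\<rparr>) \<le> w T" by (rule mx)
    moreover have "card (complete_nodes T) \<le> n" using card_mono[OF fin(1)[OF T] fin(4)[OF T]] T by (simp add: PP_def)
    moreover have "card (complete_nodes T) \<noteq> 0" using v fin(5)[OF T] by auto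
    ultimately show False using v fin(5)[OF T] by (simp add: w_def)
  qed
  then show ?thesis ..
qed

lemma (in partitive_family) reduced_unique:
  "\<exists>T. reduced_tree_representation X F T \<and> otree_size T \<le> 12 * card X \<and>
     (\<forall>T'. reduced_tree_representation X F T' \<longrightarrow> otree_iso T T')"
proof -
  obtain T0 where T0: "tree_representation X F T0" "card (nodes T0) = card codes" using canonical_exists by blast
  have fam: "reduced_family X F T" if T: "reduced_tree_representation X F T" for T
  proof -
    have "tree_representation X F T" "card (nodes T) \<le> card (nodes T0)"
      using T T0(1) by (simp_all add: reduced_tree_representation_def)
    then show ?thesis using T T0(2) by unfold_locales simp_all
  qed
  obtain T where T: "reduced_tree_representation X F T" using reduced_exists[OF T0(1)] ..
  interpret reduced_family X F T by (rule fam[OF T])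
  show ?thesis using T otree_size_le reduced_representations_isomorphic[OF fam[OF T] fam] by blast
qed

text \<open>Here \<open>F\<close> has only the trivial members, and the tree consisting of the
  leaves alone represents it. A minimal representation has no further node, hence no arc and no
  complete node.\<close>

lemma reduced_unique_small:
  assumes X: "finite X" "card X \<le> 1" and pcf: "partitive_crossing_family X F"
  shows "\<exists>T. reduced_tree_representation X F T \<and> otree_size T \<le> 12 * card X \<and>
     (\<forall>T'. reduced_tree_representation X F T' \<longrightarrow> otree_iso T T')"
proof -
  have XX: "x = y" if "x \<in> X" "y \<in> X" for x y
    using card_ge_2[OF X(1) that] X(2) by force
  have FX: "F = {{}, X}"
  proof
    show "F \<subseteq> {{}, X}"
    proof
      fix A assume "A \<in> F"
      then have "A \<subseteq> X" using pcf by (auto simp: partitive_crossing_family_def)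
      then show "A \<in> {{}, X}" using XX by blast
    qed
    show "{{}, X} \<subseteq> F" using pcf by (auto simp: partitive_crossing_family_def)
  qed
  define T where "T = \<lparr>nodes = Leaf ` X, arcs = {}, complete_nodes = {}\<rparr>"
  have T: "nodes T = Leaf ` X" "arcs T = {}" "complete_nodes T = {}" by (simp_all add: T_def)
  have adj: "\<not> adjacent T u v" for u v by (simp add: adjacent_def T)
  have lv: "leaves T = Leaf ` X" by (simp add: leaves_def T adj)
  have cl: "card (Leaf ` X) = card X" by (rule card_image) (simp add: inj_on_def)
  have "oriented_tree T"
    unfolding oriented_tree_def
  proof (intro conjI ballI allI)
    fix u v assume uv: "u \<in> nodes T" "v \<in> nodes T"
    then have "u = v" using XX by (auto simp: T)
    show "\<exists>!p. simple_path T u p v"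
    proof (rule ex1I[of _ "[u]"])
      show "simple_path T u [u] v" using uv \<open>u = v\<close> by (simp add: simple_path_def)
      fix p assume p: "simple_path T u p v"
      then obtain q where q: "p = u # q" by (cases p) (auto simp: simple_path_def)
      have "q = []" using p q adj by (cases q) (auto simp: simple_path_def)
      then show "p = [u]" using q by simp
    qed
  qed (use X in \<open>simp_all add: T\<close>)
  then have rep: "tree_representation X F T"
    by (auto simp: tree_representation_def lv T internal_nodes_def represented_sets_def prime_nodes_def FX)
  have min: "Leaf ` X \<subseteq> nodes T'" "finite (nodes T')" if "tree_representation X F T'" for T'
    using that by (auto simp: tree_representation_def leaves_def oriented_tree_def)
  have red: "reduced_tree_representation X F T"
    unfolding reduced_tree_representation_def using rep card_mono[OF min(2,1)] by (auto simp: T)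
  moreover have "otree_size T \<le> 12 * card X" by (simp add: otree_size_def T cl)
  moreover have "otree_iso T T'" if T': "reduced_tree_representation X F T'" for T'
  proof -
    have r: "tree_representation X F T'" "card (nodes T') \<le> card (Leaf ` X)"
      using T' rep T(1) unfolding reduced_tree_representation_def by metis+
    have n: "nodes T' = Leaf ` X" using card_seteq[OF min(2,1)[OF r(1)] r(2)] by simp
    have a: "arcs T' \<subseteq> nodes T' \<times> nodes T'" "\<And>v. (v, v) \<notin> arcs T'"
      using r(1) by (auto simp: tree_representation_def oriented_tree_def)
    have "(u, v) \<notin> arcs T'" for u v
    proof
      assume uv: "(u, v) \<in> arcs T'"
      then have "u \<in> Leaf ` X" "v \<in> Leaf ` X" using a(1) n by auto
      then have "u = v" using XX by blast
      then show False using uv a(2) by simp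
    qed
    then have "arcs T' = {}" by auto
    moreover have "complete_nodes T' = {}"
      using r(1) n by (auto simp: tree_representation_def internal_nodes_def)
    ultimately show ?thesis unfolding otree_iso_def using n T
      by (intro exI[of _ id]) (auto simp: bij_betw_def)
  qed
  ultimately show ?thesis by blast
qed

theorem mainTheorem6:
  shows "\<exists>c::nat. \<forall>(X :: 'a set) E I.
    symmetric_2_structure X E \<longrightarrow> involution_without_fixed_point (colours X E) I \<longrightarrow>
    partitive_crossing_family X (involution_modules X E I) \<and>
    (\<exists>T. reduced_tree_representation X (involution_modules X E I) T \<and>
         otree_size T \<le> c * card X \<and>
         (\<forall>T'. reduced_tree_representation X (involution_modules X E I) T' \<longrightarrow> otree_iso T T'))"
proof (intro exI[of _ 12] allI impI)
  fix X :: "'a set" and E I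
  assume "symmetric_2_structure X E" "involution_without_fixed_point (colours X E) I"
  then interpret coloured_structure X E I by unfold_locales
  let ?F = "involution_modules X E I"
  note pcf = partitive_crossing_family_modules
  have "\<exists>T. reduced_tree_representation X ?F T \<and> otree_size T \<le> 12 * card X \<and>
      (\<forall>T'. reduced_tree_representation X ?F T' \<longrightarrow> otree_iso T T')"
  proof (cases "2 \<le> card X")
    case True
    interpret partitive_family X ?F
      by unfold_locales (use True finite_ground pcf singleton_module in auto)
    show ?thesis by (rule reduced_unique)
  next
    case False
    then show ?thesis using reduced_unique_small[OF finite_ground _ pcf] by simp
  qed
  then show "partitive_crossing_family X ?F \<and>
    (\<exists>T. reduced_tree_representation X ?F T \<and> otree_size T \<le> 12 * card X \<and>
         (\<forall>T'. reduced_tree_representation X ?F T' \<longrightarrow> otree_iso T T'))"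
    using pcf by blast
qed

end
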